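(* Let $a,b,c,d,e,f$ be nonzero complex numbers. Then $${}_8W_7\Bigl(a;b,c,d,e,f;\tfrac{a^2q^2}{bcdef}\Bigr)$$ $$=\frac{(aq,b,\frac ba,\frac{bq}{a},\frac{cq}{a},\frac{dq}{a},\frac{eq}{a},\frac{fq}{a},\frac{aq}{cd},\frac{aq}{ce},\frac{aq}{cf},\frac{aq}{de},\frac{aq}{df},\frac{aq}{ef},\frac{bcdef}{a^2q})_\infty}{(\frac{q^2}{a},\frac qc,\frac qd,\frac qe,\frac qf,\frac{aq}{c},\frac{aq}{d},\frac{aq}{e},\frac{aq}{f},\frac{bc}{a},\frac{bd}{a},\frac{be}{a},\frac{bf}{a},\frac{cdef}{a^2},\frac{a^2q}{cdef})_\infty}\;{}_8W_7\Bigl(\tfrac qa;\tfrac qb,\tfrac qc,\tfrac qd,\tfrac qe,\tfrac qf;\tfrac{bcdef}{a^2q}\Bigr)$$ $$+\frac{(aq,c,\frac ca,\frac{bq}{a},\frac{bq}{d},\frac{bq}{e},\frac{bq}{f},\frac{aq}{bd},\frac{aq}{be},\frac{aq}{bf})_\infty}{(\frac{b^2q}{a},\frac qd,\frac qe,\frac qf,\frac cb,\frac{aq}{b},\frac{aq}{d},\frac{aq}{e},\frac{aq}{f},\frac{bc}{a})_\infty}$$ $$\times\left[1-\frac{(b,\frac qb,\frac ab,\frac{bq}{a},\frac{cd}{a},\frac{aq}{cd},\frac{ce}{a},\frac{aq}{ce},\frac{cfq}{a},\frac{a}{cf},\frac{bdef}{a^2},\frac{a^2q}{bdef})_\infty}{(c,\frac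 qc,\frac ac,\frac{cq}{a},\frac{bd}{a},\frac{aq}{bd},\frac{be}{a},\frac{aq}{be},\frac{bfq}{a},\frac{a}{bf},\frac{cdef}{a^2},\frac{a^2q}{cdef})_\infty}\right]{}_8W_7\Bigl(\tfrac{b^2}{a};b,\tfrac{bc}{a},\tfrac{bd}{a},\tfrac{be}{a},\tfrac{bf}{a};\tfrac{a^2q^2}{bcdef}\Bigr).$$
   Context: Throughout $q\in\mathbb C$, $0<|q|<1$; $(x)_0=1$, $(x)_k=\prod_{j=0}^{k-1}(1-xq^j)$, $(x)_\infty=\prod_{j\ge 0}(1-xq^j)$, $(x_1,\dots,x_r)_k=\prod_i (x_i)_k$. The very-well-poised series is $${}_8W_7(a;p_1,\dots,p_5;z)=\sum_{k=0}^\infty \frac{1-aq^{2k}}{1-a}\,\frac{(a,p_1,\dots,p_5)_k}{(q,aq/p_1,\dots,aq/p_5)_k}\,z^k,\qquad z=\frac{a^2q^2}{p_1\cdots p_5},$$ for $|z|<1$, and its analytic continuation in the parameters otherwise. Standing assumption: parameters are such that no zero denominators (singularities) occur. *)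

theory Defs
  imports "HOL-Analysis.Analysis" "HOL-Complex_Analysis.Complex_Analysis"
begin

definition qpoch :: "complex \<Rightarrow> complex \<Rightarrow> nat \<Rightarrow> complex" where
  "qpoch q x k = (\<Prod>j<k. 1 - x * q ^ j)"

definition qpoch_inf :: "complex \<Rightarrow> complex \<Rightarrow> complex" where
  "qpoch_inf q x = (\<Prod>j. 1 - x * q ^ j)"

definition qpochs :: "complex \<Rightarrow> complex list \<Rightarrow> nat \<Rightarrow> complex" where
  "qpochs q xs k = (\<Prod>x\<leftarrow>xs. qpoch q x k)"

definition qpochs_inf :: "complex \<Rightarrow> complex list \<Rightarrow> complex" where
  "qpochs_inf q xs = (\<Prod>x\<leftarrow>xs. qpoch_inf q x)"

text \<open>The argument of the series \<open>8W7(a; p1, ..., p5; z)\<close> is a function of the other parameters,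
  so it is not passed separately.  The list \<open>ps\<close> is always \<open>[p1, ..., p5]\<close>.\<close>

definition W87_arg :: "complex \<Rightarrow> complex \<Rightarrow> complex list \<Rightarrow> complex" where
  "W87_arg q a ps = a ^ 2 * q ^ 2 / prod_list ps"

definition W87_series :: "complex \<Rightarrow> complex \<Rightarrow> complex list \<Rightarrow> complex" where
  "W87_series q a ps =
     (\<Sum>k. (1 - a * q ^ (2 * k)) / (1 - a)
          * (qpochs q (a # ps) k / qpochs q (q # map (\<lambda>p. a * q / p) ps) k)
          * W87_arg q a ps ^ k)"

text \<open>The nonsingular parameters.  The conditions on \<open>a\<close> and on \<open>a q / p\<close> say that the terms of the
  series have no zero denominators.  The remaining singularities of the continued function are
  the poles at \<open>z = q ^ (-n)\<close>, \<open>n \<ge> 0\<close>: for large \<open>k\<close> the coefficient of \<open>z ^ k\<close> is a convergent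
  power series in \<open>q ^ k\<close>, and \<open>(\<Sum>k. q ^ (n * k) * z ^ k) = 1 / (1 - z * q ^ n)\<close>.\<close>

definition W87_domain :: "complex \<Rightarrow> (complex \<times> complex list) set" where
  "W87_domain q = {(a, ps). length ps = 5 \<and> a \<noteq> 0 \<and> 1 - a \<noteq> 0 \<and>
     (\<forall>p\<in>set ps. p \<noteq> 0 \<and> (\<forall>n. 1 - a * q / p * q ^ n \<noteq> 0)) \<and>
     (\<forall>n. 1 - W87_arg q a ps * q ^ n \<noteq> 0)}"

text \<open>Analyticity in the six parameters is expressed as holomorphy in each of them separately,
  which is the same as joint holomorphy by Hartogs' theorem.\<close>

definition W87_continuation :: "complex \<Rightarrow> (complex \<Rightarrow> complex list \<Rightarrow> complex) \<Rightarrow> bool" where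
  "W87_continuation q F \<longleftrightarrow>
     (\<forall>a ps. (a, ps) \<in> W87_domain q \<and> norm (W87_arg q a ps) < 1 \<longrightarrow> F a ps = W87_series q a ps) \<and>
     (\<forall>ps. (\<lambda>x. F x ps) holomorphic_on {x. (x, ps) \<in> W87_domain q}) \<and>
     (\<forall>a ps. \<forall>i<5. (\<lambda>x. F a (ps[i := x])) holomorphic_on {x. (a, ps[i := x]) \<in> W87_domain q})"

text \<open>The continuation is unique on the domain: for fixed \<open>a, p1, ..., p4\<close> the admissible \<open>p5\<close>
  form a connected open set, which contains all admissible \<open>p5\<close> of large modulus.\<close>

definition W87 :: "complex \<Rightarrow> complex \<Rightarrow> complex list \<Rightarrow> complex" where
  "W87 q a ps =
     (if norm (W87_arg q a ps) < 1 then W87_series q a ps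
      else (THE w. \<exists>F. W87_continuation q F \<and> w = F a ps))"

text \<open>The arguments of the three series in the theorem.\<close>

lemma W87_arg_1: "W87_arg q a [b, c, d, e, f] = a ^ 2 * q ^ 2 / (b * c * d * e * f)"
  by (simp add: W87_arg_def mult.assoc)

lemma W87_arg_2:
  assumes "q \<noteq> 0" "a \<noteq> 0" "b \<noteq> 0" "c \<noteq> 0" "d \<noteq> 0" "e \<noteq> 0" "f \<noteq> 0"
  shows "W87_arg q (q / a) [q / b, q / c, q / d, q / e, q / f] = b * c * d * e * f / (a ^ 2 * q)"
  using assms by (simp add: W87_arg_def field_simps power2_eq_square)

lemma W87_arg_3:
  assumes "a \<noteq> 0" "b \<noteq> 0" "c \<noteq> 0" "d \<noteq> 0" "e \<noteq> 0" "f \<noteq> 0"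
  shows "W87_arg q (b ^ 2 / a) [b, b * c / a, b * d / a, b * e / a, b * f / a]
           = a ^ 2 * q ^ 2 / (b * c * d * e * f)"
  using assms by (simp add: W87_arg_def field_simps power2_eq_square)

end

theory Submission
  imports Defs
begin

text \<open>
  Write \<open>a = t\<^sub>0\<^sup>2\<close> and let the five parameters be \<open>t\<^sub>0 t\<^sub>i\<close>, \<open>i = 1, \<dots>, 5\<close>.  The series based at \<open>t\<^sub>i\<close>, with
  parameters \<open>t\<^sub>i t\<^sub>j\<close>, all have the same argument, and up to infinite products they are the values at
  \<open>y = t\<^sub>i\<close> of one bilateral sum \<open>H(y)\<close>.  This \<open>H\<close> is an odd theta function of degree six, an element of a
  two-dimensional space, so any three of its values are linearly related.  The transformation of
  \<open>8W7\<close> series into \<open>8W7\<close> series acts on the twelve series based at \<open>t\<^sub>i\<close> and at the inverted parameters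
  \<open>q\<^sup>1\<^sup>/\<^sup>2/t\<^sub>i\<close>, and carries this relation to one between the bases \<open>t\<^sub>1\<close>, \<open>t\<^sub>2\<close> and \<open>q\<^sup>1\<^sup>/\<^sup>2/t\<^sub>0\<close>.  Eliminating the
  series based at \<open>t\<^sub>2\<close> from the two relations gives the theorem.

  The transformation is first proved for \<open>f = q\<^sup>-\<^sup>n\<close>, where both sides reduce by Watson's argument to the same
  terminating sum, and extends to all \<open>f\<close> by the identity theorem in \<open>1/f\<close>.  Genericity
  assumptions are avoided by working with the series multiplied by its denominators, which is
  analytic in all nonzero parameters.
\<close>

text \<open>The arguments of the original and of the inverted series multiply to \<open>q\<close>,
  so both series converge only if the modulus of \<open>z\<close> lies strictly between
  \<open>norm q\<close> and 1. The identities must therefore hold between continuations, and the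
  continuation has to be constructed. The first-order recurrence of the coefficients supplies it,
  and the factor \<open>(z)_inf\<close> removes its poles at \<open>z = q^(-n)\<close>.

  In the symmetric coordinates the transformation is a dilation: with
  \<open>\<rho>^2 = q/(t1*t2*t3*t4)\<close> it multiplies \<open>t1, ..., t4\<close> by
  \<open>\<rho>\<close> and divides \<open>t0\<close> and \<open>t5\<close> by
  \<open>\<rho>\<close>. The three-term relation holds for any six nonzero numbers, hence for the
  dilated ones, and a second application of the transformation leads from the base
  \<open>t5/\<rho>\<close> to the inverted series.

  Auxiliary nonvanishing conditions are removed by moving the parameters along a curve in
  \<open>s\<close> that passes through the given ones at \<open>s = 1\<close>. The exponents of
  \<open>s\<close> are chosen so that each condition fails for countably many \<open>s\<close> only;
  continuity at 1 does the rest.\<close>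

lemma norm_prod_1_minus_le_exp:
  fixes w :: "nat \<Rightarrow> complex"
  shows "norm (\<Prod>j<n. 1 - w j) \<le> exp (\<Sum>j<n. norm (w j))"
proof -
  have "norm (\<Prod>j<n. 1 - w j) = (\<Prod>j<n. norm (1 - w j))" by (simp add: prod_norm)
  also have "\<dots> \<le> (\<Prod>j<n. exp (norm (w j)))"
  proof (rule prod_mono, safe)
    fix j
    have "norm (1 - w j) \<le> 1 + norm (w j)" by (metis norm_one norm_triangle_ineq4)
    also have "\<dots> \<le> exp (norm (w j))" by (rule exp_ge_add_one_self)
    finally show "norm (1 - w j) \<le> exp (norm (w j))" .
  qed auto
  finally show ?thesis by (simp add: exp_sum)
qed

text \<open>If the values at 1 differed, the functions would differ on a whole ball around 1, which
  is uncountable. This is the device that removes genericity conditions: \<open>s\<close>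
  parametrises a curve and \<open>B\<close> collects its exceptional points.\<close>

lemma eq_at_1_if_eq_off_countable:
  fixes f g :: "complex \<Rightarrow> complex"
  assumes "isCont f 1" "isCont g 1" "countable B"
    and eq: "\<And>s. s \<notin> B \<Longrightarrow> s \<noteq> 0 \<Longrightarrow> f s = g s"
  shows "f 1 = g 1"
proof (rule ccontr)
  assume "f 1 \<noteq> g 1"
  moreover have "isCont (\<lambda>s. f s - g s) 1" using assms(1,2) by (intro continuous_intros)
  ultimately obtain r where r: "r > 0" "\<And>s. dist 1 s < r \<Longrightarrow> f s - g s \<noteq> 0"
    using continuous_at_avoid[of 1 "\<lambda>s. f s - g s" 0] by auto
  have "ball 1 r \<subseteq> B \<union> {0}"
    using r(2) eq by fastforce
  then have "countable (ball (1::complex) r)"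
    using \<open>countable B\<close> by (meson countable_Un countable_subset countable_finite finite.emptyI finite_insert)
  then show False using uncountable_ball[OF r(1)] by blast
qed

lemma suminf_holomorphic_on:
  fixes w :: "nat \<Rightarrow> complex \<Rightarrow> complex"
  assumes "open S" "\<And>k. w k holomorphic_on S"
    and "\<And>x. x \<in> S \<Longrightarrow> \<exists>d>0. cball x d \<subseteq> S \<and> (\<exists>M. summable M \<and> (\<forall>k. \<forall>y\<in>cball x d. norm (w k y) \<le> M k))"
  shows "(\<lambda>x. \<Sum>k. w k x) holomorphic_on S"
proof (rule holomorphic_uniform_sequence[OF assms(1)])
  show "(\<lambda>x. \<Sum>k<n. w k x) holomorphic_on S" for n
    using assms(2) by (intro holomorphic_intros) auto
next
  fix x assume "x \<in> S"
  then obtain d M where "d > 0" "cball x d \<subseteq> S" "summable M" "\<forall>k. \<forall>y\<in>cball x d. norm (w k y) \<le> M k"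
    using assms(3) by meson
  moreover from this have "uniform_limit (cball x d) (\<lambda>n x. \<Sum>k<n. w k x) (\<lambda>x. \<Sum>k. w k x) sequentially"
    by (intro Weierstrass_m_test) auto
  ultimately show "\<exists>d>0. cball x d \<subseteq> S \<and>
      uniform_limit (cball x d) (\<lambda>n x. \<Sum>k<n. w k x) (\<lambda>x. \<Sum>k. w k x) sequentially" by blast
qed

lemma holomorphic_locally_bounded:
  fixes g :: "complex \<Rightarrow> complex"
  assumes "open S" "g holomorphic_on S" "x \<in> S"
  shows "\<exists>d>0. cball x d \<subseteq> S \<and> (\<exists>C. \<forall>y\<in>cball x d. norm (g y) \<le> C)"
proof -
  obtain d where d: "d > 0" "cball x d \<subseteq> S"
    using assms(1,3) open_contains_cball by blast
  have "continuous_on (cball x d) g"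
    using assms(2) d(2) holomorphic_on_imp_continuous_on holomorphic_on_subset by blast
  then have "bounded (g ` cball x d)"
    by (intro compact_imp_bounded compact_continuous_image) auto
  then show ?thesis using d by (auto simp: bounded_iff)
qed

section \<open>Finite and infinite q-shifted factorials\<close>

locale q_base =
  fixes q :: complex
  assumes q_nz: "q \<noteq> 0" and q_lt_1: "norm q < 1"
begin

abbreviation qfac :: "complex \<Rightarrow> nat \<Rightarrow> complex" where "qfac \<equiv> qpoch q"

abbreviation qinf :: "complex \<Rightarrow> complex" where "qinf \<equiv> qpoch_inf q"

lemma summable_qpow: "summable (\<lambda>j. norm (x*q^j))"
  using q_lt_1 by (simp add: norm_mult norm_power summable_mult summable_geometric)

lemma qpoch_tendsto: "(\<lambda>n. qfac x n) \<longlonglongrightarrow> qinf x"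
proof -
  have "abs_convergent_prod (\<lambda>j. 1 - x*q^j)"
    unfolding abs_convergent_prod_conv_summable using summable_qpow[of x] by simp
  then have "(\<lambda>n. \<Prod>j\<le>n. 1 - x*q^j) \<longlonglongrightarrow> qinf x"
    unfolding qpoch_inf_def
    by (intro convergent_prod_LIMSEQ abs_convergent_prod_imp_convergent_prod)
  then show ?thesis
    unfolding qpoch_def by (simp add: LIMSEQ_lessThan_iff_atMost)
qed

lemma qpoch_0 [simp]: "qfac x 0 = 1"
  by (simp add: qpoch_def)

lemma qpoch_Suc: "qfac x (Suc n) = qfac x n * (1 - x*q^n)"
  by (simp add: qpoch_def)

lemma qpoch_add: "qfac x (n + m) = qfac x n * qfac (x*q^n) m"
  by (induction m) (simp_all add: qpoch_Suc power_add mult.assoc)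

lemma qpoch_Suc': "qfac x (Suc n) = (1 - x) * qfac (x*q) n"
  using qpoch_add[of x 1 n] by (simp add: qpoch_Suc)

lemma qpoch_inf_split: "qinf x = qfac x n * qinf (x*q^n)"
proof -
  have "(\<lambda>m. qfac x (m + n)) \<longlonglongrightarrow> qinf x"
    using qpoch_tendsto by (rule LIMSEQ_ignore_initial_segment)
  then have "(\<lambda>m. qfac x n * qfac (x*q^n) m) \<longlonglongrightarrow> qinf x"
    by (simp only: qpoch_add[of x n, symmetric] add.commute[of n])
  moreover have "(\<lambda>m. qfac x n * qfac (x*q^n) m) \<longlonglongrightarrow> qfac x n * qinf (x*q^n)"
    by (intro tendsto_intros qpoch_tendsto)
  ultimately show ?thesis by (rule LIMSEQ_unique)
qed

lemma qpoch_inf_step: "qinf x = (1 - x) * qinf (x*q)"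
  using qpoch_inf_split[of x 1] by (simp add: qpoch_Suc)

text \<open>For \<open>norm x \<le> r\<close> each factor is at most
  \<open>1 + r * norm q^j \<le> exp (r * norm q^j)\<close>, and the exponents form a geometric
  series. The bound serves all finite products and the infinite one at once.\<close>

definition qbd :: "real \<Rightarrow> real" where "qbd r = exp (r/(1 - norm q))"

lemma qbd_mono: "r \<le> s \<Longrightarrow> qbd r \<le> qbd s"
  using q_lt_1 by (simp add: qbd_def divide_right_mono)

lemma qbd_ge_0: "qbd r \<ge> 0"
  by (simp add: qbd_def)

lemma norm_qpoch_le: "norm (qfac x n) \<le> qbd (norm x)"
proof -
  have "norm (qfac x n) \<le> exp (\<Sum>j<n. norm (x*q^j))"
    unfolding qpoch_def by (rule norm_prod_1_minus_le_exp)
  also have "(\<Sum>j<n. norm (x*q^j)) \<le> (\<Sum>j. norm (x*q^j))"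
    by (intro sum_le_suminf summable_qpow) auto
  also have "\<dots> = norm x/(1 - norm q)"
    using q_lt_1 by (simp add: norm_mult norm_power suminf_mult suminf_geometric)
  finally show ?thesis by (simp add: qbd_def)
qed

lemma norm_qpoch_inf_le: "norm (qinf x) \<le> qbd (norm x)"
  by (rule LIMSEQ_le_const2[OF tendsto_norm[OF qpoch_tendsto[of x]]]) (use norm_qpoch_le in blast)

lemma norm_qpoch_le': "norm x \<le> r \<Longrightarrow> norm (qfac x n) \<le> qbd r"
  using norm_qpoch_le qbd_mono order_trans by blast

lemma norm_qpoch_inf_le': "norm x \<le> r \<Longrightarrow> norm (qinf x) \<le> qbd r"
  using norm_qpoch_inf_le qbd_mono order_trans by blast

lemma qpoch_inf_eq_0_iff: "qinf x = 0 \<longleftrightarrow> (\<exists>n. x*q^n = 1)"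
proof
  assume *: "qinf x = 0"
  have c: "convergent_prod (\<lambda>j. 1 - x*q^j)"
    using summable_qpow[of x]
    by (intro abs_convergent_prod_imp_convergent_prod) (simp add: abs_convergent_prod_conv_summable)
  show "\<exists>n. x*q^n = 1"
    using * prodinf_nonzero[OF c] unfolding qpoch_inf_def by auto
next
  assume "\<exists>n. x*q^n = 1"
  then obtain n where "x*q^n = 1" ..
  then have "qfac x (Suc n) = 0" by (simp add: qpoch_Suc)
  then show "qinf x = 0" using qpoch_inf_split[of x "Suc n"] by simp
qed

lemma qpoch_inf_nz: "(\<And>n. 1 - x*q^n \<noteq> 0) \<Longrightarrow> qinf x \<noteq> 0"
  using qpoch_inf_eq_0_iff by auto

lemma qpoch_inf_q_nz: "qinf q \<noteq> 0"
proof -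
  have "q*q^n \<noteq> 1" for n
    using q_lt_1 power_less_one_iff[of "norm q" "Suc n"]
    by (metis norm_ge_zero norm_one norm_power order_less_irrefl power_Suc zero_less_Suc)
  then show ?thesis by (simp add: qpoch_inf_eq_0_iff)
qed

lemma qpoch_eq_0_imp: "qfac x n = 0 \<Longrightarrow> \<exists>k<n. x*q^k = 1"
  by (auto simp: qpoch_def)

lemma qpoch_nz_if_inf_nz: "qinf x \<noteq> 0 \<Longrightarrow> qfac x n \<noteq> 0"
  using qpoch_inf_split[of x n] by auto

lemma qpoch_holomorphic [holomorphic_intros]:
  "f holomorphic_on S \<Longrightarrow> (\<lambda>x. qfac (f x) n) holomorphic_on S"
  unfolding qpoch_def by (intro holomorphic_intros)

lemma qpoch_inf_entire: "qinf holomorphic_on UNIV"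
proof (rule holomorphic_uniform_sequence[of UNIV "\<lambda>n x. qfac x n"])
  show "(\<lambda>x. qfac x n) holomorphic_on UNIV" for n
    by (intro holomorphic_intros)
next
  fix x :: complex
  let ?B = "norm x + 1"
  have b: "norm y \<le> ?B" if "y \<in> cball x 1" for y
    using that norm_triangle_ineq2[of y x] by (simp add: dist_norm norm_minus_commute)
  have "uniformly_convergent_on (cball x 1) (\<lambda>N y. \<Prod>n<N. 1 - y*q^n)"
  proof (rule uniformly_convergent_on_prod')
    show "uniformly_convergent_on (cball x 1) (\<lambda>N y. \<Sum>n<N. norm (1 - y*q^n - 1))"
    proof (rule Weierstrass_m_test')
      show "norm (norm (1 - y*q^n - 1)) \<le> ?B * norm q^n" if "y \<in> cball x 1" for n y
        using b[OF that] by (simp add: norm_mult norm_power mult_right_mono)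
      show "summable (\<lambda>n. ?B * norm q^n)"
        using q_lt_1 by (simp add: summable_mult summable_geometric)
    qed
  qed (auto intro!: continuous_intros)
  then obtain l where l: "uniform_limit (cball x 1) (\<lambda>N y. \<Prod>n<N. 1 - y*q^n) l sequentially"
    by (auto simp: uniformly_convergent_on_def)
  have "l y = qinf y" if "y \<in> cball x 1" for y
    using LIMSEQ_unique[OF tendsto_uniform_limitI[OF l that]] qpoch_tendsto[of y] by (simp add: qpoch_def)
  then have "uniform_limit (cball x 1) (\<lambda>N y. qfac y N) (qinf) sequentially"
    using l uniform_limit_cong'[of "cball x 1" "\<lambda>N y. qfac y N" "\<lambda>N y. \<Prod>n<N. 1 - y*q^n" "qinf" l]
    by (simp add: qpoch_def)
  then show "\<exists>d>0. cball x d \<subseteq> UNIV \<and> uniform_limit (cball x d) (\<lambda>n x. qfac x n) (qinf) sequentially"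
    by (intro exI[of _ 1]) auto
qed auto

lemma qpoch_inf_holomorphic [holomorphic_intros]:
  assumes "f holomorphic_on S" shows "(\<lambda>x. qinf (f x)) holomorphic_on S"
  using holomorphic_on_compose_gen[OF assms qpoch_inf_entire] by (simp add: o_def)

section \<open>Terminating summations: the balanced 3phi2 and the very-well-poised 6phi5\<close>

text \<open>The variable \<open>X\<close> stands for \<open>q^n\<close>, so \<open>1/X\<close> is
  the terminating parameter. Keeping \<open>X\<close> free turns the step from \<open>n\<close> to
  \<open>n + 1\<close> into the substitution of \<open>X*q\<close> for \<open>X\<close>.\<close>

definition saalschuetz_term where
  "saalschuetz_term A B C X k = qfac A k * qfac B k * qfac (1/X) k
    / (qfac q k * qfac C k * qfac (A*B*q/(C*X)) k)*q^k"

text \<open>The \<open>q\<close>-WZ method: multiplying \<open>X = q\<^sup>n\<close> by \<open>q\<close> changes the partial sums by the explicit ratio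
  of the closed forms, up to a telescoped term that vanishes for \<open>m > n\<close>.\<close>

lemma saalschuetz_term_telescope:
  assumes nz: "A \<noteq> 0" "B \<noteq> 0" "C \<noteq> 0" "X \<noteq> 0"
    and den: "\<And>k. qfac q k \<noteq> 0" "\<And>k. qfac C k \<noteq> 0" "\<And>k. qfac (A*B/(C*X)) k \<noteq> 0"
    and X: "1 - C * X \<noteq> 0"
  shows "(\<Sum>k\<le>m. saalschuetz_term A B C (X*q) k)
    - (A - C*X) * (B - C*X)/((1 - C*X) * (A*B - C*X)) * (\<Sum>k\<le>m. saalschuetz_term A B C X k)
    = - saalschuetz_term A B C X m * ((1 - A*q^m) * (1 - B*q^m)) * (X * C/(q^m * ((1 - C*X) * (A*B - C*X))))"
proof (induction m)
  case 0
  have "A*B - C * X \<noteq> 0" using den(3)[of 1] nz by (simp add: qpoch_Suc field_simps)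
  then show ?case using nz X by (simp add: saalschuetz_term_def divide_simps) algebra
next
  case (Suc m)
  define y where "y = q^m"
  have y: "y \<noteq> 0" using q_nz by (simp add: y_def)
  define t where "t = saalschuetz_term A B C X m"
  define N where "N = (1 - A*y) * (1 - B*y)"
  \<comment> \<open>Up to the common factor \<open>N\<close>, \<open>c1\<close> and
    \<open>c2\<close> are the quotients by \<open>t\<close> of the next summand at \<open>X\<close>
    and at \<open>X*q\<close>. The induction step thereby becomes an identity between rational
    functions of \<open>y = q^m\<close>.\<close>
  define c1 where "c1 = (X - y)*q * C/((1 - q*y) * (1 - C*y) * (C*X - A*B*q*y))"
  define c2 where "c2 = (X*q - 1) * - C/((1 - q*y) * (1 - C*y) * (A*B - C*X))"
  have s: "A*B*q/(C * (X*q)) = A*B/(C*X)" using q_nz by simp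
  have s2: "qfac (A*B/(C*X)) (Suc k) = (1 - A*B/(C*X)) * qfac (A*B*q/(C*X)) k" for k
    by (simp add: qpoch_Suc')
  have s3: "qfac (1/(X*q)) (Suc k) = (1 - 1/(X*q)) * qfac (1/X) k" for k
    using q_nz by (simp add: qpoch_Suc')
  have "1 - q * y \<noteq> 0" "1 - C * y \<noteq> 0" "1 - A*B/(C*X)*q^Suc m \<noteq> 0" "1 - A*B/(C*X) \<noteq> 0"
    using den(1)[of "Suc m"] den(2)[of "Suc m"] den(3)[of "Suc (Suc m)"] den(3)[of 1]
    unfolding qpoch_Suc[of _ m] qpoch_Suc[of _ "Suc m"] y_def by (auto simp: qpoch_Suc)
  then have n: "1 - q * y \<noteq> 0" "1 - C * y \<noteq> 0" "C*X - A*B*q * y \<noteq> 0" "A*B - C * X \<noteq> 0"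
    using nz by (auto simp: y_def field_simps)
  have "saalschuetz_term A B C X (Suc m)
    = t * (N * ((1 - y/X)*q/((1 - q*y) * (1 - C*y) * (1 - A*B*q/(C*X) * y))))"
    unfolding t_def saalschuetz_term_def qpoch_Suc y_def N_def by (simp add: mult_ac)
  also have "(1 - y/X)*q/((1 - q*y) * (1 - C*y) * (1 - A*B*q/(C*X) * y)) = c1"
    unfolding c1_def using nz n by (simp add: divide_simps)
  finally have t1: "saalschuetz_term A B C X (Suc m) = t * (N*c1)" .
  have "saalschuetz_term A B C (X*q) (Suc m)
    = t * (N * ((1 - 1/(X*q))*q/((1 - q*y) * (1 - C*y) * (1 - A*B/(C*X)))))"
    unfolding t_def saalschuetz_term_def s s2 s3 unfolding qpoch_Suc y_def N_def by (simp add: mult_ac)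
  also have "(1 - 1/(X*q))*q/((1 - q*y) * (1 - C*y) * (1 - A*B/(C*X))) = c2"
    unfolding c2_def using nz n q_nz by (simp add: divide_simps) algebra
  finally have t2: "saalschuetz_term A B C (X*q) (Suc m) = t * (N*c2)" .
  have "c2 - (A - C*X) * (B - C*X)/((1 - C*X) * (A*B - C*X)) * c1 - X * C/(y * ((1 - C*X) * (A*B - C*X)))
    = - c1 * ((1 - A * (y*q)) * (1 - B * (y*q))) * (X * C/(y*q * ((1 - C*X) * (A*B - C*X))))"
    unfolding c1_def c2_def using nz n X y q_nz by (simp add: divide_simps) algebra
  then show ?case
    using Suc.IH unfolding sum.atMost_Suc t1 t2 t_def[symmetric] y_def[symmetric] power_Suc2 N_def[symmetric] by algebra
qed

lemma qpoch_qinv_pow_eq_0: "n < k \<Longrightarrow> qfac (1/q^n) k = 0"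
  using q_nz unfolding qpoch_def by (intro prod_zero) (auto intro!: bexI[of _ n])

lemma qpoch_q_nz: "qfac q k \<noteq> 0"
  by (rule qpoch_nz_if_inf_nz[OF qpoch_inf_q_nz])

lemma qpoch_step_nz: "(\<And>k. qfac x k \<noteq> 0) \<Longrightarrow> 1 - x*q^k \<noteq> 0"
  by (metis mult_zero_right qpoch_Suc)

text \<open>The induction on \<open>n\<close> passes through all values \<open>X = q^(m+1)\<close>
  with \<open>m < n\<close>, whose lower parameters are the \<open>A*B/(C*q^m)\<close>; this is the
  origin of the second nonvanishing hypothesis.\<close>

lemma saalschuetz:
  assumes nz: "A \<noteq> 0" "B \<noteq> 0" "C \<noteq> 0"
    and C: "\<And>k. qfac C k \<noteq> 0"
    and Z: "\<And>k m. m < n \<Longrightarrow> qfac (A*B/(C*q^m)) k \<noteq> 0"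
  shows "(\<Sum>k\<le>n. saalschuetz_term A B C (q^n) k)
    = qfac (C/A) n * qfac (C/B) n/(qfac C n * qfac (C/(A*B)) n)"
  using Z
proof (induction n)
  case 0
  then show ?case by (simp add: saalschuetz_term_def)
next
  case (Suc n)
  have st: "C \<noteq> 0" "q^n \<noteq> 0" "1 - C*q^n \<noteq> 0" using nz q_nz qpoch_step_nz[OF C] by auto
  have "saalschuetz_term A B C (q^n) (Suc n) = 0"
    by (simp add: saalschuetz_term_def qpoch_qinv_pow_eq_0)
  moreover have "(A - C*q^n) * (B - C*q^n)/((1 - C*q^n) * (A*B - C*q^n))
    = (1 - C*q^n/A) * (1 - C*q^n/B)/((1 - C*q^n) * (1 - C*q^n/(A*B)))"
    using nz by (simp add: divide_simps)
  ultimately have "(\<Sum>k\<le>Suc n. saalschuetz_term A B C (q^Suc n) k)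
    = (1 - C*q^n/A) * (1 - C*q^n/B)/((1 - C*q^n) * (1 - C*q^n/(A*B)))
    * (\<Sum>k\<le>n. saalschuetz_term A B C (q^n) k)"
    using saalschuetz_term_telescope[of A B C "q^n" "Suc n"] nz st qpoch_q_nz C Suc.prems[of n] by (simp add: mult.commute[of q])
  then show ?case
    using Suc by (simp add: qpoch_Suc mult_ac)
qed

text \<open>The summand of the 6phi5 series with \<open>X\<close> for \<open>q^n\<close>, but
  without the very-well-poised factor \<open>1 - a*q^k*q^k\<close>, which the sums carry
  separately.\<close>

definition rogers_term where
  "rogers_term a b c X k = qfac a k * qfac b k * qfac c k * qfac (1/X) k
    / (qfac q k * qfac (a*q/b) k * qfac (a*q/c) k * qfac (a*q*X) k)
    * (a*q*X/(b*c))^k"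

text \<open>The same method as for the balanced sum: the partial sums at \<open>X*q\<close> and
  \<open>X\<close>, compared with the quotient of the closed forms, differ by one boundary term,
  which contains the summand of index \<open>m\<close>.\<close>

lemma rogers_term_telescope:
  assumes nz: "a \<noteq> 0" "b \<noteq> 0" "c \<noteq> 0" "X \<noteq> 0"
    and den: "\<And>k. qfac q k \<noteq> 0" "\<And>k. qfac (a*q/b) k \<noteq> 0" "\<And>k. qfac (a*q/c) k \<noteq> 0" "\<And>k. qfac (a*q*X) k \<noteq> 0"
    and X: "b - a*q * X \<noteq> 0" "c - a*q * X \<noteq> 0"
  shows "(\<Sum>k\<le>m. (1 - a*q^k*q^k) * rogers_term a b c (X*q) k)
    - (1 - a*q*X) * (b*c - a*q*X)/((b - a*q*X) * (c - a*q*X))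
    * (\<Sum>k\<le>m. (1 - a*q^k*q^k) * rogers_term a b c X k)
    = rogers_term a b c X m * ((1 - a*q^m) * (1 - b*q^m) * (1 - c*q^m))
    * ((1 - a*q*X) * (a*q*X)/((b - a*q*X) * (c - a*q*X) * (1 - a*q*X*q^m)))"
proof -
  have step: "1 - x*q^k \<noteq> 0" if "\<And>k. qfac x k \<noteq> 0" for x k
    by (metis that mult_zero_right qpoch_Suc)
  have X8: "1 - a*q * X \<noteq> 0" using step[OF den(4), of 0] by simp
  show ?thesis
  proof (induction m)
    case 0
    then show ?case using nz X X8 by (simp add: rogers_term_def divide_simps) algebra
  next
    case (Suc m)
    define y where "y = q^m"
    have y: "y \<noteq> 0" using q_nz by (simp add: y_def)
    define t where "t = rogers_term a b c X m"
    define N where "N = (1 - a*y) * (1 - b*y) * (1 - c*y)"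
    define c1 where "c1 = (X - y) * (a*q)/((1 - q*y) * (b - a*q*y) * (c - a*q*y) * (1 - a*q*X*y))"
    define c2 where "c2 = (X*q - 1) * (y * (a*q)) * (1 - a*q*X)
    / ((1 - q*y) * (b - a*q*y) * (c - a*q*y) * (1 - a*q*X*y) * (1 - a*q*X * (y*q)))"
    have n0: "1 - q * y \<noteq> 0" "1 - a*q/b * y \<noteq> 0" "1 - a*q/c * y \<noteq> 0" "1 - a*q*X * y \<noteq> 0"
      "1 - a*q*X*q^Suc m \<noteq> 0"
      using step[OF den(1)] step[OF den(2)] step[OF den(3)] step[OF den(4)] unfolding y_def by blast+
    then have n: "1 - q * y \<noteq> 0" "b - a*q * y \<noteq> 0" "c - a*q * y \<noteq> 0" "1 - a*q*X * y \<noteq> 0" "1 - a*q*X * (y*q) \<noteq> 0"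
      using nz by (auto simp: y_def field_simps)
    have s2: "qfac (a*q * (X*q)) (Suc m) = qfac (a*q*X) m * (1 - a*q*X*y) * (1 - a*q*X * (y*q))/(1 - a*q*X)"
    proof -
      have "qfac (a*q*X) (Suc (Suc m)) = (1 - a*q*X) * qfac (a*q * (X*q)) (Suc m)"
        by (subst qpoch_Suc') (simp add: mult_ac)
      then have "qfac (a*q * (X*q)) (Suc m) * (1 - a*q*X) = qfac (a*q*X) m * (1 - a*q*X*y) * (1 - a*q*X * (y*q))"
        unfolding qpoch_Suc[of "a*q*X"] y_def power_Suc2 by (simp only: mult.commute[of "1 - a*q*X" "qfac _ _"])
      then show ?thesis using X8 by (metis nonzero_eq_divide_eq)
    qed
    have s3: "qfac (1/(X*q)) (Suc m) = (1 - 1/(X*q)) * qfac (1/X) m"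
      using q_nz by (simp add: qpoch_Suc')
    have s4: "(a*q * (X*q)/(b*c))^Suc m = (a*q*X/(b*c))^m * (y * (a*q*X*q/(b*c)))"
      unfolding y_def power_Suc by (simp add: power_mult_distrib power_divide mult_ac)
    have "rogers_term a b c X (Suc m)
    = t * (N * ((1 - y/X) * (a*q*X/(b*c))/((1 - q*y) * (1 - a*q/b*y) * (1 - a*q/c*y) * (1 - a*q*X*y))))"
      unfolding t_def rogers_term_def qpoch_Suc y_def N_def by (simp add: mult_ac)
    also have "(1 - y/X) * (a*q*X/(b*c))/((1 - q*y) * (1 - a*q/b*y) * (1 - a*q/c*y) * (1 - a*q*X*y)) = c1"
      unfolding c1_def using nz n by (simp add: divide_simps)
    finally have t1: "rogers_term a b c X (Suc m) = t * (N*c1)" .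
    have "rogers_term a b c (X*q) (Suc m) = t * (N * ((1 - 1/(X*q)) * (y * (a*q*X*q/(b*c))) * (1 - a*q*X)
    / ((1 - q*y) * (1 - a*q/b*y) * (1 - a*q/c*y) * (1 - a*q*X*y) * (1 - a*q*X * (y*q)))))"
      unfolding t_def rogers_term_def s2 s3 s4 unfolding qpoch_Suc y_def[symmetric] N_def by (simp add: mult_ac)
    also have "(1 - 1/(X*q)) * (y * (a*q*X*q/(b*c))) * (1 - a*q*X)
    / ((1 - q*y) * (1 - a*q/b*y) * (1 - a*q/c*y) * (1 - a*q*X*y) * (1 - a*q*X * (y*q))) = c2"
      unfolding c2_def using nz n q_nz by (simp add: divide_simps)
    finally have t2: "rogers_term a b c (X*q) (Suc m) = t * (N*c2)" .
    have "(1 - a * (y*q) * (y*q)) * (c2 - (1 - a*q*X) * (b*c - a*q*X)/((b - a*q*X) * (c - a*q*X)) * c1)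
    + (1 - a*q*X) * (a*q*X)/((b - a*q*X) * (c - a*q*X) * (1 - a*q*X*y))
    = c1 * ((1 - a * (y*q)) * (1 - b * (y*q)) * (1 - c * (y*q)))
    * ((1 - a*q*X) * (a*q*X)/((b - a*q*X) * (c - a*q*X) * (1 - a*q*X * (y*q))))"
    proof -
      \<comment> \<open>The denominators are treated as independent letters here, so that only one
        polynomial identity remains for the actual expressions.\<close>
      have gen: "P * (u2/(d*E4*E5) - k/E67 * (u1/(d*E4))) + v/(E67*E4) = u1/(d*E4) * N' * (v/(E67*E5))"
        if "P * (u2 * E67 - k*u1*E5) + v * d*E5 = u1 * N' * v" "d \<noteq> 0" "E4 \<noteq> 0" "E5 \<noteq> 0" "E67 \<noteq> 0"
        for P u1 u2 d E4 E5 E67 k v N' :: complex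
        using that by (simp add: divide_simps) algebra
      show ?thesis unfolding c1_def c2_def by (rule gen, algebra) (use n X in simp_all)
    qed
    then show ?case
      using Suc.IH unfolding sum.atMost_Suc t1 t2 t_def[symmetric] y_def[symmetric] power_Suc2 N_def[symmetric] by algebra
  qed
qed

end

lemma sum_triangle_diag:
  fixes f :: "nat \<Rightarrow> nat \<Rightarrow> 'a::comm_monoid_add"
  shows "(\<Sum>k\<le>n. \<Sum>j\<le>k. f k j) = (\<Sum>j\<le>n. \<Sum>i\<le>n-j. f (i + j) j)"
  unfolding sum.Sigma[OF finite_atMost ballI[OF finite_atMost]]
  by (rule sum.reindex_bij_witness[of _ "\<lambda>(j, i). (i + j, j)" "\<lambda>(k, j). (j, k - j)"]) auto

context q_base
begin

lemma qpoch_nz_shift: "(\<And>k. qfac x k \<noteq> 0) \<Longrightarrow> qfac (x*q^m) k \<noteq> 0"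
  by (metis mult_zero_right qpoch_add)

text \<open>At \<open>m = n + 1\<close> the boundary term of the telescoping identity contains
  \<open>qfac (1/q^n) (n + 1) = 0\<close>, so the full sum satisfies a first-order recurrence in
  \<open>n\<close>.\<close>

lemma rogers_sum:
  assumes nz: "a \<noteq> 0" "b \<noteq> 0" "c \<noteq> 0"
    and den: "\<And>k. qfac (a*q/b) k \<noteq> 0" "\<And>k. qfac (a*q/c) k \<noteq> 0" "\<And>k. qfac (a*q) k \<noteq> 0"
  shows "(\<Sum>k\<le>n. (1 - a*q^k*q^k) * rogers_term a b c (q^n) k)
    = (1 - a) * qfac (a*q) n * qfac (a*q/(b*c)) n/(qfac (a*q/b) n * qfac (a*q/c) n)"
proof (induction n)
  case 0
  then show ?case by (simp add: rogers_term_def)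
next
  case (Suc n)
  have st: "q^n \<noteq> 0" "1 - a*q^n*q/b \<noteq> 0" "1 - a*q^n*q/c \<noteq> 0"
    using qpoch_step_nz[OF den(1), of n] qpoch_step_nz[OF den(2), of n] q_nz by (simp_all add: mult_ac)
  have "rogers_term a b c (q^n) (Suc n) = 0"
    by (simp add: rogers_term_def qpoch_qinv_pow_eq_0)
  moreover have "(1 - a*q*q^n) * (b*c - a*q*q^n)/((b - a*q*q^n) * (c - a*q*q^n))
    = (1 - a*q^n*q) * (1 - a*q^n*q/(b*c))/((1 - a*q^n*q/b) * (1 - a*q^n*q/c))"
    using nz by (simp add: divide_simps mult_ac)
  moreover have "b - a*q*q^n \<noteq> 0" "c - a*q*q^n \<noteq> 0" using st nz by (auto simp: field_simps)
  ultimately have "(\<Sum>k\<le>Suc n. (1 - a*q^k*q^k) * rogers_term a b c (q^Suc n) k)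
    = (1 - a*q^n*q) * (1 - a*q^n*q/(b*c))/((1 - a*q^n*q/b) * (1 - a*q^n*q/c))
    * (\<Sum>k\<le>n. (1 - a*q^k*q^k) * rogers_term a b c (q^n) k)"
    using rogers_term_telescope[of a b c "q^n" "Suc n"] nz st den(1,2) qpoch_q_nz qpoch_nz_shift[OF den(3), of n]
    by (simp add: mult.commute[of q])
  then show ?case
    using Suc by (simp add: qpoch_Suc mult_ac)
qed

text \<open>Read backwards, the factors on the left are \<open>1 - 1/(x*q^i)\<close>, and each
  equals \<open>-1/(x*q^i)\<close> times \<open>1 - x*q^i\<close>.\<close>

lemma qpoch_reverse:
  assumes "x \<noteq> 0"
  shows "qfac (q/(x*q^k)) k = qfac x k * (\<Prod>i<k. - 1/(x*q^i))"
proof -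
  have "qfac (q/(x*q^k)) k = (\<Prod>i<k. 1 - q/(x*q^k)*q^(k - Suc i))"
    unfolding qpoch_def by (rule prod.nat_diff_reindex[symmetric])
  also have "\<dots> = (\<Prod>i<k. (1 - x*q^i) * (- 1/(x*q^i)))"
  proof (rule prod.cong)
    fix i assume "i \<in> {..<k}"
    then have "q^k = q^(k - Suc i)*q*q^i"
      by (metis lessThan_iff add_Suc_right add_diff_inverse_nat less_imp_Suc_add mult.assoc not_less_eq order_less_irrefl
        power_Suc power_add add.commute diff_add_inverse le_add_diff_inverse2 Suc_leI add_Suc mult.commute)
    then show "1 - q/(x*q^k)*q^(k - Suc i) = (1 - x*q^i) * (- 1/(x*q^i))"
      using q_nz assms by (simp add: field_simps)
  qed simp
  finally show ?thesis unfolding qpoch_def prod.distrib[symmetric] .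
qed

text \<open>The opening of Watson's argument: the \<open>k\<close>-dependent factors in
  \<open>b\<close> and \<open>c\<close>, with a part of the power, are replaced by a balanced sum.
  After an exchange of summations the sum over \<open>k\<close> contains only the parameters
  \<open>d\<close>, \<open>e\<close> and \<open>q^(-n)\<close>.\<close>

lemma saalschuetz':
  assumes nz: "a \<noteq> 0" "b \<noteq> 0" "c \<noteq> 0"
    and den: "\<And>k. qfac (a*q/b) k \<noteq> 0" "\<And>k. qfac (a*q/c) k \<noteq> 0"
  shows "qfac b k * qfac c k/(qfac (a*q/b) k * qfac (a*q/c) k) * (a*q/(b*c))^k
    = (\<Sum>j\<le>k. saalschuetz_term (a*q/(b*c)) (a*q^k) (a*q/b) (q^k) j)"
proof -
  have Z: "qfac (a*q/(b*c) * (a*q^k)/(a*q/b*q^m)) i \<noteq> 0" if "m < k" for m i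
  proof -
    have "k = Suc (m + (k - Suc m))" using that by simp
    then have "q^k = q*q^m*q^(k - Suc m)" by (metis power_Suc power_add mult.assoc)
    then have "a*q/(b*c) * (a*q^k)/(a*q/b*q^m) = a*q/c*q^(k - Suc m)"
      using nz q_nz by (simp add: field_simps)
    then show ?thesis using qpoch_nz_shift[OF den(2)] by simp
  qed
  have 1: "a*q/b/(a*q/(b*c)) = c" using nz q_nz by (simp add: field_simps)
  have 2: "a*q/b/(a*q^k) = q/(b*q^k)" using nz q_nz by (simp add: field_simps)
  have 3: "a*q/b/(a*q/(b*c) * (a*q^k)) = q/(a*q/c*q^k)"
    using nz q_nz by (simp add: field_simps)
  have "(\<Prod>i<k. - 1/(b*q^i)) = (\<Prod>i<k. (a*q/(b*c)) * (- 1/(a*q/c*q^i)))"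
    using nz q_nz by (intro prod.cong) (simp_all add: field_simps)
  then have 4: "(\<Prod>i<k. - 1/(b*q^i)) = (a*q/(b*c))^k * (\<Prod>i<k. - 1/(a*q/c*q^i))"
    by (simp only: prod.distrib prod_constant card_lessThan)
  have 5: "(\<Prod>i<k. - 1/(a*q/c*q^i)) \<noteq> 0"
    using nz q_nz by simp
  have "(\<Sum>j\<le>k. saalschuetz_term (a*q/(b*c)) (a*q^k) (a*q/b) (q^k) j)
    = qfac c k * qfac (q/(b*q^k)) k/(qfac (a*q/b) k * qfac (q/(a*q/c*q^k)) k)"
    using saalschuetz[of "a*q/(b*c)" "a*q^k" "a*q/b" k, OF _ _ _ den(1) Z] nz q_nz
    unfolding 1 2 3 by simp
  also have "\<dots> = qfac b k * qfac c k/(qfac (a*q/b) k * qfac (a*q/c) k) * (a*q/(b*c))^k"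
  proof -
    have r1: "qfac (q/(b*q^k)) k = qfac b k * ((a*q/(b*c))^k * (\<Prod>i<k. - 1/(a*q/c*q^i)))"
      using qpoch_reverse[of b k] nz 4 by simp
    have r2: "qfac (q/(a*q/c*q^k)) k = qfac (a*q/c) k * (\<Prod>i<k. - 1/(a*q/c*q^i))"
      using qpoch_reverse[of "a*q/c" k] nz q_nz by simp
    show ?thesis unfolding r1 r2 using 5 by simp
  qed
  finally show ?thesis by simp
qed

section \<open>Watson's reduction of a terminating series\<close>

text \<open>The argument is left as a product of two factors because the first is consumed by
  \<open>saalschuetz'\<close> and the second belongs to the 6phi5 sum.\<close>

definition wp_term where
  "wp_term a b c d e X k = (1 - a*q^k*q^k) *
     (qfac a k * qfac b k * qfac c k * qfac d k * qfac e k * qfac (1/X) k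
    / (qfac q k * qfac (a*q/b) k * qfac (a*q/c) k * qfac (a*q/d) k * qfac (a*q/e) k
    * qfac (a*q*X) k)) * ((a*q/(b*c)) * (a*q*X/(d*e)))^k"

text \<open>This is \<open>qfac w n\<close> times the summand of Watson's balanced 4phi3 series
  whose lower parameters are \<open>B\<close>, \<open>C\<close> and \<open>q/(w*q^n)\<close>. The
  last three factors are the reversed form of \<open>qfac w n / qfac (q/(w*q^n)) j\<close>, which
  needs no condition on \<open>w\<close>.\<close>

definition watson_term where
  "watson_term A d e B C w n j = qfac A j * qfac d j * qfac e j * qfac (1/q^n) j
    / (qfac q j * qfac B j * qfac C j)*q^j * (\<Prod>l<j. - 1/q^Suc l) * (w*q^n)^j * qfac w (n - j)"

lemma qpoch_double: "qfac (a*q^(i + j)) j * qfac a (i + j) = qfac a (j + j) * qfac (a*q^j*q^j) i"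
proof -
  have "qfac a (i + j) * qfac (a*q^(i + j)) j = qfac a ((j + j) + i)"
    unfolding qpoch_add[symmetric] by (simp add: add_ac)
  also have "\<dots> = qfac a (j + j) * qfac (a*q^(j + j)) i" by (rule qpoch_add)
  finally show ?thesis by (simp add: power_add mult_ac)
qed

lemma qpoch_qinv:
  "qfac (1/q^(i + j)) j * qfac q i = qfac q (i + j) * ((\<Prod>l<j. - 1/q^Suc l)/q^(i*j))"
proof -
  have e: "q/(q^Suc i*q^j) = 1/q^(i + j)" using q_nz by (simp add: power_add)
  have "qfac (1/q^(i + j)) j = qfac (q^Suc i) j * (\<Prod>l<j. - 1/(q^Suc i*q^l))"
    using qpoch_reverse[of "q^Suc i" j] q_nz unfolding e by simp
  also have "(\<Prod>l<j. - 1/(q^Suc i*q^l)) = (\<Prod>l<j. (1/q^i) * (- 1/q^Suc l))"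
    by (intro prod.cong) simp_all
  also have "\<dots> = (\<Prod>l<j. - 1/q^Suc l)/q^(i*j)"
    by (simp only: prod.distrib prod_constant card_lessThan power_one_over power_mult[symmetric]) simp
  finally show ?thesis by (simp add: qpoch_add)
qed

abbreviation watson_summand where
  "watson_summand a b c d e n k j \<equiv> (1 - a*q^k*q^k) * (qfac a k * qfac d k * qfac e k *
     qfac (1/q^n) k/(qfac q k * qfac (a*q/d) k * qfac (a*q/e) k * qfac (a*q*q^n) k)) *
     (a*q*q^n/(d*e))^k * saalschuetz_term (a*q/(b*c)) (a*q^k) (a*q/b) (q^k) j"

abbreviation watson_prefactor where
  "watson_prefactor a b c d e n j \<equiv> qfac (a*q/(b*c)) j * qfac d j * qfac e j * qfac (1/q ^
     n) j/(qfac q j * qfac (a*q/b) j * qfac (a*q/c) j * (qfac (a*q/d) j * qfac (a*q/e) j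
    * qfac (a*q*q^n) j))*q^j * (\<Prod>l<j. - 1/q^Suc l) * (a*q/(d*e)*q^n)^j *
     qfac a (j + j)"

abbreviation watson_inner where
  "watson_inner a d e n j i \<equiv> (1 - a*q^j*q^j*q^i*q^i) * rogers_term (a*q^j*q^j) (d*q^j) (e*q^j) (q^(n - j)) i"

text \<open>With \<open>k = i + j\<close> every factor splits at index \<open>j\<close>, and the
  remaining \<open>i\<close> factors start at \<open>q^j\<close> times the old parameter. They form
  a 6phi5 summand with base \<open>a*q^(2*j)\<close>, parameters \<open>d*q^j\<close> and
  \<open>e*q^j\<close>, and length \<open>n - j\<close>.\<close>

lemma watson_inner_term:
  fixes i j :: nat
  defines "k \<equiv> i + j"
  assumes nz: "a \<noteq> 0" "b \<noteq> 0" "c \<noteq> 0" "d \<noteq> 0" "e \<noteq> 0" and jn: "j \<le> n"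
  shows "watson_summand a b c d e n k j
    = watson_prefactor a b c d e n j
    * (watson_inner a d e n j i)"
proof -
  have qn: "q^n = q^j*q^(n - j)" using jn by (metis le_add_diff_inverse power_add)
  have a1: "a*q/(b*c) * (a*q^k)*q/(a*q/b*q^k) = a*q/c"
    using nz q_nz by (simp add: field_simps)
  have a2: "a*q^j*q^j*q/(d*q^j) = a*q/d*q^j" using nz q_nz by (simp add: field_simps)
  have a3: "a*q^j*q^j*q/(e*q^j) = a*q/e*q^j" using nz q_nz by (simp add: field_simps)
  have a4: "a*q^j*q^j*q*q^(n - j) = a*q*q^n*q^j" unfolding qn by (simp add: mult_ac)
  have a5: "1/q^(n - j) = 1/q^n*q^j" unfolding qn using q_nz by (simp add: field_simps)
  have a6: "a*q*q^n*q^j/(d*q^j * (e*q^j)) = a*q*q^n/(d*e)/q^j"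
    using q_nz by (simp add: field_simps)
  have a7: "(1 - a*q^k*q^k) = (1 - a*q^j*q^j*q^i*q^i)"
    by (simp add: k_def power_add mult_ac)
  have a8: "(a*q*q^n/(d*e))^k = (a*q/(d*e)*q^n)^j * ((a*q*q^n/(d*e)/q^j)^i*q^(i*j))"
  proof -
    have "z^k = z^j * ((z/q^j)^i*q^(i*j))" for z
      using q_nz by (simp add: k_def power_add power_divide mult.commute[of i] flip: power_mult)
    moreover have "a*q/(d*e)*q^n = a*q*q^n/(d*e)" by simp
    ultimately show ?thesis by metis
  qed
  have d1: "qfac (a*q^k) j * qfac a k = qfac a (j + j) * qfac (a*q^j*q^j) i"
    unfolding k_def by (rule qpoch_double)
  have d2: "qfac (1/q^k) j/qfac q k = (\<Prod>l<j. - 1/q^Suc l)/q^(i*j)/qfac q i"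
    using qpoch_qinv[of i j] qpoch_q_nz[of k] qpoch_q_nz[of i] unfolding k_def
    by (subst frac_eq_eq) (simp_all only: mult.commute not_False_eq_True)
  have sp: "qfac x k = qfac x j * qfac (x*q^j) i" for x
    unfolding k_def add.commute[of i] by (rule qpoch_add)
  define S where "S = (\<Prod>l<j. - 1/q^Suc l)"
  define w where "w = (a*q*q^n/(d*e)/q^j)^i"
  define v where "v = (a*q/(d*e)*q^n)^j"
  define u where "u = 1 - a*q^j*q^j*q^i*q^i"
  define R where "R = qfac d j * qfac (d*q^j) i * (qfac e j * qfac (e*q^j) i) * (qfac (1/q^n) j * qfac (1/q^n*q^j) i)
    / (qfac (a*q/d) j * qfac (a*q/d*q^j) i * (qfac (a*q/e) j * qfac (a*q/e*q^j) i)
    * (qfac (a*q*q^n) j * qfac (a*q*q^n*q^j) i))"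
  define Q where "Q = qfac (a*q/(b*c)) j/(qfac q j * qfac (a*q/b) j * qfac (a*q/c) j)*q^j"
  have "watson_summand a b c d e n k j
    = u * R*Q * v * (w*q^(i*j)) * (qfac (a*q^k) j * qfac a k) * (qfac (1/q^k) j/qfac q k)"
    unfolding saalschuetz_term_def a1 a7 a8 u_def[symmetric] v_def[symmetric] w_def[symmetric] R_def Q_def
      sp[of d] sp[of e] sp[of "1/q^n"] sp[of "a*q/d"] sp[of "a*q/e"] sp[of "a*q*q^n"]
    by (simp add: field_simps)
  also have "\<dots> = u * R*Q * v * w * S * (qfac a (j + j) * qfac (a*q^j*q^j) i)/qfac q i"
    unfolding d1 d2 S_def[symmetric] using q_nz by simp
  finally show ?thesis
    unfolding rogers_term_def a2 a3 a4 a5 a6 u_def[symmetric] v_def[symmetric] S_def[symmetric] w_def[symmetric]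
    unfolding R_def Q_def by (simp add: field_simps)
qed

text \<open>After the summations are exchanged, the inner sum is \<open>rogers_sum\<close> with base
  \<open>a*q^(2*j)\<close>. Its value combines with the prefactor through \<open>dbl\<close>, whose
  factor \<open>qfac a (Suc n)\<close> does not depend on \<open>j\<close> and leaves the
  sum.\<close>

lemma watson_terminating:
  assumes nz: "a \<noteq> 0" "b \<noteq> 0" "c \<noteq> 0" "d \<noteq> 0" "e \<noteq> 0"
    and den: "\<And>k. qfac (a*q/b) k \<noteq> 0" "\<And>k. qfac (a*q/c) k \<noteq> 0"
      "\<And>k. qfac (a*q/d) k \<noteq> 0" "\<And>k. qfac (a*q/e) k \<noteq> 0" "\<And>k. qfac (a*q) k \<noteq> 0"
  shows "(\<Sum>k\<le>n. wp_term a b c d e (q^n) k) * (qfac (a*q/d) n * qfac (a*q/e) n)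
    = qfac a (Suc n) * (\<Sum>j\<le>n. watson_term (a*q/(b*c)) d e (a*q/b) (a*q/c) (a*q/(d*e)) n j)"
proof -
  have "(\<Sum>k\<le>n. wp_term a b c d e (q^n) k)
    = (\<Sum>k\<le>n. \<Sum>j\<le>k. watson_summand a b c d e n k j)"
    unfolding sum_distrib_left[symmetric] saalschuetz'[OF nz(1-3) den(1,2), symmetric] wp_term_def power_mult_distrib
    by (intro sum.cong refl) (simp add: field_simps)
  also have "\<dots> = (\<Sum>j\<le>n. \<Sum>i\<le>n-j. watson_summand a b c d e n (i + j) j)"
    by (rule sum_triangle_diag)
  also have "\<dots> = (\<Sum>j\<le>n. watson_prefactor a b c d e n j
    * (\<Sum>i\<le>n-j. watson_inner a d e n j i))" (is "_ = ?X")
    unfolding sum_distrib_left by (intro sum.cong refl watson_inner_term nz) auto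
  finally have X: "(\<Sum>k\<le>n. wp_term a b c d e (q^n) k) = ?X" .
  have "?X * (qfac (a*q/d) n * qfac (a*q/e) n)
    = qfac a (Suc n) * (\<Sum>j\<le>n. watson_term (a*q/(b*c)) d e (a*q/b) (a*q/c) (a*q/(d*e)) n j)"
    unfolding sum_distrib_right sum_distrib_left[of "qfac a (Suc n)"]
  proof (intro sum.cong refl)
    fix j assume "j \<in> {..n}"
    then have n: "n = j + (n - j)" by simp
    have a2: "a*q^j*q^j*q/(d*q^j) = a*q/d*q^j" using nz q_nz by (simp add: field_simps)
    have a3: "a*q^j*q^j*q/(e*q^j) = a*q/e*q^j" using nz q_nz by (simp add: field_simps)
    have a4: "a*q^j*q^j*q/(d*q^j * (e*q^j)) = a*q/(d*e)" using nz q_nz by (simp add: field_simps)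
    have a5: "a*q^j*q^j*q = a*q*q^(j + j)" by (simp add: power_add)
    define R where "R = (\<Sum>i\<le>n-j. watson_inner a d e n j i)"
    have R: "R = (1 - a*q^j*q^j) * qfac (a*q^j*q^j*q) (n - j) * qfac (a*q/(d*e)) (n - j)
    / (qfac (a*q/d*q^j) (n - j) * qfac (a*q/e*q^j) (n - j))"
      unfolding R_def
    proof (rule rogers_sum[of "a*q^j*q^j" "d*q^j" "e*q^j", unfolded a2 a3 a4])
      show "qfac (a*q^j*q^j*q) k \<noteq> 0" for k
        unfolding a5 by (rule qpoch_nz_shift[OF den(5)])
    qed (use nz q_nz qpoch_nz_shift[OF den(3)] qpoch_nz_shift[OF den(4)] in simp_all)
    have sp: "qfac x n = qfac x j * qfac (x*q^j) (n - j)" for x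
      by (subst n) (rule qpoch_add)
    have "qfac a (j + j) * ((1 - a*q^j*q^j) * qfac (a*q^j*q^j*q) (n - j))
    = qfac a ((j + j) + Suc (n - j))"
      unfolding qpoch_add qpoch_Suc'[of "a*q^(j + j)"] by (simp add: power_add mult_ac)
    also have "(j + j) + Suc (n - j) = Suc n + j" using n by simp
    also have "qfac a (Suc n + j) = qfac a (Suc n) * qfac (a*q*q^n) j"
      unfolding qpoch_add by (simp add: mult_ac)
    finally have dbl: "qfac a (j + j) * ((1 - a*q^j*q^j) * qfac (a*q^j*q^j*q) (n - j))
    = qfac a (Suc n) * qfac (a*q*q^n) j" .
    define S where "S = (\<Prod>l<j. - 1/q^Suc l)"
    define P where "P = qfac (a*q/(b*c)) j * qfac d j * qfac e j * qfac (1/q^n) j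
    / (qfac q j * qfac (a*q/b) j * qfac (a*q/c) j)*q^j * S * (a*q/(d*e)*q^n)^j"
    have nn: "qfac (a*q/d) j \<noteq> 0" "qfac (a*q/e) j \<noteq> 0" "qfac (a*q*q^n) j \<noteq> 0"
       "qfac (a*q/d*q^j) (n - j) \<noteq> 0" "qfac (a*q/e*q^j) (n - j) \<noteq> 0"
      using den qpoch_nz_shift[OF den(3)] qpoch_nz_shift[OF den(4)] qpoch_nz_shift[OF den(5)] by auto
    have "P/(qfac (a*q/d) j * qfac (a*q/e) j * qfac (a*q*q^n) j) * qfac a (j + j) * R
    * (qfac (a*q/d) n * qfac (a*q/e) n)
    = P * qfac (a*q/(d*e)) (n - j) * (qfac a (j + j) * ((1 - a*q^j*q^j) * qfac (a*q^j*q^j*q) (n - j)))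
    / qfac (a*q*q^n) j"
      unfolding R sp[of "a*q/d"] sp[of "a*q/e"] using nn by (simp add: field_simps)
    also have "\<dots> = P * qfac (a*q/(d*e)) (n - j) * qfac a (Suc n)"
      unfolding dbl using nn by simp
    finally show "watson_prefactor a b c d e n j
    * (\<Sum>i\<le>n-j. watson_inner a d e n j i)
    * (qfac (a*q/d) n * qfac (a*q/e) n)
    = qfac a (Suc n) * watson_term (a*q/(b*c)) d e (a*q/b) (a*q/c) (a*q/(d*e)) n j"
      unfolding watson_term_def R_def[symmetric] S_def[symmetric] P_def by (simp add: field_simps)
  qed
  then show ?thesis unfolding X .
qed

lemma watson_term_commute: "watson_term A d e B C w n j = watson_term d A e B C w n j"
  by (simp add: watson_term_def mult_ac)

text \<open>Watson's sum is symmetric in \<open>a*q/(b*c)\<close> and \<open>d\<close>. Replacing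
  \<open>a\<close> by \<open>l\<close> and \<open>b, c, d\<close> by
  \<open>l*b/a, l*c/a, l*d/a\<close> interchanges exactly these two quantities and fixes the
  remaining ones, so both series reduce to the same sum \<open>W\<close>.\<close>

lemma wp_terminating_transformation:
  assumes nz: "a \<noteq> 0" "b \<noteq> 0" "c \<noteq> 0" "d \<noteq> 0" "e \<noteq> 0"
    and l: "l = q*a^2/(b*c*d)"
    and den: "\<And>k. qfac (a*q/b) k \<noteq> 0" "\<And>k. qfac (a*q/c) k \<noteq> 0"
      "\<And>k. qfac (a*q/d) k \<noteq> 0" "\<And>k. qfac (a*q/e) k \<noteq> 0" "\<And>k. qfac (a*q) k \<noteq> 0"
      "\<And>k. qfac (l*q/e) k \<noteq> 0" "\<And>k. qfac (l*q) k \<noteq> 0"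
  shows "(\<Sum>k\<le>n. wp_term a b c d e (q^n) k) * qfac (a*q/e) n * qfac l (Suc n)
    = (\<Sum>k\<le>n. wp_term l (l*b/a) (l*c/a) (l*d/a) e (q^n) k) * qfac (l*q/e) n * qfac a (Suc n)"
proof -
  have lnz: "l \<noteq> 0" using nz q_nz l by simp
  have s: "l*q/(l*b/a) = a*q/b" "l*q/(l*c/a) = a*q/c" "l*q/(l*d/a) = a*q/d"
    "l*q/(l*b/a * (l*c/a)) = d" "l*q/(l*d/a*e) = a*q/(d*e)" "l*d/a = a*q/(b*c)"
    using nz q_nz lnz by (simp_all add: l field_simps power2_eq_square)
  define W where "W = (\<Sum>j\<le>n. watson_term (a*q/(b*c)) d e (a*q/b) (a*q/c) (a*q/(d*e)) n j)"
  have 1: "(\<Sum>k\<le>n. wp_term a b c d e (q^n) k) * (qfac (a*q/d) n * qfac (a*q/e) n) = qfac a (Suc n) * W"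
    unfolding W_def by (rule watson_terminating) (use nz den in auto)
  have "(\<Sum>k\<le>n. wp_term l (l*b/a) (l*c/a) (l*d/a) e (q^n) k) * (qfac (a*q/d) n * qfac (l*q/e) n)
    = qfac l (Suc n) * (\<Sum>j\<le>n. watson_term d (l*d/a) e (a*q/b) (a*q/c) (a*q/(d*e)) n j)"
    using watson_terminating[of l "l*b/a" "l*c/a" "l*d/a" e n] unfolding s(1-5)
    using nz lnz den by simp
  also have "(\<Sum>j\<le>n. watson_term d (l*d/a) e (a*q/b) (a*q/c) (a*q/(d*e)) n j) = W"
    unfolding W_def s(6) by (rule sum.cong) (simp_all add: watson_term_commute[of d])
  finally have 2: "(\<Sum>k\<le>n. wp_term l (l*b/a) (l*c/a) (l*d/a) e (q^n) k) * (qfac (a*q/d) n * qfac (l*q/e) n)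
    = qfac l (Suc n) * W" .
  define S1 where "S1 = (\<Sum>k\<le>n. wp_term a b c d e (q^n) k)"
  define S2 where "S2 = (\<Sum>k\<le>n. wp_term l (l*b/a) (l*c/a) (l*d/a) e (q^n) k)"
  have "qfac (a*q/d) n * (S1 * qfac (a*q/e) n * qfac l (Suc n))
    = qfac (a*q/d) n * (S2 * qfac (l*q/e) n * qfac a (Suc n))"
    using 1 2 unfolding S1_def[symmetric] S2_def[symmetric] by algebra
  then show ?thesis using den(3)[of n] unfolding S1_def S2_def by simp
qed

end

section \<open>Continuation of the very-well-poised series by its q-difference equation\<close>

lemma holomorphic_list_locally_bounded:
  assumes "open S" "\<And>h. h \<in> set hs \<Longrightarrow> h holomorphic_on S" "x \<in> S"
  shows "\<exists>d>0. cball x d \<subseteq> S \<and> (\<exists>C. \<forall>h\<in>set hs. \<forall>y\<in>cball x d. norm (h y :: complex) \<le> C)"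
  using assms(2)
proof (induction hs)
  case Nil
  obtain d where "d > 0" "cball x d \<subseteq> S" using assms(1,3) open_contains_cball by blast
  then show ?case by auto
next
  case (Cons h hs)
  obtain d C where d: "d > 0" "cball x d \<subseteq> S" "\<forall>h\<in>set hs. \<forall>y\<in>cball x d. norm (h y) \<le> C"
    using Cons.IH Cons.prems by (meson list.set_intros(2))
  obtain d' C' where d': "d' > 0" "cball x d' \<subseteq> S" "\<forall>y\<in>cball x d'. norm (h y) \<le> C'"
    using holomorphic_locally_bounded[OF assms(1) Cons.prems assms(3), of h] by auto
  have "\<forall>g\<in>set (h # hs). \<forall>y\<in>cball x (min d d'). norm (g y) \<le> max C C'"
    using d(3) d'(3) by (auto simp: le_max_iff_disj)
  moreover have "cball x (min d d') \<subseteq> S" using d(2) by auto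
  ultimately show ?case using d(1) d'(1) by (intro exI[of _ "min d d'"]) auto
qed

lemma open_norm_less:
  assumes "open S" "\<zeta> holomorphic_on S"
  shows "open {x \<in> S. norm (\<zeta> x :: complex) < r}"
proof -
  have "continuous_on S (\<lambda>x. norm (\<zeta> x))"
    using assms(2) by (intro continuous_intros holomorphic_on_imp_continuous_on)
  from continuous_open_preimage[OF this assms(1), of "{..<r}"]
  show ?thesis by (simp add: vimage_def Int_def)
qed

lemma coeff_prod_list_holomorphic:
  assumes "\<And>P j. P \<in> set Ps \<Longrightarrow> (\<lambda>x. coeff (P x) j) holomorphic_on S"
  shows "(\<lambda>x. coeff (\<Prod>P\<leftarrow>Ps. P x) j) holomorphic_on S"
  using assms
proof (induction Ps arbitrary: j)
  case (Cons P Ps)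
  then show ?case by (simp add: coeff_mult) (intro holomorphic_intros; simp)
qed simp

lemma norm_prod_list_le_power:
  assumes "\<And>x. x \<in> set xs \<Longrightarrow> norm (g x :: complex) \<le> B" "B \<ge> 0"
  shows "norm (\<Prod>x\<leftarrow>xs. g x) \<le> B^length xs"
  using assms by (induction xs) (auto simp: norm_mult intro!: mult_mono)

lemma coeff_linear_holomorphic:
  assumes "g holomorphic_on S"
  shows "(\<lambda>x. coeff [:1, - g x:] j) holomorphic_on S"
proof -
  consider "j = 0" | "j = Suc 0" | m where "j = Suc (Suc m)" by (metis nat.exhaust)
  then show ?thesis using assms by cases (auto intro!: holomorphic_intros)
qed

lemma prod_list_holomorphic:
  assumes "\<And>f. f \<in> set fs \<Longrightarrow> f holomorphic_on S"
  shows "(\<lambda>x. \<Prod>f\<leftarrow>fs. f x :: complex) holomorphic_on S"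
  using assms by (induction fs) (auto intro!: holomorphic_intros)

lemma degree_prod_list_linear: "degree (\<Prod>p\<leftarrow>ps. [:1, - g p :: complex:]) \<le> length ps"
proof (induction ps)
  case (Cons p ps)
  have "degree ([:1, - g p:] * (\<Prod>p\<leftarrow>ps. [:1, - g p:])) \<le> degree [:1, - g p:] + degree (\<Prod>p\<leftarrow>ps. [:1, - g p:])"
    by (rule degree_mult_le)
  also have "\<dots> \<le> 1 + length ps" using Cons by (intro add_mono) auto
  finally show ?case by simp
qed simp

lemma prod_list_map_cong_mset:
  fixes f :: "'a \<Rightarrow> 'b::comm_monoid_mult"
  assumes "mset xs = mset ys"
  shows "prod_list (map f xs) = prod_list (map f ys)"
proof -
  have "mset (map f xs) = mset (map f ys)" using assms by simp
  then show ?thesis unfolding prod_mset_prod_list[symmetric] by simp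
qed

context q_base
begin

text \<open>The coefficient of the series multiplied by \<open>1 - a\<close>, \<open>qinf q\<close>
  and all \<open>qinf (a*q/p)\<close>: since \<open>qinf x = qfac x k * qinf (x*q^k)\<close>, this
  cancels every denominator and leaves a function that is analytic for nonzero parameters.\<close>

definition wp_coeff :: "complex \<Rightarrow> complex list \<Rightarrow> nat \<Rightarrow> complex" where
  "wp_coeff a ps k = (1 - a*q^k*q^k) * qfac a k * qinf (q^Suc k)
    * (\<Prod>p\<leftarrow>ps. qfac p k * qinf (a*q/p*q^k))"

text \<open>\<open>wp_num\<close> and \<open>wp_den\<close> are the numerator and denominator of the
  quotient of consecutive coefficients, as polynomials in \<open>q^k\<close>.\<close>

definition wp_num :: "complex \<Rightarrow> complex list \<Rightarrow> complex poly" where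
  "wp_num a ps = [:1, 0, - (a*q^2):] * [:1, - a:] * (\<Prod>p\<leftarrow>ps. [:1, - p:])"

definition wp_den :: "complex \<Rightarrow> complex list \<Rightarrow> complex poly" where
  "wp_den a ps = [:1, 0, - a:] * [:1, - q:] * (\<Prod>p\<leftarrow>ps. [:1, - (a*q/p):])"

lemma poly_prod_list: "poly (prod_list Ps) x = (\<Prod>P\<leftarrow>Ps. poly P x)"
  by (induction Ps) auto

lemma qinf_step': "qinf (x*q^k) = (1 - x*q^k) * qinf (x*q^Suc k)"
  by (subst qpoch_inf_step) (simp add: mult_ac)

lemma prod_list_mult_map: "(\<Prod>x\<leftarrow>xs. f x * g x) = (\<Prod>x\<leftarrow>xs. f x) * (\<Prod>x\<leftarrow>xs. g x :: complex)"
  by (induction xs) (simp_all add: mult_ac)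

lemma wp_coeff_rec: "poly (wp_den a ps) (q^k) * wp_coeff a ps (Suc k) = poly (wp_num a ps) (q^k) * wp_coeff a ps k"
proof -
  have "(\<Prod>p\<leftarrow>ps. poly [:1, - (a*q/p):] (q^k)) * (\<Prod>p\<leftarrow>ps. qfac p (Suc k) * qinf (a*q/p*q^Suc k))
    = (\<Prod>p\<leftarrow>ps. poly [:1, - p:] (q^k)) * (\<Prod>p\<leftarrow>ps. qfac p k * qinf (a*q/p*q^k))"
    unfolding prod_list_mult_map[symmetric] qinf_step'[of _ k] qpoch_Suc by (simp add: mult_ac)
  moreover have "(1 - q*q^k) * qinf (q^Suc (Suc k)) = qinf (q^Suc k)"
    using qinf_step'[of q k] by simp
  moreover have "(1 - a*q^2 * (q^k)^2) = (1 - a*q^Suc k*q^Suc k)"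
    by (simp add: power2_eq_square mult_ac)
  moreover have "poly [:1, 0, - (a*q^2):] (q^k) = 1 - a*q^2 * (q^k)^2"
    "poly [:1, 0, - a:] (q^k) = 1 - a*q^k*q^k" "poly [:1, - q:] (q^k) = 1 - q*q^k"
    "poly [:1, - a:] (q^k) = 1 - a*q^k"
    by (simp_all add: power2_eq_square algebra_simps)
  moreover have "A1*A2 * PD * (B1 * (R*A4) * I2 * VS) = A3 * A4' * PN * (B2 * R*I1*V)"
    if "PD * VS = PN * V" "A2' * I2 = I1" "C = B1" "A3 = C" "A1 = B2" "A2 = A2'" "A4' = A4"
    for A1 A2 A2' A3 A4 A4' B1 B2 C I1 I2 PD PN R V VS :: complex
    using that by algebra
  ultimately show ?thesis
    unfolding wp_coeff_def wp_den_def wp_num_def poly_mult poly_prod_list map_map o_def qpoch_Suc[of a]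
    by blast
qed

lemma wp_num_coeff_0: "coeff (wp_num a ps) 0 = 1" and wp_den_coeff_0: "coeff (wp_den a ps) 0 = 1"
proof -
  have "(\<Prod>x\<leftarrow>ps. 1 :: complex) = 1" by (induction ps) simp_all
  then show "coeff (wp_num a ps) 0 = 1" "coeff (wp_den a ps) 0 = 1"
    unfolding wp_num_def wp_den_def poly_0_coeff_0[symmetric] poly_mult poly_prod_list map_map o_def by simp_all
qed

lemma wp_degree: "degree (wp_num a ps) \<le> length ps + 3" "degree (wp_den a ps) \<le> length ps + 3"
proof -
  have *: "degree ([:1, 0, u:] * [:1, v:] * (\<Prod>p\<leftarrow>ps. [:1, - g p :: complex:])) \<le> length ps + 3" for u v and g :: "complex \<Rightarrow> complex"
  proof -
    have "degree ([:1, 0, u:] * [:1, v:] * (\<Prod>p\<leftarrow>ps. [:1, - g p:]))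
    \<le> (degree [:1, 0, u:] + degree [:1, v:]) + degree (\<Prod>p\<leftarrow>ps. [:1, - g p:])"
      by (rule order_trans[OF degree_mult_le add_right_mono[OF degree_mult_le]])
    also have "\<dots> \<le> (2 + 1) + length ps" by (intro add_mono degree_prod_list_linear) auto
    finally show ?thesis by simp
  qed
  show "degree (wp_num a ps) \<le> length ps + 3" unfolding wp_num_def by (rule *)
  show "degree (wp_den a ps) \<le> length ps + 3" unfolding wp_den_def by (rule *)
qed

lemma norm_qpow_le_1: "norm (q^k) \<le> 1"
  using q_lt_1 by (simp add: norm_power power_le_one)

lemma norm_wp_coeff_le:
  assumes "norm a \<le> C" "\<And>p. p \<in> set ps \<Longrightarrow> norm p \<le> C" "\<And>p. p \<in> set ps \<Longrightarrow> norm (a*q/p) \<le> C"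
  shows "norm (wp_coeff a ps k) \<le> (1 + C) * qbd C * qbd 1 * (qbd C * qbd C)^length ps"
proof -
  have le: "norm (x*q^k) \<le> C" if "norm x \<le> C" for x k
    using mult_mono[OF that norm_qpow_le_1[of k]] that by (simp add: norm_mult) (smt (verit) mult_left_le norm_ge_zero norm_qpow_le_1)
  have C: "C \<ge> 0" using assms(1) norm_ge_zero order_trans by blast
  have "norm (1 - a*q^k*q^k) \<le> 1 + norm (a*q^k*q^k)" by (metis norm_one norm_triangle_ineq4)
  also have "\<dots> \<le> 1 + C" using le[OF le[OF assms(1), of k], of k] by simp
  finally have 1: "norm (1 - a*q^k*q^k) \<le> 1 + C" .
  have "norm (\<Prod>p\<leftarrow>ps. qfac p k * qinf (a*q/p*q^k)) \<le> (qbd C * qbd C)^length ps"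
    by (rule norm_prod_list_le_power)
      (auto simp: norm_mult qbd_ge_0 intro!: mult_mono norm_qpoch_le' norm_qpoch_inf_le' assms(2) le[of "a*q/p" for p, simplified] assms(3)[simplified])
  then show ?thesis
    unfolding wp_coeff_def norm_mult
    by (intro mult_mono 1 norm_qpoch_le' assms(1) norm_qpoch_inf_le' norm_qpow_le_1) (auto simp: qbd_ge_0 C)
qed

text \<open>Here \<open>z\<close> is independent of \<open>a\<close> and \<open>ps\<close>: the
  difference equation moves \<open>z\<close> while the parameters stay fixed, so the argument of the
  8W7 series is substituted only afterwards.\<close>

definition wp_sum :: "complex \<Rightarrow> complex list \<Rightarrow> complex \<Rightarrow> complex" where
  "wp_sum a ps z = (\<Sum>k. wp_coeff a ps k * z^k)"

lemma summable_geometric_bound: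
  assumes "\<And>k. norm (g k) \<le> (K::real)" "norm z < 1"
  shows "summable (\<lambda>k. (g k :: complex) * z^k)"
proof (rule summable_comparison_test')
  show "summable (\<lambda>k. K * norm z^k)" using assms(2) by (simp add: summable_mult summable_geometric)
  show "norm (g k * z^k) \<le> K * norm z^k" if "k \<ge> 0" for k
    using assms(1) by (simp add: norm_mult norm_power mult_right_mono)
qed

lemma wp_coeff_bounded: "\<exists>K. \<forall>k. norm (wp_coeff a ps k) \<le> K"
proof -
  define C where "C = norm a + (\<Sum>p\<leftarrow>ps. norm p + norm (a*q/p))"
  have s: "norm p + norm (a*q/p) \<le> (\<Sum>p\<leftarrow>ps. norm p + norm (a*q/p))" if "p \<in> set ps" for p
    using that by (intro member_le_sum_list) auto
  have "norm a \<le> C" unfolding C_def by (simp, intro sum_list_nonneg) auto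
  moreover have "norm p \<le> C" "norm (a*q/p) \<le> C" if "p \<in> set ps" for p
    using s[OF that] norm_ge_zero[of p] norm_ge_zero[of "a*q/p"] norm_ge_zero[of a] unfolding C_def by linarith+
  ultimately show ?thesis using norm_wp_coeff_le[of a C ps] by blast
qed

lemma wp_summable: "norm z < 1 \<Longrightarrow> summable (\<lambda>k. wp_coeff a ps k * z^k)"
  using wp_coeff_bounded[of a ps] summable_geometric_bound by metis

text \<open>A factor \<open>q^(j*k)\<close> in the summand amounts to replacing \<open>z\<close> by
  \<open>z*q^j\<close>; a polynomial in \<open>q^k\<close> thus acts as a combination of dilations
  of \<open>z\<close>.\<close>

lemma wp_summable_mult:
  assumes "norm z < 1"
  shows "(\<lambda>k. poly A (q^k) * (wp_coeff a ps k * z^k)) sums (\<Sum>j\<le>degree A. coeff A j * wp_sum a ps (z*q^j))"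
proof -
  have "norm (z*q^j) < 1" for j
    using assms norm_qpow_le_1[of j] by (simp add: norm_mult) (smt (verit) mult_left_le norm_ge_zero)
  then have "(\<lambda>k. \<Sum>j\<le>degree A. coeff A j * (wp_coeff a ps k * (z*q^j)^k)) sums (\<Sum>j\<le>degree A. coeff A j * wp_sum a ps (z*q^j))"
    unfolding wp_sum_def by (intro sums_sum sums_mult summable_sums wp_summable) auto
  moreover have "(\<Sum>j\<le>degree A. coeff A j * (wp_coeff a ps k * (z*q^j)^k)) = poly A (q^k) * (wp_coeff a ps k * z^k)" for k
    unfolding poly_altdef sum_distrib_right
    by (intro sum.cong refl) (simp add: power_mult_distrib mult_ac flip: power_mult)
  ultimately show ?thesis by simp
qed

lemma sum_coeff_ext:
  assumes "degree A \<le> n"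
  shows "(\<Sum>j\<le>degree A. coeff A j * g j) = (\<Sum>j\<le>n. coeff A j * (g j :: complex))"
  by (rule sum.mono_neutral_left) (use assms in \<open>auto simp: coeff_eq_0\<close>)

text \<open>The first-order recurrence for the coefficients, with polynomial coefficients in \<open>q\<^sup>k\<close>,
  turns into a \<open>q\<close>-difference equation in \<open>z\<close>, which expresses the value at \<open>z\<close> by values at
  \<open>z q, z q\<^sup>2, \<dots>\<close>; this is what continues the series beyond the unit disc.\<close>

lemma wp_sum_qdiff:
  assumes z: "norm z < 1"
  shows "(1 - z) * wp_sum a ps z
    = (\<Sum>j=1..length ps + 3. (z * coeff (wp_num a ps) j - coeff (wp_den a ps) j/q^j) * wp_sum a ps (z*q^j))"
proof -
  let ?n = "length ps + 3"
  have 1: "(\<lambda>k. poly (wp_num a ps) (q^k) * (wp_coeff a ps k * z^k)) sums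
      (\<Sum>j\<le>?n. coeff (wp_num a ps) j * wp_sum a ps (z*q^j))"
    using wp_summable_mult[OF z, of "wp_num a ps" a ps] unfolding sum_coeff_ext[OF wp_degree(1)] .
  \<comment> \<open>The dilation by \<open>1/q\<close> compensates the index shift: \<open>A\<close>
    at \<open>q^(k+1)\<close> is \<open>wp_den\<close> at \<open>q^k\<close>. It also produces the
    powers \<open>q^j\<close> in the denominators of the equation.\<close>
  define A where "A = pcompose (wp_den a ps) [:0, 1/q:]"
  have cA: "coeff A j = coeff (wp_den a ps) j/q^j" for j
    unfolding A_def by (simp add: coeff_pcompose_linear power_one_over)
  have dA: "degree A \<le> ?n" unfolding A_def using wp_degree(2)[of a ps] q_nz by (simp add: degree_pcompose)
  have pA: "poly A (q^Suc k) = poly (wp_den a ps) (q^k)" for k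
    unfolding A_def by (simp add: poly_pcompose q_nz)
  \<comment> \<open>The factor of \<open>wp_den\<close> belonging to \<open>(q)_k\<close> vanishes
    here, so the summand of index 0 drops out and the shifted sum has the same value.\<close>
  have pA0: "poly A 1 = 0"
    unfolding A_def wp_den_def by (simp add: poly_pcompose q_nz)
  have "(\<lambda>k. poly A (q^k) * (wp_coeff a ps k * z^k)) sums (\<Sum>j\<le>?n. coeff A j * wp_sum a ps (z*q^j))"
    using wp_summable_mult[OF z, of A a ps] unfolding sum_coeff_ext[OF dA] .
  then have "(\<lambda>k. poly A (q^Suc k) * (wp_coeff a ps (Suc k) * z^Suc k)) sums (\<Sum>j\<le>?n. coeff A j * wp_sum a ps (z*q^j))"
    by (subst sums_Suc_iff) (simp add: pA0)
  moreover have "poly A (q^Suc k) * (wp_coeff a ps (Suc k) * z^Suc k) = z * (poly (wp_num a ps) (q^k) * (wp_coeff a ps k * z^k))" for k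
    unfolding pA mult.assoc[symmetric] wp_coeff_rec by simp
  ultimately have "(\<lambda>k. z * (poly (wp_num a ps) (q^k) * (wp_coeff a ps k * z^k))) sums (\<Sum>j\<le>?n. coeff A j * wp_sum a ps (z*q^j))"
    by (simp only:)
  then have "(\<Sum>j\<le>?n. coeff A j * wp_sum a ps (z*q^j)) = z * (\<Sum>j\<le>?n. coeff (wp_num a ps) j * wp_sum a ps (z*q^j))"
    by (rule sums_unique2[OF _ sums_mult[OF 1]])
  \<comment> \<open>Both polynomials have constant coefficient 1, so the parts with
    \<open>j = 0\<close> give \<open>1 - z\<close>; all other values are taken at smaller
    arguments.\<close>
  moreover have "{..?n} = insert 0 {1..?n}" by auto
  ultimately have "wp_sum a ps z + (\<Sum>j=1..?n. coeff A j * wp_sum a ps (z*q^j))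
    = z * (wp_sum a ps z + (\<Sum>j=1..?n. coeff (wp_num a ps) j * wp_sum a ps (z*q^j)))"
    by (simp add: cA wp_num_coeff_0 wp_den_coeff_0)
  then show ?thesis
    by (simp add: cA sum_distrib_left sum_subtractf left_diff_distrib right_diff_distrib distrib_left mult.assoc)
      (simp add: algebra_simps)
qed

text \<open>Level \<open>N\<close> is meaningful for \<open>norm z * norm q^N < 1\<close>. The
  recursion is the difference equation multiplied by \<open>qinf (z*q)\<close>: on the left
  \<open>(1 - z) * qinf (z*q) = qinf z\<close>, and on the right
  \<open>qinf (z*q) = qfac (z*q) (j - 1) * qinf (z*q^j)\<close>. Hence no division by
  \<open>1 - z\<close> occurs.\<close>

primrec wp_ext :: "nat \<Rightarrow> complex \<Rightarrow> complex list \<Rightarrow> complex \<Rightarrow> complex" where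
  "wp_ext 0 a ps z = qinf z * wp_sum a ps z"
| "wp_ext (Suc N) a ps z = (\<Sum>j=1..length ps + 3.
     (z * coeff (wp_num a ps) j - coeff (wp_den a ps) j/q^j) * qfac (z*q) (j - 1) * wp_ext N a ps (z*q^j))"

lemma norm_mult_qpow: "norm (z*q^j) * norm q^N = norm z * norm q^(N + j)"
  by (simp add: norm_mult norm_power power_add mult_ac)

lemma norm_mult_qpow_mono: "N \<le> M \<Longrightarrow> norm z * norm q^M \<le> norm z * norm q^N"
  using q_lt_1 by (intro mult_left_mono power_decreasing) auto

lemma wp_ext_1:
  assumes "norm z < 1"
  shows "wp_ext (Suc 0) a ps z = wp_ext 0 a ps z"
proof -
  have e: "qfac (z*q) (j - 1) * qinf (z*q^j) = qinf (z*q)" if "j \<ge> 1" for j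
    using qpoch_inf_split[of "z*q" "j - 1"] that by (cases j) (simp_all add: mult_ac)
  have "wp_ext (Suc 0) a ps z = qinf (z*q) *
     (\<Sum>j=1..length ps + 3. (z * coeff (wp_num a ps) j - coeff (wp_den a ps) j/q^j) * wp_sum a ps (z*q^j))"
    unfolding sum_distrib_left wp_ext.simps
  proof (intro sum.cong refl)
    fix j assume "j \<in> {1..length ps + 3}"
    then have h: "qfac (z*q) (j - 1) * qinf (z*q^j) = qinf (z*q)" by (intro e) simp
    show "(z * coeff (wp_num a ps) j - coeff (wp_den a ps) j/q^j) * qfac (z*q) (j - 1)
    * (qinf (z*q^j) * wp_sum a ps (z*q^j))
    = qinf (z*q) * ((z * coeff (wp_num a ps) j - coeff (wp_den a ps) j/q^j) * wp_sum a ps (z*q^j))"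
      unfolding h[symmetric] by (simp only: mult_ac)
  qed
  also have "\<dots> = wp_ext 0 a ps z"
    unfolding wp_sum_qdiff[OF assms, symmetric] by (simp add: qpoch_inf_step[of z])
  finally show ?thesis .
qed

text \<open>Consecutive levels agree wherever the lower one is meaningful: at level 0 this is the
  difference equation, and the recursion passes agreement from the points \<open>z*q^j\<close> to
  \<open>z\<close>.\<close>

lemma wp_ext_Suc: "norm z * norm q^N < 1 \<Longrightarrow> wp_ext (Suc N) a ps z = wp_ext N a ps z"
proof (induction N arbitrary: z)
  case 0
  then show ?case using wp_ext_1 by simp
next
  case (Suc N)
  have "norm (z*q^j) * norm q^N < 1" if "j \<ge> 1" for j
    unfolding norm_mult_qpow using Suc.prems norm_mult_qpow_mono[of "Suc N" "N + j" z] that by linarith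
  then have "wp_ext (Suc N) a ps (z*q^j) = wp_ext N a ps (z*q^j)" if "j \<ge> 1" for j
    using Suc.IH that by blast
  then show ?case by (subst (1 2) wp_ext.simps(2)) (intro sum.cong refl, simp)
qed

lemma wp_ext_eq:
  assumes "norm z * norm q^N < 1" "N \<le> M"
  shows "wp_ext M a ps z = wp_ext N a ps z"
  using assms(2)
proof (induction M rule: dec_induct)
  case (step M)
  then show ?case using wp_ext_Suc[of z M a ps] norm_mult_qpow_mono[of N M z] assms(1) by simp
qed simp

lemma ex_norm_mult_qpow: "\<exists>N. norm (z::complex) * norm q^N < 1"
proof -
  have "(\<lambda>N. norm z * norm q^N) \<longlonglongrightarrow> norm z * 0"
    using q_lt_1 by (intro tendsto_intros LIMSEQ_power_zero) auto
  then have "\<forall>\<^sub>F N in sequentially. norm z * norm q^N < 1" by (intro order_tendstoD) auto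
  then show ?thesis by (auto simp: eventually_sequentially)
qed

text \<open>The series times \<open>(z)\<^sub>\<infinity>\<close> and its denominators, continued to all \<open>z\<close>; any sufficiently large first
  argument of \<open>wp_ext\<close> gives the same value.\<close>

definition wp_entire :: "complex \<Rightarrow> complex list \<Rightarrow> complex" where
  "wp_entire a ps = wp_ext (LEAST N. norm (W87_arg q a ps) * norm q^N < 1) a ps (W87_arg q a ps)"

lemma wp_entire_eq:
  assumes "norm (W87_arg q a ps) * norm q^N < 1"
  shows "wp_entire a ps = wp_ext N a ps (W87_arg q a ps)"
proof -
  let ?M = "LEAST N. norm (W87_arg q a ps) * norm q^N < 1"
  have "norm (W87_arg q a ps) * norm q^?M < 1" "?M \<le> N"
    using assms by (rule LeastI, rule Least_le)
  then show ?thesis unfolding wp_entire_def using wp_ext_eq by metis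
qed

lemma wp_entire_eq_sum: "norm (W87_arg q a ps) < 1 \<Longrightarrow> wp_entire a ps = qinf (W87_arg q a ps) * wp_sum a ps (W87_arg q a ps)"
  using wp_entire_eq[of a ps 0] by simp

lemma wp_coeff_cong_mset: "mset ps = mset ps' \<Longrightarrow> wp_coeff a ps = wp_coeff a ps'"
  unfolding wp_coeff_def by (rule ext) (simp only: prod_list_map_cong_mset[of ps ps'])

lemma wp_sum_cong_mset: "mset ps = mset ps' \<Longrightarrow> wp_sum a ps = wp_sum a ps'"
  unfolding wp_sum_def using wp_coeff_cong_mset by metis

lemma wp_ext_cong_mset:
  assumes "mset ps = mset ps'"
  shows "wp_ext N a ps z = wp_ext N a ps' z"
proof (induction N arbitrary: z)
  case 0
  then show ?case using wp_sum_cong_mset[OF assms] by simp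
next
  case (Suc N)
  have "wp_num a ps = wp_num a ps'" "wp_den a ps = wp_den a ps'"
    using assms unfolding wp_num_def wp_den_def by (simp_all only: prod_list_map_cong_mset[of ps ps'])
  moreover have "length ps = length ps'" using assms by (metis size_mset)
  ultimately show ?case using Suc by simp
qed

lemma W87_arg_cong_mset: "mset ps = mset ps' \<Longrightarrow> W87_arg q a ps = W87_arg q a ps'"
  unfolding W87_arg_def by (metis prod_mset_prod_list)

lemma wp_entire_cong_mset: "mset ps = mset ps' \<Longrightarrow> wp_entire a ps = wp_entire a ps'"
  unfolding wp_entire_def using W87_arg_cong_mset wp_ext_cong_mset by metis

lemma coeff_quadratic_holomorphic:
  assumes "g holomorphic_on S"
  shows "(\<lambda>x. coeff [:1, 0, - g x:] j) holomorphic_on S"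
proof -
  consider "j = 0" | "j = Suc 0" | "j = Suc (Suc 0)" | m where "j = Suc (Suc (Suc m))" by (metis nat.exhaust)
  then show ?thesis using assms by cases (auto intro!: holomorphic_intros)
qed

lemma coeff_mult_holomorphic:
  assumes "\<And>j. (\<lambda>x. coeff (A x) j) holomorphic_on S" "\<And>j. (\<lambda>x. coeff (B x) j) holomorphic_on S"
  shows "(\<lambda>x. coeff (A x * B x :: complex poly) j) holomorphic_on S"
  unfolding coeff_mult using assms by (intro holomorphic_intros)

context
  fixes S :: "complex set" and a and fs :: "(complex \<Rightarrow> complex) list"
  assumes S: "open S" and a: "a holomorphic_on S" and fs: "\<And>f. f \<in> set fs \<Longrightarrow> f holomorphic_on S"
    and nz: "\<And>f x. f \<in> set fs \<Longrightarrow> x \<in> S \<Longrightarrow> f x \<noteq> 0"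
begin

lemma wp_coeff_holomorphic:
  shows "(\<lambda>x. wp_coeff (a x) (map (\<lambda>f. f x) fs) k) holomorphic_on S"
proof -
  have "(\<lambda>x. \<Prod>g\<leftarrow>map (\<lambda>f x. qfac (f x) k * qinf (a x*q/f x*q^k)) fs. g x) holomorphic_on S"
    by (rule prod_list_holomorphic) (use a fs nz in \<open>auto intro!: holomorphic_intros\<close>)
  then have p: "(\<lambda>x. \<Prod>f\<leftarrow>fs. qfac (f x) k * qinf (a x*q/f x*q^k)) holomorphic_on S"
    by (simp add: o_def)
  show ?thesis
    unfolding wp_coeff_def map_map o_def using a p by (intro holomorphic_intros)
qed

lemma wp_sum_holomorphic:
  assumes z: "\<zeta> holomorphic_on S"
  shows "(\<lambda>x. wp_sum (a x) (map (\<lambda>f. f x) fs) (\<zeta> x)) holomorphic_on {x \<in> S. norm (\<zeta> x) < 1}"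
  unfolding wp_sum_def
proof (rule suminf_holomorphic_on)
  show "open {x \<in> S. norm (\<zeta> x) < 1}" by (rule open_norm_less[OF S z])
  show "(\<lambda>x. wp_coeff (a x) (map (\<lambda>f. f x) fs) k * \<zeta> x^k) holomorphic_on {x \<in> S. norm (\<zeta> x) < 1}" for k
  proof (rule holomorphic_on_subset[of _ S])
    have "(\<lambda>x. wp_coeff (a x) (map (\<lambda>f. f x) fs) k) holomorphic_on S"
      by (rule wp_coeff_holomorphic)
    then show "(\<lambda>x. wp_coeff (a x) (map (\<lambda>f. f x) fs) k * \<zeta> x^k) holomorphic_on S"
      using z by (intro holomorphic_intros)
  qed auto
next
  fix x assume x: "x \<in> {x \<in> S. norm (\<zeta> x) < 1}"
  \<comment> \<open>The room between \<open>norm (\<zeta> x)\<close> and 1 yields the geometric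
    majorant \<open>K * r^k\<close> on a neighbourhood of \<open>x\<close>.\<close>
  then obtain r where r: "norm (\<zeta> x) < r" "r < 1" using dense by auto
  let ?T = "{x \<in> S. norm (\<zeta> x) < r}"
  define hs where "hs = a # fs @ map (\<lambda>f x. a x*q/f x) fs"
  have T: "open ?T" by (rule open_norm_less[OF S z])
  have hol: "h holomorphic_on ?T" if "h \<in> set hs" for h
  proof (rule holomorphic_on_subset[of _ S])
    show "h holomorphic_on S"
      using that a fs nz by (auto simp: hs_def intro!: holomorphic_intros)
  qed auto
  have xT: "x \<in> ?T" using x r by auto
  obtain d C where d: "d > 0" "cball x d \<subseteq> ?T" "\<forall>h\<in>set hs. \<forall>y\<in>cball x d. norm (h y) \<le> C"
    using holomorphic_list_locally_bounded[OF T, of hs x] hol xT by blast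
  define K where "K = (1 + C) * qbd C * qbd 1 * (qbd C * qbd C)^length fs"
  have K: "norm (wp_coeff (a y) (map (\<lambda>f. f y) fs) k) \<le> K" if "y \<in> cball x d" for y k
  proof -
    have b: "norm (a y) \<le> C" "\<And>f. f \<in> set fs \<Longrightarrow> norm (f y) \<le> C" "\<And>f. f \<in> set fs \<Longrightarrow> norm (a y*q/f y) \<le> C"
      using d(3) that unfolding hs_def by fastforce+
    show ?thesis
      using norm_wp_coeff_le[of "a y" C "map (\<lambda>f. f y) fs" k] b unfolding K_def length_map set_map by blast
  qed
  have "norm (wp_coeff (a y) (map (\<lambda>f. f y) fs) k * \<zeta> y^k) \<le> K * r^k" if "y \<in> cball x d" for y k
  proof -
    have "norm (\<zeta> y) \<le> r" using d(2) that by auto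
    then show ?thesis unfolding norm_mult norm_power
      using K[OF that, of k] K[OF that, of k, THEN order_trans[OF norm_ge_zero]] by (intro mult_mono power_mono) auto
  qed
  moreover have "summable (\<lambda>k. K * r^k)"
    using r order_trans[OF norm_ge_zero less_imp_le[OF r(1)]] by (intro summable_mult summable_geometric) simp
  moreover have "cball x d \<subseteq> {x \<in> S. norm (\<zeta> x) < 1}" using d(2) r by force
  ultimately show "\<exists>d>0. cball x d \<subseteq> {x \<in> S. norm (\<zeta> x) < 1} \<and> (\<exists>M. summable M \<and>
      (\<forall>k. \<forall>y\<in>cball x d. norm (wp_coeff (a y) (map (\<lambda>f. f y) fs) k * \<zeta> y^k) \<le> M k))"
    using d(1) by blast
qed

lemma wp_num_holomorphic:
  shows "(\<lambda>x. coeff (wp_num (a x) (map (\<lambda>f. f x) fs)) j) holomorphic_on S"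
proof -
  have p: "(\<lambda>x. coeff (\<Prod>f\<leftarrow>fs. [:1, - f x:]) j) holomorphic_on S" for j
    using coeff_prod_list_holomorphic[of "map (\<lambda>f x. [:1, - f x:]) fs" S j] fs coeff_linear_holomorphic
    by (auto simp: o_def)
  show ?thesis unfolding wp_num_def map_map o_def
    by (intro coeff_mult_holomorphic p coeff_linear_holomorphic coeff_quadratic_holomorphic a holomorphic_intros)
qed

lemma wp_den_holomorphic:
  shows "(\<lambda>x. coeff (wp_den (a x) (map (\<lambda>f. f x) fs)) j) holomorphic_on S"
proof -
  have l: "(\<lambda>x. a x*q/f x) holomorphic_on S" if "f \<in> set fs" for f
    using that a fs nz by (auto intro!: holomorphic_intros)
  have p: "(\<lambda>x. coeff (\<Prod>f\<leftarrow>fs. [:1, - (a x*q/f x):]) j) holomorphic_on S" for j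
    using coeff_prod_list_holomorphic[of "map (\<lambda>f x. [:1, - (a x*q/f x):]) fs" S j] l coeff_linear_holomorphic
    by (auto simp: o_def)
  show ?thesis unfolding wp_den_def map_map o_def
    by (intro coeff_mult_holomorphic p coeff_linear_holomorphic coeff_quadratic_holomorphic a holomorphic_intros)
qed

lemma wp_ext_holomorphic:
  assumes z: "\<zeta> holomorphic_on S"
  shows "(\<lambda>x. wp_ext N (a x) (map (\<lambda>f. f x) fs) (\<zeta> x)) holomorphic_on {x \<in> S. norm (\<zeta> x) * norm q^N < 1}"
  using z
proof (induction N arbitrary: \<zeta>)
  case 0
  have "(\<lambda>x. wp_sum (a x) (map (\<lambda>f. f x) fs) (\<zeta> x)) holomorphic_on {x \<in> S. norm (\<zeta> x) < 1}"
    by (rule wp_sum_holomorphic[OF 0])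
  moreover have "\<zeta> holomorphic_on {x \<in> S. norm (\<zeta> x) < 1}" using 0 by (rule holomorphic_on_subset) auto
  ultimately show ?case by (auto intro!: holomorphic_intros)
next
  case (Suc N)
  let ?T = "{x \<in> S. norm (\<zeta> x) * norm q^Suc N < 1}"
  have ih: "(\<lambda>x. wp_ext N (a x) (map (\<lambda>f. f x) fs) (\<zeta> x*q^j)) holomorphic_on ?T" if "j \<ge> 1" for j
  proof (rule holomorphic_on_subset[OF Suc.IH])
    show "(\<lambda>x. \<zeta> x*q^j) holomorphic_on S" using Suc.prems by (intro holomorphic_intros)
    show "?T \<subseteq> {x \<in> S. norm (\<zeta> x*q^j) * norm q^N < 1}"
    proof safe
      fix x assume "norm (\<zeta> x) * norm q^Suc N < 1"
      then show "norm (\<zeta> x*q^j) * norm q^N < 1"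
        unfolding norm_mult_qpow using norm_mult_qpow_mono[of "Suc N" "N + j" "\<zeta> x"] that by linarith
    qed
  qed
  have sub: "?T \<subseteq> S" by auto
  have n: "(\<lambda>x. coeff (wp_num (a x) (map (\<lambda>f. f x) fs)) j) holomorphic_on ?T" for j
    by (rule holomorphic_on_subset[OF wp_num_holomorphic sub])
  have d: "(\<lambda>x. coeff (wp_den (a x) (map (\<lambda>f. f x) fs)) j) holomorphic_on ?T" for j
    by (rule holomorphic_on_subset[OF wp_den_holomorphic sub])
  show ?case
    unfolding wp_ext.simps length_map
    by (intro holomorphic_intros ih n d holomorphic_on_subset[OF Suc.prems sub]) (auto simp: q_nz)
qed

lemma W87_arg_holomorphic:
  shows "(\<lambda>x. W87_arg q (a x) (map (\<lambda>f. f x) fs)) holomorphic_on S"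
proof -
  have "prod_list (map (\<lambda>f. f x) fs) \<noteq> 0" if "x \<in> S" for x
    using nz that by (auto simp: prod_list_zero_iff)
  then show ?thesis unfolding W87_arg_def using fs a by (intro holomorphic_intros prod_list_holomorphic) auto
qed

text \<open>On the open set where \<open>norm (\<zeta> x) * norm q^N < 1\<close> the single level
  \<open>N\<close> represents the function, and these sets exhaust \<open>S\<close>. Base and
  parameters are arbitrary holomorphic functions because they later move along curves in parameter
  space.\<close>

lemma wp_entire_holomorphic:
  shows "(\<lambda>x. wp_entire (a x) (map (\<lambda>f. f x) fs)) holomorphic_on S"
proof -
  define \<zeta> where "\<zeta> = (\<lambda>x. W87_arg q (a x) (map (\<lambda>f. f x) fs))"
  have z: "\<zeta> holomorphic_on S" unfolding \<zeta>_def by (rule W87_arg_holomorphic)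
  have *: "(\<lambda>x. wp_entire (a x) (map (\<lambda>f. f x) fs)) holomorphic_on {x \<in> S. norm (\<zeta> x) * norm q^N < 1}" for N
  proof (rule holomorphic_transform)
    show "(\<lambda>x. wp_ext N (a x) (map (\<lambda>f. f x) fs) (\<zeta> x)) holomorphic_on {x \<in> S. norm (\<zeta> x) * norm q^N < 1}"
      by (rule wp_ext_holomorphic[OF z])
  qed (auto simp: \<zeta>_def wp_entire_eq)
  have op: "open {x \<in> S. norm (\<zeta> x) * norm q^N < 1}" for N
    using open_norm_less[OF S holomorphic_on_mult[OF z holomorphic_on_const[of "q^N"]], of 1]
    by (simp add: norm_mult norm_power)
  have "(\<lambda>x. wp_entire (a x) (map (\<lambda>f. f x) fs)) holomorphic_on (\<Union>N. {x \<in> S. norm (\<zeta> x) * norm q^N < 1})"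
    by (rule holomorphic_on_UN_open) (use * op in auto)
  moreover have "(\<Union>N. {x \<in> S. norm (\<zeta> x) * norm q^N < 1}) = S" using ex_norm_mult_qpow by auto
  ultimately show ?thesis by simp
qed

end

section \<open>Existence and uniqueness of the continuation that defines \<open>W87\<close>\<close>

text \<open>The divisor consists of the factors put into \<open>wp_coeff\<close> to clear
  denominators and of the factor \<open>(z)_inf\<close> put into \<open>wp_ext\<close>.\<close>

definition wp_fun :: "complex \<Rightarrow> complex list \<Rightarrow> complex" where
  "wp_fun a ps = wp_entire a ps
    / ((1 - a) * qinf q * (\<Prod>p\<leftarrow>ps. qinf (a*q/p)) * qinf (W87_arg q a ps))"

lemma W87_domainD:
  assumes "(a, ps) \<in> W87_domain q"
  shows "length ps = 5" "a \<noteq> 0" "1 - a \<noteq> 0" "\<And>p. p \<in> set ps \<Longrightarrow> p \<noteq> 0"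
    "\<And>p. p \<in> set ps \<Longrightarrow> qinf (a*q/p) \<noteq> 0" "qinf (W87_arg q a ps) \<noteq> 0"
  using assms by (auto simp: W87_domain_def intro!: qpoch_inf_nz)

lemma W87_domainI:
  assumes "length ps = 5" "a \<noteq> 0" "1 - a \<noteq> 0" "\<And>p. p \<in> set ps \<Longrightarrow> p \<noteq> 0"
    "\<And>p. p \<in> set ps \<Longrightarrow> qinf (a*q/p) \<noteq> 0" "qinf (W87_arg q a ps) \<noteq> 0"
  shows "(a, ps) \<in> W87_domain q"
proof -
  have "1 - y*q^n \<noteq> 0" if "qinf y \<noteq> 0" for y n
    using that by (auto simp: qpoch_inf_eq_0_iff)
  then show ?thesis unfolding W87_domain_def mem_Collect_eq prod.case using assms by blast
qed

lemma prod_list_divide_map: "(\<Prod>x\<leftarrow>xs. f x/g x) = (\<Prod>x\<leftarrow>xs. f x)/(\<Prod>x\<leftarrow>xs. g x :: complex)"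
  by (induction xs) simp_all

lemma W87_series_eq:
  assumes dom: "(a, ps) \<in> W87_domain q" and z: "norm (W87_arg q a ps) < 1"
  shows "W87_series q a ps = wp_fun a ps"
proof -
  note D = W87_domainD[OF dom]
  define K where "K = qinf q * (\<Prod>p\<leftarrow>ps. qinf (a*q/p))"
  have K: "K \<noteq> 0" unfolding K_def using D(5) qpoch_inf_q_nz by (auto simp: prod_list_zero_iff)
  have qk: "qinf (q^Suc k) = qinf q/qfac q k" for k
    using qpoch_inf_split[of q k] qpoch_q_nz[of k] by (simp add: field_simps)
  have pk: "(\<Prod>p\<leftarrow>ps. qfac p k * qinf (a*q/p*q^k))
    = (\<Prod>p\<leftarrow>ps. qfac p k) * ((\<Prod>p\<leftarrow>ps. qinf (a*q/p))/(\<Prod>p\<leftarrow>ps. qfac (a*q/p) k))" for k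
  proof -
    have "qinf (a*q/p*q^k) = qinf (a*q/p)/qfac (a*q/p) k" if "p \<in> set ps" for p
      using qpoch_inf_split[of "a*q/p" k] D(5)[OF that] by (auto simp: field_simps)
    then have "(\<Prod>p\<leftarrow>ps. qfac p k * qinf (a*q/p*q^k))
    = (\<Prod>p\<leftarrow>ps. qfac p k * (qinf (a*q/p)/qfac (a*q/p) k))"
      by (intro arg_cong[of _ _ prod_list] map_cong refl) simp
    then show ?thesis unfolding prod_list_mult_map prod_list_divide_map .
  qed
  have c: "wp_coeff a ps k = K * ((1 - a*q^(2 * k)) * (qpochs q (a # ps) k/qpochs q (q # map (\<lambda>p. a*q/p) ps) k))" for k
    unfolding wp_coeff_def qk pk K_def qpochs_def by (simp add: o_def mult_2 power_add mult.assoc)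
  have t: "(1 - a*q^(2 * k))/(1 - a) * (qpochs q (a # ps) k/qpochs q (q # map (\<lambda>p. a*q/p) ps) k) * W87_arg q a ps^k
    = wp_coeff a ps k * W87_arg q a ps^k * inverse ((1 - a) * K)" for k
  proof -
    have "K * (u * R) * Z * inverse ((1 - a) * K) = u/(1 - a) * R*Z" for u R Z
      using K D(3) by (simp add: field_simps)
    then show ?thesis unfolding c by simp
  qed
  show ?thesis
    unfolding W87_series_def t suminf_mult2[OF wp_summable[OF z], symmetric]
    unfolding wp_fun_def wp_entire_eq_sum[OF z] wp_sum_def[symmetric] K_def
    using D(6) by (simp add: divide_inverse)
qed

text \<open>In a nonempty slice the other parameters are admissible, and the slice consists of the
  nonzero \<open>x\<close> at which the denominator \<open>\<Delta>\<close> of \<open>wp_fun\<close>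
  does not vanish. Openness and holomorphy both follow from the holomorphy of
  \<open>\<Delta>\<close>.\<close>

lemma W87_slice_holomorphic:
  assumes "i < 5"
  shows "(\<lambda>x. wp_fun a (ps[i := x])) holomorphic_on {x. (a, ps[i := x]) \<in> W87_domain q}" (is "_ holomorphic_on ?T")
    and "open {x. (a, ps[i := x]) \<in> W87_domain q}"
proof -
  have "(\<lambda>x. wp_fun a (ps[i := x])) holomorphic_on ?T \<and> open ?T"
  proof (cases "?T = {}")
    case False
    then obtain x0 where x0: "(a, ps[i := x0]) \<in> W87_domain q" by blast
    note D = W87_domainD[OF x0]
    have len: "length ps = 5" using D(1) by simp
    define fs where "fs = (map (\<lambda>p _. p) ps)[i := (\<lambda>x::complex. x)]"
    have map: "ps[i := x] = map (\<lambda>f. f x) fs" for x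
      unfolding fs_def by (simp add: map_update o_def)
    have nzj: "ps ! j \<noteq> 0" if "j < 5" "j \<noteq> i" for j
    proof -
      have "ps[i := x0] ! j \<in> set (ps[i := x0])" using that len by (intro nth_mem) simp
      then show ?thesis using D(4) that by fastforce
    qed
    have fs: "f = (\<lambda>x. x) \<or> (\<exists>c. c \<noteq> 0 \<and> f = (\<lambda>_. c))" if f: "f \<in> set fs" for f
    proof -
      obtain j where j: "j < 5" "f = fs ! j" using f len by (auto simp: fs_def in_set_conv_nth)
      then show ?thesis using nzj[of j] len assms by (cases "j = i") (auto simp: fs_def)
    qed
    let ?S = "- {0::complex}"
    have S: "open ?S" by auto
    have hol: "f holomorphic_on ?S" if "f \<in> set fs" for f using fs[OF that] by (auto intro!: holomorphic_intros)
    have nz: "f x \<noteq> 0" if "f \<in> set fs" "x \<in> ?S" for f x using fs[OF that(1)] that(2) by auto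
    define \<Delta> where "\<Delta> = (\<lambda>x. (1 - a) * qinf q * (\<Prod>p\<leftarrow>ps[i := x]. qinf (a*q/p)) * qinf (W87_arg q a (ps[i := x])))"
    have "(\<lambda>x. \<Prod>g\<leftarrow>map (\<lambda>f x. qinf (a*q/f x)) fs. g x) holomorphic_on ?S"
      by (rule prod_list_holomorphic) (use hol nz in \<open>auto intro!: holomorphic_intros\<close>)
    then have p: "(\<lambda>x. \<Prod>f\<leftarrow>fs. qinf (a*q/f x)) holomorphic_on ?S" by (simp add: o_def)
    have wf: "(\<lambda>x. wp_fun a (ps[i := x])) = (\<lambda>x. wp_entire a (ps[i := x])/\<Delta> x)"
      by (simp add: wp_fun_def \<Delta>_def)
    have dhol: "\<Delta> holomorphic_on ?S"
      unfolding \<Delta>_def map map_map o_def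
      by (intro holomorphic_intros p W87_arg_holomorphic S hol nz)
    have "\<Delta> x \<noteq> 0" if "(a, ps[i := x]) \<in> W87_domain q" for x
      using W87_domainD[OF that] qpoch_inf_q_nz unfolding \<Delta>_def by (auto simp: prod_list_zero_iff)
    moreover have "(a, ps[i := x]) \<in> W87_domain q" if "x \<in> ?S" "\<Delta> x \<noteq> 0" for x
    proof -
      have "qinf (a*q/p) \<noteq> 0" if "p \<in> set (ps[i := x])" for p
        using \<open>\<Delta> x \<noteq> 0\<close> that unfolding \<Delta>_def by (auto simp: prod_list_zero_iff)
      moreover have "p \<noteq> 0" if "p \<in> set (ps[i := x])" for p
        using that nz \<open>x \<in> ?S\<close> unfolding map by auto
      moreover have "qinf (W87_arg q a (ps[i := x])) \<noteq> 0" using that(2) by (auto simp: \<Delta>_def)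
      ultimately show ?thesis using D(2,3) len by (intro W87_domainI) auto
    qed
    moreover have "x \<noteq> 0" if "(a, ps[i := x]) \<in> W87_domain q" for x
      using W87_domainD(4)[OF that, of x] len assms by (simp add: set_update_memI)
    ultimately have T: "?T = {x \<in> ?S. \<Delta> x \<noteq> 0}" by blast
    have "open {x \<in> ?S. \<Delta> x \<noteq> 0}"
    proof -
      have "open (- {0} \<inter> \<Delta> -` (- {0}))"
        by (rule continuous_open_preimage[OF holomorphic_on_imp_continuous_on[OF dhol] S]) auto
      then show ?thesis by (simp add: vimage_def Int_def)
    qed
    moreover have "(\<lambda>x. wp_entire a (ps[i := x])) holomorphic_on ?S"
      unfolding map by (rule wp_entire_holomorphic[OF S]) (use hol nz in auto)
    then have "(\<lambda>x. wp_fun a (ps[i := x])) holomorphic_on {x \<in> ?S. \<Delta> x \<noteq> 0}"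
      unfolding wf
      by (intro holomorphic_on_divide holomorphic_on_subset[OF dhol]) (auto intro: holomorphic_on_subset)
    ultimately show ?thesis unfolding T by blast
  next
    case True
    then show ?thesis by (metis holomorphic_on_empty open_empty)
  qed
  then show "(\<lambda>x. wp_fun a (ps[i := x])) holomorphic_on ?T" "open ?T" by auto
qed

lemma W87_base_slice_holomorphic: "(\<lambda>x. wp_fun x ps) holomorphic_on {x. (x, ps) \<in> W87_domain q}" (is "_ holomorphic_on ?T")
proof (cases "?T = {}")
  case False
  then obtain x0 where x0: "(x0, ps) \<in> W87_domain q" by blast
  define fs where "fs = map (\<lambda>p (_::complex). p) ps"
  have map: "ps = map (\<lambda>f. f x) fs" for x unfolding fs_def by (simp add: o_def)
  have nz: "p \<noteq> 0" if "p \<in> set ps" for p using W87_domainD(4)[OF x0 that] .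
  have "(\<lambda>x. wp_entire x (map (\<lambda>f. f x) fs)) holomorphic_on UNIV"
    by (rule wp_entire_holomorphic) (use nz in \<open>auto simp: fs_def\<close>)
  then have 1: "(\<lambda>x. wp_entire x ps) holomorphic_on UNIV" unfolding map[symmetric] .
  have 2: "(\<lambda>x. W87_arg q x ps) holomorphic_on UNIV" unfolding W87_arg_def
    using nz by (auto intro!: holomorphic_intros simp: prod_list_zero_iff)
  have "(\<lambda>x. \<Prod>g\<leftarrow>map (\<lambda>p x. qinf (x*q/p)) ps. g x) holomorphic_on UNIV"
    by (rule prod_list_holomorphic) (use nz in \<open>auto intro!: holomorphic_intros\<close>)
  then have 3: "(\<lambda>x. \<Prod>p\<leftarrow>ps. qinf (x*q/p)) holomorphic_on UNIV" by (simp add: o_def)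
  show ?thesis unfolding wp_fun_def
    by (intro holomorphic_intros holomorphic_on_subset[OF 1] holomorphic_on_subset[OF 2] holomorphic_on_subset[OF 3])
      (use W87_domainD qpoch_inf_q_nz in \<open>auto simp: prod_list_zero_iff\<close>)
next
  case True
  then show ?thesis by (metis holomorphic_on_empty)
qed

lemma wp_fun_continuation: "W87_continuation q wp_fun"
  unfolding W87_continuation_def
  using W87_series_eq W87_slice_holomorphic(1) W87_base_slice_holomorphic by auto

text \<open>The excluded values of the last parameter are among 0 and the two sequences
  \<open>a*q*q^n\<close> and \<open>\<kappa>*q^n\<close>; the complement of a countable set in the
  plane is path-connected.\<close>

lemma W87_slice_connected:
  assumes "(a, ps) \<in> W87_domain q"
  shows "connected {x. (a, ps[4 := x]) \<in> W87_domain q}" (is "connected ?T")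
proof -
  note D = W87_domainD[OF assms]
  obtain p0 p1 p2 p3 p4 where ps: "ps = [p0, p1, p2, p3, p4]"
    using D(1) by (auto simp: length_Suc_conv numeral_eq_Suc)
  define \<kappa> where "\<kappa> = a^2*q^2/(p0*p1*p2*p3)"
  have upd: "ps[4 := x] = [p0, p1, p2, p3, x]" for x
    unfolding ps by (simp add: eval_nat_numeral)
  let ?B = "insert 0 (range (\<lambda>n. a*q*q^n) \<union> range (\<lambda>n. \<kappa> * q^n))"
  have "x \<in> ?T" if "x \<notin> ?B" for x
  proof -
    have "x \<noteq> 0" and 1: "1 - a*q/x*q^n \<noteq> 0" "1 - \<kappa>/x*q^n \<noteq> 0" for n
      using that by (auto simp: field_simps)
    moreover have "W87_arg q a [p0, p1, p2, p3, x] = \<kappa>/x"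
      unfolding W87_arg_def \<kappa>_def by (simp add: mult_ac)
    ultimately show ?thesis
      using assms unfolding upd ps by (auto simp: W87_domain_def)
  qed
  then have sub: "- ?T \<subseteq> ?B" by blast
  have "countable (- ?T)" by (rule countable_subset[OF sub]) auto
  then have "path_connected (- (- ?T))" by (intro path_connected_complement_countable) auto
  then show ?thesis by (simp add: path_connected_imp_connected)
qed

text \<open>Moving only the last parameter, every continuation agrees with the series for large values of it.\<close>

lemma W87_continuation_unique:
  assumes F: "W87_continuation q F" and dom: "(a, ps) \<in> W87_domain q"
  shows "F a ps = wp_fun a ps"
proof -
  let ?T = "{x. (a, ps[4 := x]) \<in> W87_domain q}"
  note D = W87_domainD[OF dom]
  let ?T' = "{x \<in> ?T. norm (W87_arg q a (ps[4 := x])) < 1}"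
  obtain p0 p1 p2 p3 p4 where ps: "ps = [p0, p1, p2, p3, p4]"
    using D(1) by (auto simp: length_Suc_conv numeral_eq_Suc)
  define \<kappa> where "\<kappa> = a^2*q^2/(p0*p1*p2*p3)"
  have upd: "ps[4 := x] = [p0, p1, p2, p3, x]" for x
    unfolding ps by (simp add: eval_nat_numeral)
  have arg: "W87_arg q a (ps[4 := x]) = \<kappa>/x" for x
    unfolding upd W87_arg_def \<kappa>_def by (simp add: mult_ac)
  have T0: "x \<noteq> 0" if "x \<in> ?T" for x
    using W87_domainD(4)[of a "ps[4 := x]" x] that unfolding upd by simp
  have opT: "open ?T" by (rule W87_slice_holomorphic(2)) simp
  have op: "open ?T'"
    unfolding arg by (rule open_norm_less[OF opT]) (use T0 in \<open>auto intro!: holomorphic_intros\<close>)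
  have ne: "?T' \<noteq> {}"
  proof -
    \<comment> \<open>For \<open>x\<close> larger in modulus than \<open>a*q\<close> and
      \<open>\<kappa>\<close>, both \<open>a*q/x\<close> and the argument \<open>\<kappa>/x\<close>
      lie in the unit disc, so \<open>x\<close> is admissible and the series converges.\<close>
    define x where "x = complex_of_real (1 + norm (a*q) + norm \<kappa>)"
    have nx: "norm x = 1 + norm (a*q) + norm \<kappa>"
      unfolding x_def by (simp only: norm_of_real) auto
    have x: "x \<noteq> 0" "norm (a*q) < norm x" "norm \<kappa> < norm x"
    proof -
      have g: "norm (a*q) \<ge> 0" "norm \<kappa> \<ge> 0" by simp_all
      show "norm (a*q) < norm x" "norm \<kappa> < norm x" using nx g by linarith+
      then show "x \<noteq> 0" using g by auto
    qed
    have small: "1 - y/x*q^n \<noteq> 0" if "norm y < norm x" for y n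
    proof -
      have "norm (y/x*q^n) \<le> norm (y/x) * 1"
        unfolding norm_mult[of "y/x"] by (intro mult_left_mono norm_qpow_le_1) auto
      also have "\<dots> < 1" using that x(1) by (simp add: norm_divide)
      finally show ?thesis by auto
    qed
    have "norm (\<kappa>/x) < 1" using x by (simp add: norm_divide)
    moreover have "x \<in> ?T"
    proof -
      have "\<forall>n. 1 - a*q/x*q^n \<noteq> 0" "\<forall>n. 1 - \<kappa>/x*q^n \<noteq> 0" using small x by blast+
      then show ?thesis
        using dom x(1) unfolding upd unfolding ps W87_domain_def mem_Collect_eq prod.case arg[unfolded upd]
        by (simp only: list.set ball_simps list.size simp_thms)
    qed
    ultimately show ?thesis using arg by auto
  qed
  have eq: "F a (ps[4 := x]) = wp_fun a (ps[4 := x])" if "x \<in> ?T" for x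
  proof (rule analytic_continuation_open[OF op opT ne W87_slice_connected[OF dom], of "\<lambda>x. F a (ps[4 := x])" "\<lambda>x. wp_fun a (ps[4 := x])"])
    show "(\<lambda>x. F a (ps[4 := x])) holomorphic_on ?T" using F by (auto simp: W87_continuation_def)
    show "(\<lambda>x. wp_fun a (ps[4 := x])) holomorphic_on ?T" by (rule W87_slice_holomorphic(1)) simp
    show "F a (ps[4 := x]) = wp_fun a (ps[4 := x])" if "x \<in> ?T'" for x
      using F that W87_series_eq[of a "ps[4 := x]"] by (auto simp: W87_continuation_def)
  qed (use that in auto)
  show ?thesis using eq[of p4] dom unfolding upd ps by simp
qed

lemma W87_eq:
  assumes "(a, ps) \<in> W87_domain q"
  shows "W87 q a ps = wp_fun a ps"
proof (cases "norm (W87_arg q a ps) < 1")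
  case True
  then show ?thesis using W87_series_eq[OF assms] by (simp add: W87_def)
next
  case False
  have "(THE w. \<exists>F. W87_continuation q F \<and> w = F a ps) = wp_fun a ps"
  proof (rule the_equality)
    show "\<exists>F. W87_continuation q F \<and> wp_fun a ps = F a ps" using wp_fun_continuation by blast
    show "w = wp_fun a ps" if "\<exists>F. W87_continuation q F \<and> w = F a ps" for w
      using that W87_continuation_unique[OF _ assms] by blast
  qed
  then show ?thesis using False by (simp add: W87_def)
qed

end

section \<open>The nonterminating transformation between two series\<close>

lemma connected_punctured_plane: "connected (- {0::complex})"
  by (intro path_connected_imp_connected path_connected_complement_countable) auto

lemma holomorphic_isCont_1: "f holomorphic_on - {0::complex} \<Longrightarrow> isCont f 1"
  using continuous_on_eq_continuous_at[of "- {0::complex}" f] holomorphic_on_imp_continuous_on[of f "- {0}"]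
    open_Compl[OF closed_singleton, of "0::complex"]
  by auto

context q_base
begin

lemma wp_coeff_snoc: "wp_coeff a (ps @ [f]) k = wp_coeff a ps k * (qfac f k * qinf (a*q/f*q^k))"
  by (simp add: wp_coeff_def mult_ac)

text \<open>The series with last parameter \<open>1/u\<close>, in a form that is analytic at \<open>u = 0\<close>, where the
  terminating cases \<open>u = q\<^sup>n\<close> accumulate.\<close>

definition wp_inv :: "complex \<Rightarrow> complex list \<Rightarrow> complex \<Rightarrow> complex" where
  "wp_inv a ps u = qinf (a^2*q^2/prod_list ps * u)
    * (\<Sum>k. wp_coeff a ps k * (\<Prod>j<k. u - q^j) * qinf (a*q*u*q^k) * (a^2*q^2/prod_list ps)^k)"

lemma W87_arg_snoc: "W87_arg q a (ps @ [f]) = a^2*q^2/prod_list ps/f"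
  by (simp add: W87_arg_def mult_ac)

text \<open>The singularity of the parameter \<open>1/u\<close> at \<open>u = 0\<close> is absorbed
  by the power of the argument: \<open>qfac (1/u) k * u^k\<close> is the polynomial
  \<open>(\<Prod>j<k. u - q^j)\<close>.\<close>

lemma wp_entire_eq_wp_inv:
  assumes "u \<noteq> 0" "norm (a^2*q^2/prod_list ps * u) < 1"
  shows "wp_entire a (ps @ [1/u]) = wp_inv a ps u"
proof -
  define \<kappa> where "\<kappa> = a^2*q^2/prod_list ps"
  have arg: "W87_arg q a (ps @ [1/u]) = \<kappa> * u" by (simp add: W87_arg_snoc \<kappa>_def)
  have "qfac (1/u) k * u^k = (\<Prod>j<k. u - q^j)" for k
  proof -
    have "qfac (1/u) k * u^k = (\<Prod>j<k. (1 - 1/u*q^j) * u)"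
      unfolding qpoch_def prod.distrib by simp
    also have "\<dots> = (\<Prod>j<k. u - q^j)" using assms(1) by (intro prod.cong) (simp_all add: field_simps)
    finally show ?thesis .
  qed
  then have "wp_coeff a (ps @ [1/u]) k * (\<kappa> * u)^k
    = wp_coeff a ps k * (\<Prod>j<k. u - q^j) * qinf (a*q*u*q^k) * \<kappa>^k" for k
    unfolding wp_coeff_snoc power_mult_distrib by (simp add: mult_ac)
  then show ?thesis
    using wp_entire_eq_sum[of a "ps @ [1/u]"] assms(2) unfolding arg wp_sum_def wp_inv_def \<kappa>_def by simp
qed

text \<open>Taking \<open>r\<close> out of each factor leaves a product that is bounded uniformly in
  \<open>k\<close>. The growth is therefore only \<open>r^k\<close>, and \<open>wp_inv\<close> is
  dominated by a geometric series as soon as the coefficient of \<open>u\<close> in the argument,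
  times \<open>r\<close>, is below 1 in modulus.\<close>

lemma norm_prod_diff_qpow_le:
  assumes "r > 0" "norm u \<le> r"
  shows "norm (\<Prod>j<k. u - q^j) \<le> r^k * qbd (1/r)"
proof -
  have "norm (\<Prod>j<k. u - q^j) = (\<Prod>j<k. norm (u - q^j))" by (simp add: prod_norm)
  also have "\<dots> \<le> (\<Prod>j<k. r * exp (norm (1/complex_of_real r*q^j)))"
  proof (rule prod_mono, safe)
    fix j
    have "norm (u - q^j) \<le> r + norm (q^j)" using norm_triangle_ineq4[of u "q^j"] assms(2) by linarith
    also have "\<dots> = r * (1 + norm (1/complex_of_real r*q^j))"
      using assms(1) by (simp add: norm_mult norm_divide field_simps)
    also have "\<dots> \<le> r * exp (norm (1/complex_of_real r*q^j))"
      using assms(1) exp_ge_add_one_self by (intro mult_left_mono) auto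
    finally show "norm (u - q^j) \<le> r * exp (norm (1/complex_of_real r*q^j))" .
  qed auto
  also have "\<dots> = r^k * exp (\<Sum>j<k. norm (1/complex_of_real r*q^j))"
    by (simp add: prod.distrib exp_sum)
  also have "\<dots> \<le> r^k * qbd (1/r)"
  proof -
    have "(\<Sum>j<k. norm (1/complex_of_real r*q^j)) \<le> (\<Sum>j. norm (1/complex_of_real r*q^j))"
      by (intro sum_le_suminf summable_qpow) auto
    also have "\<dots> = (1/r)/(1 - norm q)"
      using q_lt_1 assms(1) summable_geometric[of "norm q"]
      by (simp add: norm_mult norm_power norm_divide suminf_divide suminf_geometric)
    finally show ?thesis unfolding qbd_def using assms(1) by (intro mult_left_mono) auto
  qed
  finally show ?thesis .
qed

lemma wp_inv_holomorphic:
  assumes r: "r > 0" "norm (a^2*q^2/prod_list ps) * r < 1"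
  shows "wp_inv a ps holomorphic_on ball 0 r"
proof -
  define \<kappa> where "\<kappa> = a^2*q^2/prod_list ps"
  obtain K where K: "\<And>k. norm (wp_coeff a ps k) \<le> K" using wp_coeff_bounded by blast
  then have K0: "K \<ge> 0" using order_trans[OF norm_ge_zero] by blast
  have "(\<lambda>u. \<Sum>k. wp_coeff a ps k * (\<Prod>j<k. u - q^j) * qinf (a*q*u*q^k) * \<kappa>^k) holomorphic_on ball 0 r"
  proof (rule suminf_holomorphic_on)
    fix x :: complex assume "x \<in> ball 0 r"
    then obtain d where d: "d > 0" "cball x d \<subseteq> ball 0 r" using open_contains_cball open_ball by blast
    define B where "B = K * qbd (1/r) * qbd (norm (a*q) * r)"
    have "norm (wp_coeff a ps k * (\<Prod>j<k. y - q^j) * qinf (a*q*y*q^k) * \<kappa>^k) \<le> B * (norm \<kappa> * r)^k"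
      if y: "y \<in> cball x d" for y k
    proof -
      have ny: "norm y \<le> r" using y d(2) by force
      have "norm (a*q*y*q^k) \<le> norm (a*q) * r * 1"
        unfolding norm_mult[of "a*q*y"] norm_mult[of "a*q"] using ny r(1)
        by (intro mult_mono norm_qpow_le_1) auto
      then have "norm (qinf (a*q*y*q^k)) \<le> qbd (norm (a*q) * r)"
        by (intro norm_qpoch_inf_le') simp
      then have "norm (wp_coeff a ps k * (\<Prod>j<k. y - q^j) * qinf (a*q*y*q^k) * \<kappa>^k)
    \<le> K * (r^k * qbd (1/r)) * qbd (norm (a*q) * r) * norm \<kappa>^k"
        unfolding norm_mult[of _ "\<kappa>^k"] norm_mult[of _ "qinf (a*q*y*q^k)"] norm_mult[of "wp_coeff a ps k"] norm_power[of \<kappa>]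
        using K0 r(1) by (intro mult_mono K norm_prod_diff_qpow_le ny order_refl) (auto simp: qbd_ge_0)
      then show ?thesis by (simp add: B_def power_mult_distrib mult_ac)
    qed
    moreover have "summable (\<lambda>k. B * (norm \<kappa> * r)^k)"
      using r unfolding \<kappa>_def[symmetric] by (intro summable_mult summable_geometric) simp
    ultimately show "\<exists>d>0. cball x d \<subseteq> ball 0 r \<and> (\<exists>M. summable M \<and> (\<forall>k. \<forall>y\<in>cball x d.
        norm (wp_coeff a ps k * (\<Prod>j<k. y - q^j) * qinf (a*q*y*q^k) * \<kappa>^k) \<le> M k))"
      using d by blast
  qed (auto intro!: holomorphic_intros)
  then show ?thesis
    unfolding wp_inv_def \<kappa>_def[symmetric] by (intro holomorphic_intros)
qed

lemma wp_entire_terminating: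
  assumes nz: "a \<noteq> 0" "b \<noteq> 0" "c \<noteq> 0" "d \<noteq> 0" "e \<noteq> 0"
    and den: "qinf (a*q/b) \<noteq> 0" "qinf (a*q/c) \<noteq> 0" "qinf (a*q/d) \<noteq> 0"
      "qinf (a*q/e) \<noteq> 0" "qinf (a*q) \<noteq> 0"
    and z: "norm (a^2*q^2/(b*c*d*e)*q^n) < 1"
  shows "wp_entire a ([b, c, d, e] @ [1/q^n]) = qinf (a^2*q^2/(b*c*d*e)*q^n)
    * (qinf q * qinf (a*q/b) * qinf (a*q/c) * qinf (a*q/d)
    * qinf (a*q/e) * qinf (a*q*q^n)) * (\<Sum>k\<le>n. wp_term a b c d e (q^n) k)"
proof -
  define X where "X = q^n"
  have X: "X \<noteq> 0" using q_nz by (simp add: X_def)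
  define K where "K = (qinf q * qinf (a*q/b) * qinf (a*q/c) * qinf (a*q/d)
    * qinf (a*q/e) * qinf (a*q*X))"
  have arg: "W87_arg q a ([b, c, d, e] @ [1/X]) = (a*q/(b*c)) * (a*q*X/(d*e))"
    by (simp add: W87_arg_def power2_eq_square mult_ac)
  have arg': "a^2*q^2/(b*c*d*e) * X = (a*q/(b*c)) * (a*q*X/(d*e))"
    by (simp add: power2_eq_square mult_ac)
  have "qinf (a*q*X) \<noteq> 0" using den(5) qpoch_inf_split[of "a*q" n] by (auto simp: X_def)
  moreover have sp: "qinf (y*q^k) = qinf y/qfac y k" if "qinf y \<noteq> 0" for y k
    using that qpoch_inf_split[of y k] by (auto simp: field_simps)
  ultimately have s: "qinf (a*q*X*q^k) = qinf (a*q*X)/qfac (a*q*X) k" for k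
    by blast
  have aX: "a*q/(1/X) = a*q*X" by simp
  have t: "wp_coeff a ([b, c, d, e] @ [1/X]) k * ((a*q/(b*c)) * (a*q*X/(d*e)))^k = K * wp_term a b c d e X k" for k
    unfolding wp_coeff_def wp_term_def K_def append.simps list.map prod_list.Cons prod_list.Nil aX power_Suc
      s sp[OF den(1)] sp[OF den(2)] sp[OF den(3)] sp[OF den(4)] sp[OF qpoch_inf_q_nz]
    by (simp add: mult_ac)
  have fin: "wp_coeff a ([b, c, d, e] @ [1/X]) k = 0" if "k > n" for k
    unfolding wp_coeff_snoc X_def by (simp add: qpoch_qinv_pow_eq_0[OF that])
  have "wp_sum a ([b, c, d, e] @ [1/X]) ((a*q/(b*c)) * (a*q*X/(d*e)))
    = (\<Sum>k\<le>n. wp_coeff a ([b, c, d, e] @ [1/X]) k * ((a*q/(b*c)) * (a*q*X/(d*e)))^k)"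
    unfolding wp_sum_def by (rule suminf_finite) (use fin in auto)
  also have "\<dots> = K * (\<Sum>k\<le>n. wp_term a b c d e X k)"
    unfolding t sum_distrib_left ..
  finally show ?thesis
    using wp_entire_eq_sum[of a "[b, c, d, e] @ [1/X]"] z unfolding X_def[symmetric] arg arg' K_def[symmetric] by simp
qed

lemma countable_qpoch_inf_zeros:
  assumes "c \<noteq> 0" "i > 0"
  shows "countable {s. qinf (c * s^i) = 0}" "countable {s. s \<noteq> 0 \<and> qinf (c/s^i) = 0}"
proof -
  have "{s. qinf (c * s^i) = 0} \<subseteq> (\<Union>n. {s. s^i = 1/(c*q^n)})"
    using assms q_nz by (auto simp: qpoch_inf_eq_0_iff field_simps)
  moreover have "countable (\<Union>n. {s. s^i = 1/(c*q^n)})"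
    using finite_nth_roots[OF assms(2)] by (intro countable_UN) (auto intro: countable_finite)
  ultimately show "countable {s. qinf (c * s^i) = 0}" by (rule countable_subset)
  have "{s. s \<noteq> 0 \<and> qinf (c/s^i) = 0} \<subseteq> (\<Union>n. {s. s^i = c*q^n})"
    using assms q_nz by (auto simp: qpoch_inf_eq_0_iff field_simps) metis
  moreover have "countable (\<Union>n. {s. s^i = c*q^n})"
    using finite_nth_roots[OF assms(2)] by (intro countable_UN) (auto intro: countable_finite)
  ultimately show "countable {s. s \<noteq> 0 \<and> qinf (c/s^i) = 0}" by (rule countable_subset)
qed

lemma wp_transformation_generic:
  assumes nz: "a \<noteq> 0" "b \<noteq> 0" "c \<noteq> 0" "d \<noteq> 0" "e \<noteq> 0" "f \<noteq> 0"
    and l: "l = q*a^2/(b*c*d)"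
    and den: "qinf (a*q/b) \<noteq> 0" "qinf (a*q/c) \<noteq> 0" "qinf (a*q/d) \<noteq> 0"
      "qinf (a*q/e) \<noteq> 0" "qinf (a*q) \<noteq> 0" "qinf (l*q/e) \<noteq> 0" "qinf (l*q) \<noteq> 0"
  shows "qinf l * wp_entire a [b, c, d, e, f] = qinf a * wp_entire l [l*b/a, l*c/a, l*d/a, e, f]"
proof -
  have lnz: "l \<noteq> 0" using nz q_nz l by simp
  define \<kappa> where "\<kappa> = a^2*q^2/(b*c*d*e)"
  define \<kappa>' where "\<kappa>' = l^2*q^2/(l*b/a * (l*c/a) * (l*d/a) * e)"
  \<comment> \<open>The factor \<open>(z)_inf\<close> of each series is thus a tail of the factor
    \<open>(a*q/e)_inf\<close> or \<open>(l*q/e)_inf\<close> of the other. This matches the finite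
    factors in the terminating transformation.\<close>
  have k1: "\<kappa> = l*q/e" unfolding \<kappa>_def l using nz by (simp add: field_simps power2_eq_square)
  have k2: "\<kappa>' = a*q/e" unfolding \<kappa>'_def l using nz q_nz by (simp add: field_simps power2_eq_square)
  have pl: "prod_list [b, c, d, e] = b*c*d*e" "prod_list [l*b/a, l*c/a, l*d/a, e] = l*b/a * (l*c/a) * (l*d/a) * e"
    by (simp_all add: mult_ac)
  have s: "l*q/(l*b/a) = a*q/b" "l*q/(l*c/a) = a*q/c" "l*q/(l*d/a) = a*q/d"
    using nz lnz by (simp_all add: field_simps)
  define r where "r = 1/(1 + norm \<kappa> + norm \<kappa>')"
  have r: "r > 0" "norm \<kappa> * r < 1" "norm \<kappa>' * r < 1"
    unfolding r_def using norm_ge_zero[of \<kappa>] norm_ge_zero[of \<kappa>'] by (auto simp: field_simps simp del: norm_ge_zero)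
  define D where "D = (\<lambda>u. qinf l * wp_inv a [b, c, d, e] u - qinf a * wp_inv l [l*b/a, l*c/a, l*d/a, e] u)"
  have D: "D holomorphic_on ball 0 r"
    unfolding D_def using r by (intro holomorphic_intros wp_inv_holomorphic) (simp_all only: pl \<kappa>_def \<kappa>'_def)
  have small: "norm (\<kappa> * u) < 1" "norm (\<kappa>' * u) < 1" if "norm u < r" for u
  proof -
    have "norm \<kappa> * norm u \<le> norm \<kappa> * r" "norm \<kappa>' * norm u \<le> norm \<kappa>' * r"
      using that by (auto intro!: mult_left_mono)
    then show "norm (\<kappa> * u) < 1" "norm (\<kappa>' * u) < 1" using r by (simp_all add: norm_mult)
  qed
  have Du: "D u = qinf l * wp_entire a [b, c, d, e, 1/u] - qinf a * wp_entire l [l*b/a, l*c/a, l*d/a, e, 1/u]"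
    if "u \<noteq> 0" "norm u < r" for u
    using wp_entire_eq_wp_inv[OF that(1), of a "[b, c, d, e]"] wp_entire_eq_wp_inv[OF that(1), of l "[l*b/a, l*c/a, l*d/a, e]"]
      small[OF that(2)] unfolding pl \<kappa>_def[symmetric] \<kappa>'_def[symmetric] D_def by simp
  have Dq: "D (q^n) = 0" if n: "norm (q^n) < r" for n
  proof -
    have qn: "q^n \<noteq> 0" using q_nz by simp
    have 1: "wp_entire a ([b, c, d, e] @ [1/q^n]) = qinf (\<kappa> * q^n)
    * (qinf q * qinf (a*q/b) * qinf (a*q/c) * qinf (a*q/d)
    * qinf (a*q/e) * qinf (a*q*q^n)) * (\<Sum>k\<le>n. wp_term a b c d e (q^n) k)"
      unfolding \<kappa>_def by (rule wp_entire_terminating) (use nz den small(1)[OF n] in \<open>auto simp: \<kappa>_def\<close>)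
    have 2: "wp_entire l ([l*b/a, l*c/a, l*d/a, e] @ [1/q^n]) = qinf (\<kappa>' * q^n)
    * (qinf q * qinf (a*q/b) * qinf (a*q/c) * qinf (a*q/d)
    * qinf (l*q/e) * qinf (l*q*q^n)) * (\<Sum>k\<le>n. wp_term l (l*b/a) (l*c/a) (l*d/a) e (q^n) k)"
      using wp_entire_terminating[of l "l*b/a" "l*c/a" "l*d/a" e n] nz lnz den small(2)[OF n]
      unfolding \<kappa>'_def[symmetric] s by simp
    define S1 where "S1 = (\<Sum>k\<le>n. wp_term a b c d e (q^n) k)"
    define S2 where "S2 = (\<Sum>k\<le>n. wp_term l (l*b/a) (l*c/a) (l*d/a) e (q^n) k)"
    have 3: "S1 * qfac (a*q/e) n * qfac l (Suc n) = S2 * qfac (l*q/e) n * qfac a (Suc n)"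
      unfolding S1_def S2_def
      by (rule wp_terminating_transformation) (use nz l den qpoch_nz_if_inf_nz in auto)
    have 4: "qinf l = qfac l (Suc n) * qinf (l*q*q^n)" "qinf a = qfac a (Suc n) * qinf (a*q*q^n)"
      using qpoch_inf_split[of l "Suc n"] qpoch_inf_split[of a "Suc n"] by (simp_all add: mult.assoc)
    have 5: "qinf (a*q/e) = qfac (a*q/e) n * qinf (a*q/e*q^n)"
      "qinf (l*q/e) = qfac (l*q/e) n * qinf (l*q/e*q^n)"
      by (rule qpoch_inf_split)+
    have "qinf l * wp_entire a ([b, c, d, e] @ [1/q^n])
    = qinf a * wp_entire l ([l*b/a, l*c/a, l*d/a, e] @ [1/q^n])"
      unfolding 1 2 S1_def[symmetric] S2_def[symmetric] 4 unfolding k1 k2 5 using 3 by algebra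
    then show ?thesis using Du[OF qn n] by simp
  qed
  have D0: "D u = 0" if "u \<in> ball 0 r" for u
  proof (rule analytic_continuation[OF D])
    show "(0::complex) islimpt {u \<in> ball 0 r. D u = 0}"
      unfolding islimpt_approachable
    proof safe
      fix \<epsilon> :: real assume "\<epsilon> > 0"
      then have "min \<epsilon> r > 0" using r by simp
      moreover have "(\<lambda>n. norm (q^n)) \<longlonglongrightarrow> 0"
        using q_lt_1 by (intro tendsto_norm_zero LIMSEQ_power_zero)
      ultimately obtain n where n: "norm (q^n) < min \<epsilon> r"
        by (metis (no_types, lifting) eventually_sequentially order_refl order_tendstoD(2))
      then show "\<exists>x'\<in>{u \<in> ball 0 r. D u = 0}. x' \<noteq> 0 \<and> dist x' 0 < \<epsilon>"
        using Dq[of n] q_nz by (intro bexI[of _ "q^n"]) auto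
    qed
  qed (use that r in auto)
  \<comment> \<open>\<open>D\<close> represents the difference of the two sides near
    \<open>u = 0\<close> only. \<open>G\<close> is the same difference on the whole punctured plane,
    where its vanishing near 0 spreads to \<open>u = 1/f\<close>.\<close>
  define G where "G = (\<lambda>u. qinf l * wp_entire a [b, c, d, e, 1/u] - qinf a * wp_entire l [l*b/a, l*c/a, l*d/a, e, 1/u])"
  have h: "(\<lambda>u. wp_entire A [B, C, E, F, 1/u]) holomorphic_on - {0}" if "B \<noteq> 0" "C \<noteq> 0" "E \<noteq> 0" "F \<noteq> 0" for A B C E F
  proof -
    have "(\<lambda>u. wp_entire A (map (\<lambda>f. f u) [\<lambda>_. B, \<lambda>_. C, \<lambda>_. E, \<lambda>_. F, \<lambda>u. 1/u])) holomorphic_on - {0}"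
      by (rule wp_entire_holomorphic) (use that in \<open>auto intro!: holomorphic_intros\<close>)
    then show ?thesis by simp
  qed
  have "G holomorphic_on - {0}"
    unfolding G_def using nz lnz by (intro holomorphic_intros h) auto
  moreover have "connected (- {0::complex})"
    by (rule connected_punctured_plane)
  moreover have "ball (0::complex) r - {0} \<noteq> {}"
  proof -
    have "complex_of_real (r/2) \<in> ball 0 r - {0}" using r by simp
    then show ?thesis by (metis empty_iff)
  qed
  moreover have "G u = 0" if "u \<in> ball 0 r - {0}" for u
    using Du[of u] D0[of u] that by (simp add: G_def)
  ultimately have "G (1/f) = 0"
    by (intro analytic_continuation_open[of "ball 0 r - {0}" "- {0}" G "\<lambda>_. 0" "1/f"]) (use nz in auto)
  then show ?thesis unfolding G_def by simp
qed

text \<open>(III.23) of Gasper and Rahman, cleared of denominators and hence free of genericity assumptions.\<close>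

lemma wp_transformation:
  assumes nz: "a \<noteq> 0" "b \<noteq> 0" "c \<noteq> 0" "d \<noteq> 0" "e \<noteq> 0" "f \<noteq> 0"
    and l: "l = q*a^2/(b*c*d)"
  shows "qinf l * wp_entire a [b, c, d, e, f] = qinf a * wp_entire l [l*b/a, l*c/a, l*d/a, e, f]"
proof -
  have lnz: "l \<noteq> 0" using nz q_nz l by simp
  \<comment> \<open>The curve replaces \<open>a\<close> by \<open>a*s\<close> with
    \<open>b, ..., f\<close> fixed, so \<open>l\<close> becomes \<open>l*s^2\<close> and
    \<open>l*b/a\<close> becomes \<open>l*b/a*s\<close>. Each condition of the generic case then
    concerns a nonzero constant times \<open>s\<close> or \<open>s^2\<close>.\<close>
  define F where "F = (\<lambda>s. qinf (l * s^2) * wp_entire (a * s) [b, c, d, e, f])"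
  define G where "G = (\<lambda>s. qinf (a * s) * wp_entire (l * s^2) [l*b/a * s, l*c/a * s, l*d/a * s, e, f])"
  have "(\<lambda>s. wp_entire (a * s) (map (\<lambda>h. h s) [\<lambda>_. b, \<lambda>_. c, \<lambda>_. d, \<lambda>_. e, \<lambda>_. f])) holomorphic_on - {0}"
    by (rule wp_entire_holomorphic) (use nz in \<open>auto intro!: holomorphic_intros\<close>)
  then have "F holomorphic_on - {0}" unfolding F_def by (auto intro!: holomorphic_intros)
  then have cF: "isCont F 1"
    by (rule holomorphic_isCont_1)
  have "(\<lambda>s. wp_entire (l * s^2) (map (\<lambda>h. h s) [\<lambda>s. l * b/a * s, \<lambda>s. l * c/a * s, \<lambda>s. l * d/a * s, \<lambda>_. e, \<lambda>_. f])) holomorphic_on - {0}"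
    by (rule wp_entire_holomorphic) (use nz lnz in \<open>auto intro!: holomorphic_intros\<close>)
  then have "G holomorphic_on - {0}" unfolding G_def by (auto intro!: holomorphic_intros)
  then have cG: "isCont G 1"
    by (rule holomorphic_isCont_1)
  define B where "B = {s. qinf (a*q/b * s^1) = 0} \<union> {s. qinf (a*q/c * s^1) = 0} \<union> {s. qinf (a*q/d * s^1) = 0}
    \<union> {s. qinf (a*q/e * s^1) = 0} \<union> {s. qinf (a*q * s^1) = 0} \<union> {s. qinf (l*q/e * s^2) = 0}
    \<union> {s. qinf (l*q * s^2) = 0}"
  have "countable B"
    unfolding B_def using nz lnz q_nz by (intro countable_Un countable_qpoch_inf_zeros) auto
  moreover have "F s = G s" if "s \<notin> B" "s \<noteq> 0" for s
  proof -
    have e: "l * s^2*b/(a * s) = l*b/a * s" "l * s^2*c/(a * s) = l*c/a * s" "l * s^2*d/(a * s) = l*d/a * s"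
      using that by (simp_all add: power2_eq_square)
    have "qinf (l * s^2) * wp_entire (a * s) [b, c, d, e, f]
    = qinf (a * s) * wp_entire (l * s^2) [l * s^2*b/(a * s), l * s^2*c/(a * s), l * s^2*d/(a * s), e, f]"
    proof (rule wp_transformation_generic)
      show "l * s^2 = q * (a * s)^2/(b*c*d)" by (simp add: l power_mult_distrib)
    qed (use that nz in \<open>auto simp: B_def mult_ac\<close>)
    then show ?thesis unfolding F_def G_def e .
  qed
  ultimately have "F 1 = G 1" using eq_at_1_if_eq_off_countable[OF cF cG] by blast
  then show ?thesis by (simp add: F_def G_def)
qed

end

section \<open>Theta functions, and division by them\<close>

text \<open>At a zero \<open>x0\<close> of \<open>g\<close> the difference quotients of
  \<open>f\<close> and \<open>g\<close> extend holomorphically, and that of \<open>g\<close> is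
  nonzero at \<open>x0\<close> because the zero is simple. Their quotient is the extension of
  \<open>f/g\<close>, with the value \<open>deriv f x0/deriv g x0\<close>.\<close>

lemma holomorphic_quotient_simple_zeros:
  fixes f g :: "complex \<Rightarrow> complex"
  assumes S: "open S" and f: "f holomorphic_on S" and g: "g holomorphic_on S"
    and zeros: "\<And>x. x \<in> S \<Longrightarrow> g x = 0 \<Longrightarrow> f x = 0 \<and> deriv g x \<noteq> 0"
  shows "\<exists>R. R holomorphic_on S \<and> (\<forall>x\<in>S. f x = g x * R x)"
proof -
  define R where "R = (\<lambda>x. if g x = 0 then deriv f x/deriv g x else f x/g x)"
  have "\<exists>N. open N \<and> x0 \<in> N \<and> N \<subseteq> S \<and> R holomorphic_on N" if x0: "x0 \<in> S" for x0
  proof (cases "g x0 = 0")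
    case True
    define F where "F = (\<lambda>z. if z = x0 then deriv f x0 else (f z - f x0)/(z - x0))"
    define G where "G = (\<lambda>z. if z = x0 then deriv g x0 else (g z - g x0)/(z - x0))"
    have x0i: "x0 \<in> interior S" using S x0 by (simp add: interior_open)
    have F: "F holomorphic_on S" unfolding F_def by (rule pole_lemma[OF f x0i])
    have G: "G holomorphic_on S" unfolding G_def by (rule pole_lemma[OF g x0i])
    have z0: "f x0 = 0" "deriv g x0 \<noteq> 0" using zeros[OF x0 True] by auto
    let ?N = "S \<inter> G -` (- {0})"
    have N: "open ?N"
      by (rule continuous_open_preimage[OF holomorphic_on_imp_continuous_on[OF G] S]) auto
    have "R z = F z/G z" if "z \<in> ?N" for z
      using that True z0 by (auto simp: R_def F_def G_def)
    moreover have "(\<lambda>z. F z/G z) holomorphic_on ?N"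
      by (intro holomorphic_on_divide holomorphic_on_subset[OF F] holomorphic_on_subset[OF G]) auto
    ultimately have "R holomorphic_on ?N" by (subst holomorphic_cong[of ?N ?N R "\<lambda>z. F z/G z"]) auto
    moreover have "x0 \<in> ?N" using x0 z0 by (simp add: G_def)
    ultimately show ?thesis using N by blast
  next
    case False
    let ?N = "S \<inter> g -` (- {0})"
    have N: "open ?N"
      by (rule continuous_open_preimage[OF holomorphic_on_imp_continuous_on[OF g] S]) auto
    have "(\<lambda>z. f z/g z) holomorphic_on ?N"
      by (intro holomorphic_on_divide holomorphic_on_subset[OF f] holomorphic_on_subset[OF g]) auto
    then have "R holomorphic_on ?N"
      by (subst holomorphic_cong[of ?N ?N R "\<lambda>z. f z/g z"]) (auto simp: R_def)
    moreover have "x0 \<in> ?N" using x0 False by simp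
    ultimately show ?thesis using N by blast
  qed
  then have "R holomorphic_on S"
    by (metis S holomorphic_on_imp_differentiable_at holomorphic_onI field_differentiable_at_within)
  moreover have "f x = g x * R x" if "x \<in> S" for x
    using zeros[OF that] by (simp add: R_def)
  ultimately show ?thesis by blast
qed

context q_base
begin

definition theta :: "complex \<Rightarrow> complex" where
  "theta x = qinf x * qinf (q/x)"

lemma theta_q_mult: "x \<noteq> 0 \<Longrightarrow> theta (q*x) = - theta x/x"
proof -
  assume x: "x \<noteq> 0"
  have 1: "qinf x = (1 - x) * qinf (q*x)" using qpoch_inf_step[of x] by (simp add: mult.commute)
  have 2: "qinf (q/(q*x)) = (1 - 1/x) * qinf (q/x)"
    using qpoch_inf_step[of "1/x"] q_nz by simp
  show ?thesis unfolding theta_def 1 2 using x by (simp add: field_simps)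
qed

lemma theta_inverse: "x \<noteq> 0 \<Longrightarrow> theta (1/x) = - theta x/x"
  using theta_q_mult[of x] q_nz by (simp add: theta_def mult.commute)

lemma theta_q_divide: "x \<noteq> 0 \<Longrightarrow> theta (q/x) = theta x"
  using q_nz by (simp add: theta_def)

lemma theta_1 [simp]: "theta 1 = 0"
  using qpoch_inf_step[of 1] by (simp add: theta_def)

lemma theta_q2_mult: "x \<noteq> 0 \<Longrightarrow> theta (q^2*x) = theta x/(q*x^2)"
  using theta_q_mult[of "q*x"] theta_q_mult[of x] q_nz by (simp add: power2_eq_square mult_ac)

lemma theta_holomorphic [holomorphic_intros]:
  assumes "f holomorphic_on S" "\<And>x. x \<in> S \<Longrightarrow> f x \<noteq> 0"
  shows "(\<lambda>x. theta (f x)) holomorphic_on S"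
  unfolding theta_def using assms by (intro holomorphic_intros)

lemma theta_eq_0_cases:
  assumes "theta x = 0" "x \<noteq> 0"
  obtains n where "x*q^n = 1" | n where "x = q^Suc n"
proof -
  consider n where "x*q^n = 1" | n where "q/x*q^n = 1"
    using assms(1) unfolding theta_def by (auto simp: qpoch_inf_eq_0_iff)
  then show thesis
  proof cases
    case (2 n)
    then have "x = q^Suc n" using assms(2) q_nz by (simp add: field_simps)
    then show thesis using that by blast
  qed (use that in blast)
qed

lemma qpow_Suc_ne_1: "q^Suc n \<noteq> 1"
proof -
  have "norm (q^Suc n) < 1"
    unfolding norm_power using q_lt_1 q_nz by (intro power_Suc_less_one) auto
  then show ?thesis by force
qed

lemma qpoch_inf_qpow_nz: "qinf (q^Suc n) \<noteq> 0"
  unfolding qpoch_inf_eq_0_iff by (metis qpow_Suc_ne_1 power_add add_Suc)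

lemma qpoch_qinv_nz: 
  assumes "x*q^n = 1" shows "qfac x n \<noteq> 0"
proof
  assume "qfac x n = 0"
  then obtain k where k: "k < n" "x*q^k = 1" using qpoch_eq_0_imp by blast
  then have "x*q^n = q^Suc (n - Suc k)"
    by (metis Suc_diff_Suc less_imp_Suc_add mult.assoc mult_1 power_add add_diff_cancel_left' add_Suc_right diff_Suc_Suc)
  then show False using assms qpow_Suc_ne_1 by metis
qed

lemma deriv_product_at_zero:
  assumes "(g has_field_derivative g') (at x)" "g x = 0" "K holomorphic_on - {0}" "x \<noteq> 0"
  shows "deriv (\<lambda>y. g y * K y) x = g' * K x"
proof -
  have "K field_differentiable at x"
    using assms(3,4) holomorphic_on_imp_differentiable_at[of K "- {0}" x] by auto
  then obtain K' where "(K has_field_derivative K') (at x)" by (auto simp: field_differentiable_def)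
  from DERIV_mult[OF assms(1) this] show ?thesis using assms(2) by (simp add: DERIV_imp_deriv)
qed

text \<open>The one vanishing factor of the product is split off. At the zero the derivative is that
  of this factor times the remaining product \<open>K\<close>, which is nonzero there.\<close>

lemma theta_simple_zeros:
  assumes "theta x = 0" "x \<noteq> 0"
  shows "deriv theta x \<noteq> 0"
  using assms
proof (cases rule: theta_eq_0_cases)
  case (1 n)
  define K where "K = (\<lambda>y. qfac y n * qinf (y*q^Suc n) * qinf (q/y))"
  have "theta y = (1 - y*q^n) * K y" for y
    unfolding theta_def K_def using qpoch_inf_split[of y "Suc n"] by (simp add: qpoch_Suc mult_ac)
  then have t: "theta = (\<lambda>y. (1 - y*q^n) * K y)" by (rule ext)
  have "K holomorphic_on - {0}" unfolding K_def by (auto intro!: holomorphic_intros)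
  moreover have "((\<lambda>y. 1 - y*q^n) has_field_derivative - (q^n)) (at x)" by (auto intro!: derivative_eq_intros)
  ultimately have "deriv theta x = - (q^n) * K x"
    unfolding t using deriv_product_at_zero[of "\<lambda>y. 1 - y*q^n"] 1 assms(2) by simp
  moreover have "K x \<noteq> 0"
  proof -
    have "x = 1/q^n" using 1 q_nz by (simp add: field_simps)
    then have "x*q^Suc n = q" "q/x = q^Suc n" using q_nz by simp_all
    then show ?thesis using qpoch_qinv_nz[OF 1] qpoch_inf_q_nz qpoch_inf_qpow_nz unfolding K_def by (metis mult_eq_0_iff)
  qed
  ultimately show ?thesis using q_nz by simp
next
  case (2 n)
  define K where "K = (\<lambda>y. qinf y * (qfac (q/y) n * qinf (q/y*q^Suc n)))"
  have "theta y = (1 - q/y*q^n) * K y" for y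
    unfolding theta_def K_def using qpoch_inf_split[of "q/y" "Suc n"] by (simp only: qpoch_Suc mult_ac)
  then have t: "theta = (\<lambda>y. (1 - q/y*q^n) * K y)" by (rule ext)
  have "K holomorphic_on - {0}" unfolding K_def by (auto intro!: holomorphic_intros)
  moreover have qx: "q/x*q^n = 1" using 2 q_nz by simp
  moreover have "((\<lambda>y. 1 - q/y*q^n) has_field_derivative q/(x*x)*q^n) (at x)"
    using assms(2) by (auto intro!: derivative_eq_intros simp: power2_eq_square)
  ultimately have "deriv theta x = q/(x*x)*q^n * K x"
    unfolding t using deriv_product_at_zero[of "\<lambda>y. 1 - q/y*q^n"] assms(2) by simp
  moreover have "K x \<noteq> 0"
  proof -
    have "q/x*q^Suc n = q" using qx by simp
    then show ?thesis using qpoch_qinv_nz[OF qx] qpoch_inf_q_nz qpoch_inf_qpow_nz 2 q_nz unfolding K_def by simp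
  qed
  ultimately show ?thesis using q_nz assms(2) by simp
qed

lemma holomorphic_divide_theta:
  assumes f: "f holomorphic_on - {0}" and c: "c \<noteq> 0"
    and zeros: "\<And>x. x \<noteq> 0 \<Longrightarrow> theta (c*x^Suc i) = 0 \<Longrightarrow> f x = 0"
  shows "\<exists>R. R holomorphic_on - {0} \<and> (\<forall>x. x \<noteq> 0 \<longrightarrow> f x = theta (c*x^Suc i) * R x)"
proof -
  let ?g = "\<lambda>x. theta (c*x^Suc i)"
  have g: "?g holomorphic_on - {0}" using c by (auto intro!: holomorphic_intros)
  have "deriv ?g x \<noteq> 0" if x: "x \<noteq> 0" "?g x = 0" for x
  proof -
    have nz: "c*x^Suc i \<noteq> 0" using c x by simp
    have "theta holomorphic_on - {0}"
      using theta_holomorphic[of "\<lambda>x. x" "- {0}"] by (simp add: holomorphic_on_ident)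
    then have "(theta has_field_derivative deriv theta (c*x^Suc i)) (at (c*x^Suc i))"
      using nz by (intro holomorphic_derivI[of _ "- {0}"]) auto
    moreover have "((\<lambda>x. c * x^Suc i) has_field_derivative c * (of_nat (Suc i) * x^i)) (at x)"
      by (rule derivative_eq_intros refl | simp)+
    ultimately have "(?g has_field_derivative deriv theta (c*x^Suc i) * (c * (of_nat (Suc i) * x^i))) (at x)"
      by (rule DERIV_chain2)
    then have "deriv ?g x = deriv theta (c*x^Suc i) * (c * (of_nat (Suc i) * x^i))" by (rule DERIV_imp_deriv)
    then show ?thesis using theta_simple_zeros[OF x(2) nz] c x by (simp del: of_nat_Suc)
  qed
  then show ?thesis
    using holomorphic_quotient_simple_zeros[OF _ f g] zeros open_Compl[OF closed_singleton, of "0::complex"] by auto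
qed

text \<open>The annulus \<open>norm q \<le> norm x \<le> 1\<close> meets every orbit of
  multiplication by \<open>q\<close>, so \<open>R\<close> is bounded on the punctured plane. Its
  composition with \<open>exp\<close> is then a bounded entire function.\<close>

lemma q_periodic_constant:
  assumes R: "R holomorphic_on - {0}" and per: "\<And>x. x \<noteq> 0 \<Longrightarrow> R (q*x) = R x"
  shows "\<exists>C. \<forall>x. x \<noteq> 0 \<longrightarrow> R x = C"
proof -
  let ?A = "cball 0 1 - ball 0 (norm q) :: complex set"
  have "continuous_on ?A R"
    by (rule holomorphic_on_imp_continuous_on[OF holomorphic_on_subset[OF R]]) (use q_nz in auto)
  then have "compact (R ` ?A)" by (intro compact_continuous_image compact_diff) auto
  then obtain M where M: "\<And>x. x \<in> ?A \<Longrightarrow> norm (R x) \<le> M" using compact_imp_bounded bounded_iff by (metis imageI)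
  have up: "R (q^n*x) = R x" if "x \<noteq> 0" for x n
    by (induction n) (use per that q_nz in \<open>simp_all add: mult.assoc\<close>)
  have small: "norm (R x) \<le> M" if x: "x \<noteq> 0" "norm x \<le> 1" for x
  proof -
    have ex: "\<exists>n. norm q^Suc n \<le> norm x"
    proof -
      obtain N where "norm q^N < norm x"
        using q_lt_1 x(1) real_arch_pow_inv[of "norm x" "norm q"] by auto
      moreover have "norm q^Suc N \<le> norm q^N" using q_lt_1 by (intro power_decreasing) auto
      ultimately show ?thesis by (intro exI[of _ N]) linarith
    qed
    \<comment> \<open>The least such \<open>n\<close> brings \<open>x/q^n\<close> into the closed
      annulus.\<close>
    define n where "n = (LEAST n. norm q^Suc n \<le> norm x)"
    have n1: "norm q^Suc n \<le> norm x" unfolding n_def using ex by (rule LeastI_ex)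
    have n2: "norm x \<le> norm q^n"
    proof (cases n)
      case (Suc m)
      then have "\<not> norm q^Suc m \<le> norm x" unfolding n_def by (metis lessI not_less_Least)
      then show ?thesis using Suc by simp
    qed (use x in simp)
    have p: "norm q^n > 0" using q_nz by simp
    have "x/q^n \<in> ?A"
      using n1 n2 p by (auto simp: norm_divide norm_power field_simps)
    moreover have "x/q^n \<noteq> 0" "q^n * (x/q^n) = x" using x q_nz by simp_all
    ultimately show ?thesis using M up[of "x/q^n" n] by metis
  qed
  have bound: "norm (R x) \<le> M" if x: "x \<noteq> 0" for x
  proof -
    obtain N where "norm x * norm q^N < 1" using ex_norm_mult_qpow by blast
    then have "norm (q^N*x) \<le> 1" by (simp add: norm_mult norm_power mult.commute)
    then show ?thesis using small[of "q^N*x"] up[OF x, of N] x q_nz by simp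
  qed
  have "(R \<circ> exp) holomorphic_on UNIV"
    by (rule holomorphic_on_compose_gen[OF _ R]) (auto intro!: holomorphic_intros)
  moreover have "bounded (range (R \<circ> exp))" unfolding bounded_iff using bound by (intro exI[of _ M]) auto
  ultimately have "(R \<circ> exp) constant_on UNIV" by (rule Liouville_theorem)
  then obtain C where C: "\<And>w. R (exp w) = C" by (auto simp: constant_on_def)
  show ?thesis
  proof (intro exI allI impI)
    fix x :: complex assume "x \<noteq> 0"
    then show "R x = C" using C[of "ln x"] by (simp add: exp_Ln)
  qed
qed

section \<open>The bilateral sum and its transformation laws\<close>

text \<open>A term of nonnegative index of the bilateral very-well-poised series with base
  \<open>y^2\<close> and the six parameters \<open>t*y\<close>, cleared of denominators. The
  constant factor \<open>qinf (q/(t*y))\<close> clears those of the terms of negative index and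
  makes the term of index \<open>-k\<close> equal to \<open>-(y^2)\<close> times the term of index
  \<open>k\<close> at \<open>1/y\<close>.\<close>

definition bil_term :: "complex list \<Rightarrow> complex \<Rightarrow> nat \<Rightarrow> complex" where
  "bil_term ts y k = (1 - y^2*q^k*q^k)
    * (\<Prod>t\<leftarrow>ts. qfac (t*y) k * qinf (y*q/t*q^k) * qinf (q/(t*y)))
    * (q^2/prod_list ts)^k"

lemma bil_term_holomorphic:
  assumes "\<And>t. t \<in> set ts \<Longrightarrow> t \<noteq> 0"
  shows "(\<lambda>y. bil_term ts y k) holomorphic_on - {0}"
proof -
  have "(\<lambda>y. \<Prod>g\<leftarrow>map (\<lambda>t y. qfac (t*y) k * qinf (y*q/t*q^k) * qinf (q/(t*y))) ts. g y) holomorphic_on - {0}"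
    by (rule prod_list_holomorphic) (use assms in \<open>auto intro!: holomorphic_intros\<close>)
  then show ?thesis unfolding bil_term_def map_map o_def by (intro holomorphic_intros)
qed

lemma bil_term_bound:
  assumes y: "norm y \<le> C" and t: "\<And>t. t \<in> set ts \<Longrightarrow> norm (t*y) \<le> C \<and> norm (y*q/t) \<le> C \<and> norm (q/(t*y)) \<le> C"
  shows "norm (bil_term ts y k) \<le> (1 + C^2) * (qbd C * qbd C * qbd C)^length ts * norm (q^2/prod_list ts)^k"
proof -
  have C: "C \<ge> 0" using y norm_ge_zero order_trans by blast
  have "norm (1 - y^2*q^k*q^k) \<le> 1 + norm (y^2*q^k*q^k)" by (metis norm_one norm_triangle_ineq4)
  also have "norm (y^2*q^k*q^k) \<le> C^2 * 1 * 1"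
    unfolding norm_mult norm_power[of y] using y C by (intro mult_mono norm_qpow_le_1 power_mono) auto
  finally have 1: "norm (1 - y^2*q^k*q^k) \<le> 1 + C^2" by simp
  have le: "norm (x*q^k) \<le> C" if "norm x \<le> C" for x
    using mult_mono[OF that norm_qpow_le_1[of k] C] by (simp add: norm_mult)
  have "norm (\<Prod>t\<leftarrow>ts. qfac (t*y) k * qinf (y*q/t*q^k) * qinf (q/(t*y)))
    \<le> (qbd C * qbd C * qbd C)^length ts"
  proof (rule norm_prod_list_le_power)
    fix t' assume "t' \<in> set ts"
    from t[OF this] show "norm (qfac (t' * y) k * qinf (y*q/t' * q^k) * qinf (q/(t'*y))) \<le> qbd C * qbd C * qbd C"
      unfolding norm_mult[of "_ * _"] norm_mult[of "qfac (t' * y) k"]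
      by (intro mult_mono norm_qpoch_le' norm_qpoch_inf_le' le) (auto simp: qbd_ge_0)
  qed (auto simp: qbd_ge_0)
  then show ?thesis
    unfolding bil_term_def norm_mult[of "_ * _"] norm_mult[of "1 - _"] norm_power[of "q^2/prod_list ts"]
    by (intro mult_mono 1 order_refl) (auto simp: qbd_ge_0)
qed

lemma bil_term_locally_bounded:
  assumes "y \<noteq> 0" "\<And>t. t \<in> set ts \<Longrightarrow> t \<noteq> 0"
  shows "\<exists>d>0. cball y d \<subseteq> - {0} \<and> (\<exists>B. \<forall>k. \<forall>x\<in>cball y d. norm (bil_term ts x k) \<le> B * norm (q^2/prod_list ts)^k)"
proof -
  define hs where "hs = (\<lambda>y. y) # map (\<lambda>t y. t * y) ts @ map (\<lambda>t y. y*q/t) ts @ map (\<lambda>t y. q/(t*y)) ts"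
  have "h holomorphic_on - {0}" if "h \<in> set hs" for h
    using that assms(2) unfolding hs_def by (auto intro!: holomorphic_intros)
  then obtain d C where d: "d > 0" "cball y d \<subseteq> - {0}" "\<forall>h\<in>set hs. \<forall>x\<in>cball y d. norm (h x) \<le> C"
    using holomorphic_list_locally_bounded[of "- {0}" hs y] assms(1) by auto
  have "norm (bil_term ts x k) \<le> (1 + C^2) * (qbd C * qbd C * qbd C)^length ts * norm (q^2/prod_list ts)^k"
    if "x \<in> cball y d" for x k
  proof (rule bil_term_bound)
    show "norm x \<le> C" using d(3) that by (simp add: hs_def)
    show "norm (t*x) \<le> C \<and> norm (x*q/t) \<le> C \<and> norm (q/(t*x)) \<le> C" if "t \<in> set ts" for t
    proof -
      have "(\<lambda>y. t * y) \<in> set hs" "(\<lambda>y. y*q/t) \<in> set hs" "(\<lambda>y. q/(t*y)) \<in> set hs"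
        using that by (auto simp: hs_def)
      then show ?thesis using d(3) \<open>x \<in> cball y d\<close> by fastforce
    qed
  qed
  then show ?thesis using d(1,2) by blast
qed

definition bil_half :: "complex list \<Rightarrow> complex \<Rightarrow> complex" where
  "bil_half ts y = (\<Sum>k. bil_term ts y k)"

text \<open>The terms with negative index are reflected to \<open>1/y\<close>; the last summand corrects the index \<open>0\<close>.\<close>

definition bil_sum :: "complex list \<Rightarrow> complex \<Rightarrow> complex" where
  "bil_sum ts y = bil_half ts y - y^2 * bil_half ts (1/y) - bil_term ts y 0"

context
  fixes ts :: "complex list"
  assumes ts_nz: "\<And>t. t \<in> set ts \<Longrightarrow> t \<noteq> 0" and arg: "norm (q^2/prod_list ts) < 1" and len: "length ts = 6"
begin

lemma bil_summable: "y \<noteq> 0 \<Longrightarrow> summable (bil_term ts y)"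
proof -
  assume "y \<noteq> 0"
  then obtain d B where d: "d > 0" "\<forall>k. \<forall>x\<in>cball y d. norm (bil_term ts x k) \<le> B * norm (q^2/prod_list ts)^k"
    using bil_term_locally_bounded[of y ts] ts_nz by blast
  show ?thesis
  proof (rule summable_comparison_test')
    show "summable (\<lambda>k. B * norm (q^2/prod_list ts)^k)" using arg by (intro summable_mult summable_geometric) simp
    show "norm (bil_term ts y k) \<le> B * norm (q^2/prod_list ts)^k" if "k \<ge> 0" for k using d by simp
  qed
qed

lemma bil_half_holomorphic: "bil_half ts holomorphic_on - {0}"
  unfolding bil_half_def
proof (rule suminf_holomorphic_on)
  fix y :: complex assume "y \<in> - {0}"
  then obtain d B where d: "d > 0" "cball y d \<subseteq> - {0}" "\<forall>k. \<forall>x\<in>cball y d. norm (bil_term ts x k) \<le> B * norm (q^2/prod_list ts)^k"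
    using bil_term_locally_bounded[of y ts] ts_nz by auto
  moreover have "summable (\<lambda>k. B * norm (q^2/prod_list ts)^k)" using arg by (intro summable_mult summable_geometric) simp
  ultimately show "\<exists>d>0. cball y d \<subseteq> - {0} \<and> (\<exists>M. summable M \<and> (\<forall>k. \<forall>x\<in>cball y d. norm (bil_term ts x k) \<le> M k))"
    by blast
qed (use bil_term_holomorphic ts_nz in auto)

lemma bil_sum_holomorphic: "bil_sum ts holomorphic_on - {0}"
proof -
  have "(bil_half ts \<circ> (\<lambda>y. 1/y)) holomorphic_on - {0}"
    by (rule holomorphic_on_compose_gen[OF _ bil_half_holomorphic]) (auto intro!: holomorphic_intros)
  then have "(\<lambda>y. bil_half ts (1/y)) holomorphic_on - {0}" by (simp add: o_def)
  moreover have "(\<lambda>y. bil_term ts y 0) holomorphic_on - {0}" by (rule bil_term_holomorphic) (rule ts_nz)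
  ultimately show ?thesis unfolding bil_sum_def[abs_def] using bil_half_holomorphic by (intro holomorphic_intros)
qed

lemma bil_term_0_inverse: "y \<noteq> 0 \<Longrightarrow> - (y^2) * bil_term ts (1/y) 0 = bil_term ts y 0"
  unfolding bil_term_def by (simp add: field_simps power2_eq_square)

lemma bil_sum_inverse: "y \<noteq> 0 \<Longrightarrow> bil_sum ts (1/y) = - bil_sum ts y/y^2"
  using bil_term_0_inverse[of y, symmetric] unfolding bil_sum_def by (simp add: field_simps)

text \<open>Multiplying \<open>y\<close> by \<open>q\<close> shifts the index by one. Each of the
  six parameters contributes \<open>-1/(t*y)\<close> and the power of the argument contributes
  \<open>prod_list ts/q^2\<close>, whence \<open>1/(q^2*y^6)\<close>.\<close>

lemma bil_term_q_mult: "y \<noteq> 0 \<Longrightarrow> bil_term ts (q*y) k = bil_term ts y (Suc k)/(q^2*y^6)"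
proof -
  assume y: "y \<noteq> 0"
  have *: "qfac (t * (q*y)) k * qinf (q*y*q/t*q^k) * qinf (q/(t * (q*y)))
    = (- 1/(t*y)) * (qfac (t*y) (Suc k) * qinf (y*q/t*q^Suc k) * qinf (q/(t*y)))" if "t \<in> set ts" for t
  proof -
    have "t \<noteq> 0" using ts_nz that by blast
    then have a1: "qinf (q/(t * (q*y))) = (1 - 1/(t*y)) * qinf (q/(t*y))"
      using qpoch_inf_step[of "1/(t*y)"] q_nz by simp
    have a2: "1 - 1/(t*y) = (- 1/(t*y)) * (1 - t*y)" using \<open>t \<noteq> 0\<close> y by (simp add: field_simps)
    have a3: "qfac (t*y) (Suc k) = (1 - t*y) * qfac (t * (q*y)) k"
      by (subst qpoch_Suc') (simp add: mult_ac)
    have a4: "q*y*q/t*q^k = y*q/t*q^Suc k" by simp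
    show ?thesis unfolding a1 a2 a3 a4 by (simp only: mult_ac)
  qed
  have "(\<Prod>t\<leftarrow>ts. qfac (t * (q*y)) k * qinf (q*y*q/t*q^k) * qinf (q/(t * (q*y))))
    = (\<Prod>t\<leftarrow>ts. (- 1/(t*y)) * (qfac (t*y) (Suc k) * qinf (y*q/t*q^Suc k) * qinf (q/(t*y))))"
    by (intro arg_cong[of _ _ prod_list] map_cong refl *)
  also have "\<dots> = (\<Prod>t\<leftarrow>ts. - 1/(t*y)) * (\<Prod>t\<leftarrow>ts. qfac (t*y) (Suc k) * qinf (y*q/t*q^Suc k) * qinf (q/(t*y)))"
    by (rule prod_list_mult_map)
  also have "(\<Prod>t\<leftarrow>ts. - 1/(t*y)) = 1/(prod_list ts*y^6)"
  proof -
    have "(\<Prod>t\<leftarrow>us. - 1/(t*y)) = (- 1)^length us/(prod_list us*y^length us)" for us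
      by (induction us) (simp_all add: field_simps)
    then show ?thesis using len by simp
  qed
  finally have P: "(\<Prod>t\<leftarrow>ts. qfac (t * (q*y)) k * qinf (q*y*q/t*q^k) * qinf (q/(t * (q*y))))
    = 1/(prod_list ts*y^6) * (\<Prod>t\<leftarrow>ts. qfac (t*y) (Suc k) * qinf (y*q/t*q^Suc k) * qinf (q/(t*y)))" .
  have "(q*y)^2*q^k*q^k = y^2*q^Suc k*q^Suc k" by (simp add: power2_eq_square mult_ac)
  moreover have "prod_list ts \<noteq> 0" using ts_nz by (auto simp: prod_list_zero_iff)
  ultimately show ?thesis unfolding bil_term_def P using y q_nz by (simp add: field_simps)
qed

text \<open>For the full sum the index shift is a reindexing. In terms of the two halves one term
  crosses index 0, and the correction in \<open>bil_sum\<close> compensates it because the term of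
  index 0 is its own reflection.\<close>

lemma bil_sum_q_mult: "y \<noteq> 0 \<Longrightarrow> bil_sum ts (q*y) = bil_sum ts y/(q^2*y^6)"
proof -
  assume y: "y \<noteq> 0"
  have sh: "bil_half ts x = bil_term ts x 0 + q^2*x^6 * bil_half ts (q*x)" if "x \<noteq> 0" for x
  proof -
    have "bil_term ts x (Suc k) = q^2*x^6 * bil_term ts (q*x) k" for k
      using bil_term_q_mult[OF that, of k] that q_nz by (simp add: field_simps)
    then have "(\<Sum>k. bil_term ts x (Suc k)) = q^2*x^6 * bil_half ts (q*x)"
      unfolding bil_half_def using bil_summable[of "q*x"] that q_nz by (simp add: suminf_mult)
    then show ?thesis using suminf_split_head[OF bil_summable[OF that]] unfolding bil_half_def by (simp add: algebra_simps)
  qed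
  have 1: "bil_half ts y = bil_term ts y 0 + q^2*y^6 * bil_half ts (q*y)" by (rule sh[OF y])
  have 2: "bil_half ts (1/(q*y)) = bil_term ts (1/(q*y)) 0 + q^2 * (1/(q*y))^6 * bil_half ts (1/y)"
    using sh[of "1/(q*y)"] y q_nz by simp
  have 3: "bil_term ts (q*y) 0 = - ((q*y)^2) * bil_term ts (1/(q*y)) 0"
    by (rule bil_term_0_inverse[symmetric]) (use y q_nz in simp)
  have "bil_sum ts (q*y) = bil_half ts (q*y) - (q*y)^2 * (q^2 * (1/(q*y))^6 * bil_half ts (1/y))"
    unfolding bil_sum_def 2 3 by (simp add: algebra_simps)
  also have "(q*y)^2 * (q^2 * (1/(q*y))^6 * bil_half ts (1/y)) = y^2 * bil_half ts (1/y)/(q^2*y^6)"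
    using y q_nz by (simp add: field_simps)
  finally show ?thesis unfolding bil_sum_def 1 using y q_nz by (simp add: field_simps)
qed

text \<open>At \<open>y = t\<close> the reflected terms contain
  \<open>qfac (t * (1/t)) k = 0\<close> for \<open>k > 0\<close>, so the bilateral sum terminates on
  the left.\<close>

lemma bil_sum_at_param:
  assumes "t \<in> set ts"
  shows "bil_sum ts t = bil_half ts t"
proof -
  have t: "t \<noteq> 0" using ts_nz assms by blast
  have "bil_term ts (1/t) k = 0" if "k \<notin> {0}" for k
  proof -
    have "qfac (t * (1/t)) k = 0" using t that by (cases k) (simp_all add: qpoch_Suc')
    then have "0 \<in> set (map (\<lambda>u. qfac (u * (1/t)) k * qinf (1/t*q/u*q^k) * qinf (q/(u * (1/t)))) ts)"
      using assms by force
    then have "(\<Prod>u\<leftarrow>ts. qfac (u * (1/t)) k * qinf (1/t*q/u*q^k) * qinf (q/(u * (1/t)))) = 0"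
      by (simp only: prod_list_zero_iff)
    then show ?thesis unfolding bil_term_def by (simp only: mult_zero_right mult_zero_left)
  qed
  then have "bil_half ts (1/t) = bil_term ts (1/t) 0"
    unfolding bil_half_def by (subst suminf_finite[of "{0}"]) auto
  then show ?thesis unfolding bil_sum_def using bil_term_0_inverse[OF t] by simp
qed

end

section \<open>Odd theta functions of degree six and their interpolation\<close>

text \<open>It is \<open>f x/x\<close> that changes sign under inversion of \<open>x\<close>. The
  exponent 6 in the multiplier is the degree.\<close>

definition odd_theta_fun :: "(complex \<Rightarrow> complex) \<Rightarrow> bool" where
  "odd_theta_fun f \<longleftrightarrow> f holomorphic_on - {0} \<and> (\<forall>x. x \<noteq> 0 \<longrightarrow> f (q*x) = f x/(q^2*x^6)) \<and>
     (\<forall>x. x \<noteq> 0 \<longrightarrow> f (1/x) = - f x/x^2)"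

lemma odd_theta_fun_qpow_zero:
  assumes "odd_theta_fun f" "x \<noteq> 0"
  shows "f (q^n*x) = 0 \<longleftrightarrow> f x = 0"
  using assms(2)
proof (induction n arbitrary: x)
  case (Suc n)
  have "f (q^Suc n * x) = 0 \<longleftrightarrow> f (q^n * (q*x)) = 0" by (simp add: mult_ac)
  also have "\<dots> \<longleftrightarrow> f (q*x) = 0" using Suc q_nz by simp
  also have "\<dots> \<longleftrightarrow> f x = 0" using assms(1) Suc.prems q_nz unfolding odd_theta_fun_def by simp
  finally show ?case .
qed simp

lemma odd_theta_fun_inverse_zero:
  "odd_theta_fun f \<Longrightarrow> x \<noteq> 0 \<Longrightarrow> f (1/x) = 0 \<longleftrightarrow> f x = 0"
  unfolding odd_theta_fun_def by simp

text \<open>A power of \<open>q\<close> moves \<open>x\<close> to some \<open>w\<close> with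
  \<open>w^2 = 1\<close> or \<open>w^2 = 1/q\<close>. If \<open>1/w = w\<close>, oddness gives
  \<open>f w = - f w\<close>; if \<open>1/w = q*w\<close>, the two laws give \<open>f (q*w)\<close>
  opposite values. These are the four forced classes of zeros modulo \<open>q\<close>.\<close>

lemma odd_theta_fun_zero:
  assumes f: "odd_theta_fun f" and x: "x \<noteq> 0" "theta (x^2) = 0"
  shows "f x = 0"
proof -
  have main: "f x = 0" if x: "x \<noteq> 0" "x^2*q^n = 1" for x n
  proof (cases "even n")
    case True
    then obtain m where m: "n = m + m" by (metis evenE mult_2)
    define w where "w = q^m*x"
    have "w*w = 1" using x(2) unfolding w_def m by (simp add: power_add power2_eq_square mult_ac)
    then have "w \<noteq> 0" "1/w = w" "w^2 = 1" by (auto simp: power2_eq_square divide_simps)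
    then have "f w = - f w" using f unfolding odd_theta_fun_def by (metis div_by_1)
    then have "f w = 0" by (simp add: eq_neg_iff_add_eq_0)
    then show ?thesis unfolding w_def using odd_theta_fun_qpow_zero[OF f x(1)] by simp
  next
    case False
    then obtain m where m: "n = m + m + 1" by (metis oddE mult_2)
    define w where "w = q^m*x"
    have w2: "w * (q*w) = 1" using x(2) unfolding w_def m by (simp add: power_add power2_eq_square mult_ac)
    then have w: "w \<noteq> 0" "1/w = q*w" by (auto simp: divide_simps mult_ac)
    have w2': "w^2 = 1/q" using w2 q_nz by (simp add: field_simps power2_eq_square)
    have "w^6 = (w^2)^3" by (simp flip: power_mult)
    then have "q^2*w^6 = w^2" unfolding w2' using q_nz by (simp add: field_simps power2_eq_square power3_eq_cube)
    then have "f (q*w) = f w/w^2" using f w(1) unfolding odd_theta_fun_def by simp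
    moreover have "f (q*w) = - f w/w^2" using f w unfolding odd_theta_fun_def by metis
    ultimately have "f w = 0" using w(1) by (simp add: eq_neg_iff_add_eq_0)
    then show ?thesis unfolding w_def using odd_theta_fun_qpow_zero[OF f x(1)] by simp
  qed
  have "x^2 \<noteq> 0" using x by simp
  from theta_eq_0_cases[OF x(2) this] show ?thesis
  proof cases
    case (1 n)
    then show ?thesis using main x by blast
  next
    case (2 n)
    then have "(1/x)^2*q^Suc n = 1" using x q_nz by (simp add: power_divide)
    then have "f (1/x) = 0" using main[of "1/x" "Suc n"] x by simp
    then show ?thesis using odd_theta_fun_inverse_zero[OF f x(1)] by simp
  qed
qed

lemma theta_qpow_zero: "x \<noteq> 0 \<Longrightarrow> theta (q^n*x) = 0 \<longleftrightarrow> theta x = 0"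
proof (induction n)
  case (Suc n)
  then have "q^n * x \<noteq> 0" using q_nz by simp
  then show ?case using theta_q_mult[of "q^n*x"] Suc q_nz by (simp add: mult.assoc)
qed simp

text \<open>A function with these transformation laws has six zeros modulo \<open>q\<close>; four of them are forced
  by oddness.  One more pair of zeros determines it up to a factor, and two more pairs make it vanish.\<close>

lemma odd_theta_fun_eq_0:
  assumes f: "odd_theta_fun f" and y: "y \<noteq> 0" "theta (y^2) \<noteq> 0" "f y = 0"
    and z: "z \<noteq> 0" "theta (z^2) \<noteq> 0" "f z = 0" "theta (y*z) \<noteq> 0" "theta (z/y) \<noteq> 0"
    and x: "x \<noteq> 0"
  shows "f x = 0"
proof -
  have hol: "f holomorphic_on - {0}" and fq: "\<And>x. x \<noteq> 0 \<Longrightarrow> f (q*x) = f x/(q^2*x^6)"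
    using f by (auto simp: odd_theta_fun_def)
  \<comment> \<open>Besides the vanishing of \<open>f\<close>, the division below needs that the
    zeros of the three theta factors are disjoint; only then do the zeros of \<open>f\<close>
    survive the preceding divisions. The conditions on \<open>y^2\<close> ensure this.\<close>
  have yz: "f x = 0" "theta (x^2) \<noteq> 0" if "theta (y*x) = 0" "x \<noteq> 0" for x
  proof -
    have "y * x \<noteq> 0" using y that by simp
    with that(1) have "f x = 0 \<and> theta (x^2) \<noteq> 0"
    proof (cases rule: theta_eq_0_cases)
      case (1 n)
      then have e: "q^n*x = 1/y" using y by (simp add: field_simps)
      then have "f (q^n*x) = 0" using odd_theta_fun_inverse_zero[OF f y(1)] y(3) by simp
      moreover have "q^(2*n) * x^2 = 1/y^2" using e by (metis power_divide power_mult power_mult_distrib power_one mult.commute)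
      then have "theta (q^(2*n) * x^2) \<noteq> 0" using theta_inverse[of "y^2"] y by simp
      ultimately show ?thesis
        using odd_theta_fun_qpow_zero[OF f that(2), of n] theta_qpow_zero[of "x^2" "2*n"] that(2) by simp
    next
      case (2 n)
      then have e: "x = q^Suc n * (1/y)" using y by (simp add: field_simps)
      then have "f x = 0" using odd_theta_fun_qpow_zero[OF f, of "1/y" "Suc n"] odd_theta_fun_inverse_zero[OF f y(1)] y by simp
      moreover have "x^2 = q^(2 * Suc n) * (1/y^2)" using e by (metis power_divide power_mult power_mult_distrib power_one mult.commute)
      then have "theta (x^2) \<noteq> 0" using theta_inverse[of "y^2"] theta_qpow_zero[of "1/y^2" "2 * Suc n"] y by simp
      ultimately show ?thesis by blast
    qed
    then show "f x = 0" "theta (x^2) \<noteq> 0" by auto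
  qed
  have dbl: "q^(2*n) = q^n*q^n" for n by (simp only: mult_2 power_add)
  have yz': "f x = 0" "theta (x^2) \<noteq> 0" "theta (y*x) \<noteq> 0" if "theta (1/y*x) = 0" "x \<noteq> 0" for x
  proof -
    have "1/y * x \<noteq> 0" using y that by simp
    with that(1) have "f x = 0 \<and> theta (x^2) \<noteq> 0 \<and> theta (y*x) \<noteq> 0"
    proof (cases rule: theta_eq_0_cases)
      case (1 n)
      then have e: "q^n*x = y" using y by (simp add: field_simps)
      then have "q^(2*n) * x^2 = y^2" "q^n * (y*x) = y^2"
        using dbl by (auto simp: power2_eq_square mult_ac simp del: power_Suc)
      then show ?thesis
        using odd_theta_fun_qpow_zero[OF f that(2), of n] theta_qpow_zero[of "x^2" "2*n"] theta_qpow_zero[of "y*x" n] that(2) y e by simp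
    next
      case (2 n)
      then have e: "x = q^Suc n * y" using y by (simp add: field_simps)
      then have e2: "x^2 = q^(2 * Suc n) * y^2" "y*x = q^Suc n * y^2"
        unfolding dbl[of "Suc n"] by (simp_all only: power2_eq_square mult_ac)
      have "f x = 0" unfolding e using odd_theta_fun_qpow_zero[OF f y(1)] y(3) by blast
      moreover have "theta (x^2) \<noteq> 0" "theta (y*x) \<noteq> 0"
        unfolding e2 using theta_qpow_zero[of "y^2"] y(1,2) by (simp_all del: power_Suc mult_Suc_right)
      ultimately show ?thesis by blast
    qed
    then show "f x = 0" "theta (x^2) \<noteq> 0" "theta (y*x) \<noteq> 0" by auto
  qed
  obtain f1 where f1: "f1 holomorphic_on - {0}" "\<And>x. x \<noteq> 0 \<Longrightarrow> f x = theta (x^2) * f1 x"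
    using holomorphic_divide_theta[OF hol, of 1 1] odd_theta_fun_zero[OF f] by (auto simp: power2_eq_square)
  have "f1 x = 0" if "x \<noteq> 0" "theta (y*x^Suc 0) = 0" for x
    using f1(2)[OF that(1)] yz[of x] that by simp
  then obtain f2 where f2: "f2 holomorphic_on - {0}" "\<And>x. x \<noteq> 0 \<Longrightarrow> f1 x = theta (y*x) * f2 x"
    using holomorphic_divide_theta[OF f1(1) y(1), of 0] by auto
  have "f2 x = 0" if "x \<noteq> 0" "theta (1/y*x^Suc 0) = 0" for x
    using f1(2)[OF that(1)] f2(2)[OF that(1)] yz'[of x] that by simp
  then obtain R where R: "R holomorphic_on - {0}" "\<And>x. x \<noteq> 0 \<Longrightarrow> f2 x = theta (1/y*x) * R x"
    using holomorphic_divide_theta[OF f2(1), of "1/y" 0] y(1) by auto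
  define g where "g = (\<lambda>x. theta (x^2) * theta (y*x) * theta (1/y*x))"
  have fg: "f x = g x * R x" if "x \<noteq> 0" for x
    using f1(2)[OF that] f2(2)[OF that] R(2)[OF that] by (simp add: g_def)
  \<comment> \<open>The multiplier of \<open>g\<close> differs from that of \<open>f\<close> by a
    factor \<open>q\<close> only, so \<open>R (q*x) = R x/q\<close> and the function
    \<open>x * R x\<close> is invariant.\<close>
  have gq: "g (q*x) = g x/(q*x^6)" if x: "x \<noteq> 0" for x
  proof -
    have 1: "theta ((q*x)^2) = theta (x^2)/(q * (x^2)^2)"
      using theta_q2_mult[of "x^2"] x by (simp add: power_mult_distrib)
    have 2: "theta (y * (q*x)) = - theta (y*x)/(y*x)"
      using theta_q_mult[of "y*x"] x y(1) by (simp add: mult.left_commute)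
    have 3: "theta (1/y * (q*x)) = - theta (1/y*x)/(1/y*x)"
      using theta_q_mult[of "1/y*x"] x y(1) by (simp add: mult.left_commute)
    show ?thesis unfolding g_def 1 2 3 using x y(1) q_nz
      by (simp add: field_simps) (simp add: eval_nat_numeral field_simps)
  qed
  define S where "S = - {0} \<inter> g -` (- {0})"
  have ghol: "g holomorphic_on - {0}" unfolding g_def using y(1) by (auto intro!: holomorphic_intros)
  have S: "open S" unfolding S_def
    by (rule continuous_open_preimage[OF holomorphic_on_imp_continuous_on[OF ghol]]) auto
  have zS: "z \<in> S" using z by (simp add: S_def g_def)
  \<comment> \<open>The invariance can be read off only where \<open>g\<close> is nonzero; the
    identity theorem extends it. The point \<open>z\<close> shows that this set is nonempty and
    forces the constant \<open>C\<close> to vanish.\<close>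
  have per: "q*x * R (q*x) = x * R x" if "x \<noteq> 0" for x
  proof (rule analytic_continuation_open[of S "- {0}" "\<lambda>x. q * x * R (q*x)" "\<lambda>x. x * R x"])
    show "S \<noteq> {}" using zS by blast
    show "connected (- {0::complex})"
      by (rule connected_punctured_plane)
    have "(R \<circ> (\<lambda>x. q * x)) holomorphic_on - {0}"
      by (rule holomorphic_on_compose_gen[OF _ R(1)]) (use q_nz in \<open>auto intro!: holomorphic_intros\<close>)
    then show "(\<lambda>x. q * x * R (q*x)) holomorphic_on - {0}" by (auto simp: o_def intro!: holomorphic_intros)
    show "(\<lambda>x. x * R x) holomorphic_on - {0}" using R(1) by (intro holomorphic_intros)
    fix w assume "w \<in> S"
    then have w: "w \<noteq> 0" "g w \<noteq> 0" by (auto simp: S_def)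
    have "g w/(q*w^6) * R (q*w) = g w * R w/(q^2*w^6)"
      using fq[OF w(1)] fg[OF w(1)] fg[of "q*w"] gq[OF w(1)] w q_nz by simp
    then have "R (q*w) = R w/q" using w q_nz by (simp add: field_simps power2_eq_square)
    then show "q*w * R (q*w) = w * R w" using q_nz by simp
  qed (use S that in \<open>auto simp: S_def\<close>)
  have "(\<lambda>x. x * R x) holomorphic_on - {0}" using R(1) by (intro holomorphic_intros)
  then obtain C where C: "\<And>x. x \<noteq> 0 \<Longrightarrow> x * R x = C"
    using q_periodic_constant[of "\<lambda>x. x * R x"] per by blast
  have "R z = 0" using fg[OF z(1)] z(3) zS by (simp add: S_def)
  then have "C = 0" using C[OF z(1)] by simp
  then show ?thesis using fg[OF x] C[OF x] x by simp
qed

text \<open>The factor \<open>1/x\<close> makes the product antisymmetric in \<open>x\<close> and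
  \<open>y\<close>.\<close>

definition theta_pair :: "complex \<Rightarrow> complex \<Rightarrow> complex" where
  "theta_pair x y = theta (x*y) * theta (x/y)/x"

lemma theta_pair_self [simp]: "theta_pair x x = 0"
  by (cases "x = 0") (simp_all add: theta_pair_def)

lemma theta_pair_commute: "x \<noteq> 0 \<Longrightarrow> y \<noteq> 0 \<Longrightarrow> theta_pair y x = - theta_pair x y"
  using theta_inverse[of "x/y"] by (simp add: theta_pair_def mult_ac)

text \<open>Two such functions, for two values of \<open>y\<close>, serve as a Lagrange basis: each
  vanishes at its own \<open>y\<close>.\<close>

lemma odd_theta_fun_basic:
  assumes "y \<noteq> 0"
  shows "odd_theta_fun (\<lambda>x. theta (x^2) * theta_pair x y)"
  unfolding odd_theta_fun_def
proof (intro conjI allI impI)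
  show "(\<lambda>x. theta (x^2) * theta_pair x y) holomorphic_on - {0}"
    unfolding theta_pair_def using assms by (auto intro!: holomorphic_intros)
next
  fix x :: complex assume x: "x \<noteq> 0"
  have 1: "theta ((q*x)^2) = theta (x^2)/(q * (x^2)^2)"
    using theta_q2_mult[of "x^2"] x by (simp add: power_mult_distrib)
  have 2: "theta (q*x*y) = - theta (x*y)/(x*y)"
    using theta_q_mult[of "x*y"] x assms by (simp add: mult.assoc)
  have 3: "theta (q*x/y) = - theta (x/y)/(x/y)"
    using theta_q_mult[of "x/y"] x assms by simp
  show "theta ((q*x)^2) * theta_pair (q*x) y = theta (x^2) * theta_pair x y/(q^2*x^6)"
    unfolding theta_pair_def 1 2 3 using x assms q_nz by (simp add: field_simps) (simp add: eval_nat_numeral field_simps)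
  have 4: "theta ((1/x)^2) = - theta (x^2)/x^2"
    using theta_inverse[of "x^2"] x by (simp add: power_divide)
  have 5: "theta (1/x*y) = - theta (x/y)/(x/y)"
    using theta_inverse[of "x/y"] x assms by simp
  have 6: "theta (1/x/y) = - theta (x*y)/(x*y)"
    using theta_inverse[of "x*y"] x assms by (simp add: mult.commute)
  show "theta ((1/x)^2) * theta_pair (1/x) y = - (theta (x^2) * theta_pair x y)/x^2"
    unfolding theta_pair_def 4 5 6 using x assms by (simp add: field_simps)
qed

lemma odd_theta_fun_combination:
  assumes "odd_theta_fun f" "odd_theta_fun g" "odd_theta_fun h"
  shows "odd_theta_fun (\<lambda>x. f x * a - b * g x + c * h x)"
  using assms unfolding odd_theta_fun_def
  by (auto intro!: holomorphic_intros simp: diff_divide_distrib add_divide_distrib algebra_simps)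

text \<open>Lagrange interpolation at \<open>y\<close> and \<open>z\<close>, multiplied out. As a
  function of \<open>x\<close> the left side is an odd theta function that vanishes at both nodes,
  hence everywhere.\<close>

lemma odd_theta_fun_interpolation:
  assumes f: "odd_theta_fun f" and nz: "x \<noteq> 0" "y \<noteq> 0" "z \<noteq> 0"
    and gen: "theta (y^2) \<noteq> 0" "theta (z^2) \<noteq> 0" "theta (y*z) \<noteq> 0" "theta (y/z) \<noteq> 0"
  shows "f x * (theta (y^2) * theta (z^2) * theta_pair y z) - f y * theta (z^2) * (theta (x^2) * theta_pair x z)
    + f z * theta (y^2) * (theta (x^2) * theta_pair x y) = 0"
proof -
  define \<Delta> where "\<Delta> = (\<lambda>x. f x * (theta (y^2) * theta (z^2) * theta_pair y z) - f y * theta (z^2) * (theta (x^2) * theta_pair x z)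
    + f z * theta (y^2) * (theta (x^2) * theta_pair x y))"
  have "odd_theta_fun \<Delta>" unfolding \<Delta>_def
    by (rule odd_theta_fun_combination[OF f odd_theta_fun_basic[OF nz(3)] odd_theta_fun_basic[OF nz(2)]])
  moreover have "\<Delta> y = 0" by (simp add: \<Delta>_def)
  moreover have "\<Delta> z = 0" using theta_pair_commute[OF nz(2,3)] by (simp add: \<Delta>_def)
  moreover have "theta (z/y) \<noteq> 0" using theta_inverse[of "y/z"] nz gen by simp
  ultimately have "\<Delta> x = 0" using odd_theta_fun_eq_0[of \<Delta> y z x] nz gen by blast
  then show ?thesis by (simp add: \<Delta>_def)
qed

section \<open>The three-term relation between series with the same argument\<close>

text \<open>For five entries in \<open>rs\<close> the argument of this series is
  \<open>q^2/(x * prod_list rs)\<close>, which is symmetric in \<open>x\<close> and the entries. The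
  base can thus be exchanged with an entry without changing the argument.\<close>

definition wp_at :: "complex \<Rightarrow> complex list \<Rightarrow> complex" where
  "wp_at x rs = wp_entire (x^2) (map (\<lambda>r. x * r) rs)"

lemma wp_at_cong_mset: "mset rs = mset rs' \<Longrightarrow> wp_at x rs = wp_at x rs'"
  unfolding wp_at_def by (rule wp_entire_cong_mset) simp

lemma wp_at_holomorphic:
  assumes S: "open S" and x: "x holomorphic_on S" "\<And>s. s \<in> S \<Longrightarrow> x s \<noteq> 0"
    and fs: "\<And>f. f \<in> set fs \<Longrightarrow> f holomorphic_on S" "\<And>f s. f \<in> set fs \<Longrightarrow> s \<in> S \<Longrightarrow> f s \<noteq> 0"
  shows "(\<lambda>s. wp_at (x s) (map (\<lambda>f. f s) fs)) holomorphic_on S"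
proof -
  have "(\<lambda>s. wp_entire (x s^2) (map (\<lambda>f. f s) (map (\<lambda>f s. x s * f s) fs))) holomorphic_on S"
    by (rule wp_entire_holomorphic[OF S]) (use x fs in \<open>auto intro!: holomorphic_intros\<close>)
  then show ?thesis unfolding wp_at_def by (simp add: o_def)
qed

lemma bil_half_cong_mset: "mset ts = mset ts' \<Longrightarrow> bil_half ts y = bil_half ts' y"
proof -
  assume *: "mset ts = mset ts'"
  then have pl: "prod_list ts = prod_list ts'" by (metis prod_mset_prod_list)
  have "bil_term ts y = bil_term ts' y"
    unfolding bil_term_def by (intro ext) (simp only: prod_list_map_cong_mset[OF *] pl)
  then show ?thesis by (simp add: bil_half_def)
qed

text \<open>The parameter \<open>t = x\<close> supplies the factors \<open>qfac (x^2) k\<close> and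
  \<open>qinf (q^Suc k)\<close> that a unilateral series with base \<open>x^2\<close>
  requires.\<close>

lemma bil_half_at_param:
  assumes nz: "x \<noteq> 0" "\<And>r. r \<in> set rs \<Longrightarrow> r \<noteq> 0" and len: "length rs = 5" and arg: "norm (q^2/prod_list (x # rs)) < 1"
  shows "qinf (q^2/prod_list (x # rs)) * bil_half (x # rs) x = (\<Prod>t\<leftarrow>x # rs. qinf (q/(t*x))) * wp_at x rs"
proof -
  have pl: "prod_list (map (\<lambda>r. x * r) us) = x^length us * prod_list us" for us
    by (induction us) simp_all
  have A: "W87_arg q (x^2) (map (\<lambda>r. x * r) rs) = q^2/prod_list (x # rs)"
    unfolding W87_arg_def pl len using nz(1) by (simp add: eval_nat_numeral)
  have m: "(\<Prod>r\<leftarrow>rs. qfac (x*r) k * qinf (x^2*q/(x*r)*q^k)) = (\<Prod>r\<leftarrow>rs. qfac (r*x) k * qinf (x*q/r*q^k))" for k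
    using nz(1) by (intro arg_cong[of _ _ prod_list] map_cong refl) (simp add: power2_eq_square mult.commute)
  have "bil_term (x # rs) x k = (\<Prod>t\<leftarrow>x # rs. qinf (q/(t*x)))
    * (wp_coeff (x^2) (map (\<lambda>r. x * r) rs) k * (q^2/prod_list (x # rs))^k)" for k
    unfolding bil_term_def wp_coeff_def map_map o_def m list.map prod_list.Cons prod_list_mult_map
    using nz(1) by (simp add: power2_eq_square mult_ac)
  then have "bil_term (x # rs) x = (\<lambda>k. (\<Prod>t\<leftarrow>x # rs. qinf (q/(t*x)))
    * (wp_coeff (x^2) (map (\<lambda>r. x * r) rs) k * (q^2/prod_list (x # rs))^k))" by (rule ext)
  then have "bil_half (x # rs) x = (\<Prod>t\<leftarrow>x # rs. qinf (q/(t*x))) * wp_sum (x^2) (map (\<lambda>r. x * r) rs) (q^2/prod_list (x # rs))"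
    unfolding bil_half_def wp_sum_def using suminf_mult[OF wp_summable[OF arg]] by (simp only:)
  then show ?thesis
    unfolding wp_at_def using wp_entire_eq_sum[of "x^2" "map (\<lambda>r. x * r) rs"] arg unfolding A by simp
qed

text \<open>The interpolation relation for the bilateral sum at \<open>t0\<close>,
  \<open>t1\<close>, \<open>t2\<close>, after removal of the common factors
  \<open>qinf (q/(x*y))\<close> with \<open>x, y\<close> among these three. Therefore
  \<open>qinf (t1^2)\<close> stands for \<open>theta (t1^2)\<close>, and
  \<open>qinf (t1*t2) * theta (t1/t2)/t1\<close> for \<open>theta_pair t1 t2\<close>.\<close>

definition same_base_rel :: "complex \<Rightarrow> complex \<Rightarrow> complex \<Rightarrow> complex \<Rightarrow> complex \<Rightarrow> complex \<Rightarrow> complex" where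
  "same_base_rel t0 t1 t2 t3 t4 t5 =
     wp_at t0 [t1, t2, t3, t4, t5] * (qinf (q/(t0*t3)) * qinf (q/(t0*t4)) * qinf (q/(t0*t5)))
    * (qinf (t1^2) * qinf (t2^2)) * (qinf (t1*t2) * theta (t1/t2)/t1)
   - wp_at t1 [t0, t2, t3, t4, t5] * (qinf (q/(t1*t3)) * qinf (q/(t1*t4)) * qinf (q/(t1*t5)))
    * (qinf (t0^2) * qinf (t2^2)) * (qinf (t0*t2) * theta (t0/t2)/t0)
   + wp_at t2 [t0, t1, t3, t4, t5] * (qinf (q/(t2*t3)) * qinf (q/(t2*t4)) * qinf (q/(t2*t5)))
    * (qinf (t0^2) * qinf (t1^2)) * (qinf (t0*t1) * theta (t0/t1)/t0)"

lemma same_base_rel_holomorphic: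
  assumes S: "open S"
    and hol: "f0 holomorphic_on S" "f1 holomorphic_on S" "f2 holomorphic_on S" "f3 holomorphic_on S" "f4 holomorphic_on S" "f5 holomorphic_on S"
    and nz: "\<And>s. s \<in> S \<Longrightarrow> f0 s \<noteq> 0 \<and> f1 s \<noteq> 0 \<and> f2 s \<noteq> 0 \<and> f3 s \<noteq> 0 \<and> f4 s \<noteq> 0 \<and> f5 s \<noteq> 0"
  shows "(\<lambda>s. same_base_rel (f0 s) (f1 s) (f2 s) (f3 s) (f4 s) (f5 s)) holomorphic_on S"
proof -
  have w: "(\<lambda>s. wp_at (x s) [g1 s, g2 s, g3 s, g4 s, g5 s]) holomorphic_on S"
    if sub: "{x, g1, g2, g3, g4, g5} \<subseteq> {f0, f1, f2, f3, f4, f5}" for x g1 g2 g3 g4 g5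
  proof -
    have h: "g holomorphic_on S \<and> (\<forall>s\<in>S. g s \<noteq> 0)" if g: "g \<in> {x, g1, g2, g3, g4, g5}" for g
    proof -
      have "g \<in> {f0, f1, f2, f3, f4, f5}" using g sub by (rule set_rev_mp)
      then show ?thesis by (elim insertE emptyE) (simp_all add: hol nz)
    qed
    have "set [g1, g2, g3, g4, g5] \<subseteq> {x, g1, g2, g3, g4, g5}" by auto
    then have "(\<lambda>s. wp_at (x s) (map (\<lambda>f. f s) [g1, g2, g3, g4, g5])) holomorphic_on S"
      using h by (intro wp_at_holomorphic[OF S]) blast+
    then show ?thesis by simp
  qed
  show ?thesis unfolding same_base_rel_def
    by (intro holomorphic_intros w hol) (use nz in auto)
qed

lemma same_base_rel_generic:
  assumes nz: "t0 \<noteq> 0" "t1 \<noteq> 0" "t2 \<noteq> 0" "t3 \<noteq> 0" "t4 \<noteq> 0" "t5 \<noteq> 0"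
    and arg: "norm (q^2/(t0*t1*t2*t3*t4*t5)) < 1"
    and gen: "theta (t0^2) \<noteq> 0" "theta (t1^2) \<noteq> 0" "theta (t2^2) \<noteq> 0" "theta (t0*t1) \<noteq> 0" "theta (t0*t2) \<noteq> 0"
      "theta (t1*t2) \<noteq> 0" "theta (t1/t2) \<noteq> 0"
  shows "same_base_rel t0 t1 t2 t3 t4 t5 = 0"
proof -
  define ts where "ts = [t0, t1, t2, t3, t4, t5]"
  define z where "z = q^2/(t0*t1*t2*t3*t4*t5)"
  have tsp: "\<And>t. t \<in> set ts \<Longrightarrow> t \<noteq> 0" "norm (q^2/prod_list ts) < 1" "length ts = 6"
    using nz arg by (auto simp: ts_def mult.assoc)
  have odd: "odd_theta_fun (bil_sum ts)"
    unfolding odd_theta_fun_def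
    using bil_sum_holomorphic[OF tsp] bil_sum_q_mult[OF tsp] bil_sum_inverse[OF tsp] by blast
  have H: "qinf z * bil_sum ts x = (\<Prod>t\<leftarrow>x # rs. qinf (q/(t*x))) * wp_at x rs" if "mset ts = mset (x # rs)" for x rs
  proof -
    have set: "set ts = set (x # rs)" and len: "length ts = length (x # rs)" and pl: "prod_list ts = prod_list (x # rs)"
      using that by (metis set_mset_mset, metis size_mset, metis prod_mset_prod_list)
    have zz: "z = q^2/prod_list (x # rs)" unfolding pl[symmetric] z_def ts_def by (simp add: mult.assoc)
    have "bil_sum ts x = bil_half (x # rs) x"
      using bil_sum_at_param[OF tsp, of x] bil_half_cong_mset[OF that] set by simp
    then show ?thesis
      using bil_half_at_param[of x rs] tsp set len arg unfolding zz z_def[symmetric] by auto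
  qed
  have H0: "qinf z * bil_sum ts t0 = (\<Prod>t\<leftarrow>[t0, t1, t2, t3, t4, t5]. qinf (q/(t*t0))) * wp_at t0 [t1, t2, t3, t4, t5]"
    by (rule H) (simp add: ts_def)
  have H1: "qinf z * bil_sum ts t1 = (\<Prod>t\<leftarrow>[t1, t0, t2, t3, t4, t5]. qinf (q/(t*t1))) * wp_at t1 [t0, t2, t3, t4, t5]"
    by (rule H) (simp add: ts_def)
  have H2: "qinf z * bil_sum ts t2 = (\<Prod>t\<leftarrow>[t2, t0, t1, t3, t4, t5]. qinf (q/(t*t2))) * wp_at t2 [t0, t1, t3, t4, t5]"
    by (rule H) (simp add: ts_def)
  have I: "bil_sum ts t0 * (theta (t1^2) * theta (t2^2) * theta_pair t1 t2) - bil_sum ts t1 * theta (t2^2) * (theta (t0^2) * theta_pair t0 t2)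
    + bil_sum ts t2 * theta (t1^2) * (theta (t0^2) * theta_pair t0 t1) = 0"
    by (rule odd_theta_fun_interpolation[OF odd]) (use nz gen in auto)
  define g where "g = (\<lambda>x y. qinf (q/(x*y)))"
  have gc: "qinf (q/(x*y)) = g x y" "g x y = g y x" for x y by (simp_all add: g_def mult.commute)
  have gcs: "g t1 t0 = g t0 t1" "g t2 t0 = g t0 t2" "g t2 t1 = g t1 t2"
    "g t3 t0 = g t0 t3" "g t4 t0 = g t0 t4" "g t5 t0 = g t0 t5"
    "g t3 t1 = g t1 t3" "g t4 t1 = g t1 t4" "g t5 t1 = g t1 t5"
    "g t3 t2 = g t2 t3" "g t4 t2 = g t2 t4" "g t5 t2 = g t2 t5" by (rule gc(2))+
  have th: "theta (x*y) = qinf (x*y) * g x y" "theta (x^2) = qinf (x^2) * g x x" for x y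
    by (simp_all add: theta_def g_def power2_eq_square)
  have gnz: "g t0 t0 \<noteq> 0" "g t1 t1 \<noteq> 0" "g t2 t2 \<noteq> 0" "g t0 t1 \<noteq> 0" "g t0 t2 \<noteq> 0" "g t1 t2 \<noteq> 0"
    using gen unfolding th by auto
  \<comment> \<open>The product of the six \<open>g\<close> factors is exactly what the
    interpolation relation contains in excess of \<open>same_base_rel\<close>; \<open>gen\<close>
    makes it nonzero.\<close>
  have "(g t0 t0 * g t1 t1 * g t2 t2 * g t0 t1 * g t0 t2 * g t1 t2) * same_base_rel t0 t1 t2 t3 t4 t5
    = qinf z * (bil_sum ts t0 * (theta (t1^2) * theta (t2^2) * theta_pair t1 t2) - bil_sum ts t1 * theta (t2^2) * (theta (t0^2) * theta_pair t0 t2)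
    + bil_sum ts t2 * theta (t1^2) * (theta (t0^2) * theta_pair t0 t1))"
    unfolding distrib_left right_diff_distrib mult.assoc[symmetric, of "qinf z"] H0 H1 H2
    unfolding same_base_rel_def theta_pair_def list.map prod_list.Cons prod_list.Nil th gc(1) gcs
    by (simp add: algebra_simps)
  then show ?thesis unfolding I using gnz by simp
qed

lemma countable_theta_zeros:
  assumes "c \<noteq> 0" "i > 0"
  shows "countable {s. s \<noteq> 0 \<and> theta (c * s^i) = 0}"
proof -
  have "{s. s \<noteq> 0 \<and> theta (c * s^i) = 0} \<subseteq> {s. qinf (c * s^i) = 0} \<union> {s. s \<noteq> 0 \<and> qinf (q/c/s^i) = 0}"
    unfolding theta_def by auto
  moreover have "countable \<dots>" using assms q_nz by (intro countable_Un countable_qpoch_inf_zeros) auto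
  ultimately show ?thesis by (rule countable_subset)
qed

lemma same_base_rel_eq_0:
  assumes nz: "t0 \<noteq> 0" "t1 \<noteq> 0" "t2 \<noteq> 0" "t3 \<noteq> 0" "t4 \<noteq> 0" "t5 \<noteq> 0"
  shows "same_base_rel t0 t1 t2 t3 t4 t5 = 0"
proof -
  \<comment> \<open>The conditions \<open>gen\<close> do not involve \<open>t5\<close>. The bound on
    the argument is therefore removed by continuation in \<open>t5\<close> alone, as a large
    \<open>t5\<close> makes the argument small.\<close>
  have step: "same_base_rel t0 t1 t2 t3 t4 t5 = 0"
    if nz: "t0 \<noteq> 0" "t1 \<noteq> 0" "t2 \<noteq> 0" "t3 \<noteq> 0" "t4 \<noteq> 0" "t5 \<noteq> 0"
      and gen: "theta (t0^2) \<noteq> 0" "theta (t1^2) \<noteq> 0" "theta (t2^2) \<noteq> 0" "theta (t0*t1) \<noteq> 0" "theta (t0*t2) \<noteq> 0"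
        "theta (t1*t2) \<noteq> 0" "theta (t1/t2) \<noteq> 0" for t0 t1 t2 t3 t4 t5
  proof -
    define \<kappa> where "\<kappa> = q^2/(t0*t1*t2*t3*t4)"
    have S: "open (- {0::complex})" by auto
    let ?T = "{x \<in> - {0}. norm (\<kappa>/x) < 1}"
    show ?thesis
    proof (rule analytic_continuation_open[of ?T "- {0}" "\<lambda>x. same_base_rel t0 t1 t2 t3 t4 x" "\<lambda>_. 0" t5])
      show "open ?T" by (rule open_norm_less[OF S]) (auto intro!: holomorphic_intros)
      have "norm (\<kappa>/of_real (1 + norm \<kappa>)) < 1"
      proof -
        have "\<bar>1 + norm \<kappa>\<bar> = 1 + norm \<kappa>" using norm_ge_zero[of \<kappa>] by linarith
        then show ?thesis using norm_ge_zero[of \<kappa>] unfolding norm_divide norm_of_real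
          by (simp add: divide_less_eq del: norm_ge_zero)
      qed
      moreover have "complex_of_real (1 + norm \<kappa>) \<noteq> 0"
        using norm_ge_zero[of \<kappa>] by (metis add.commute add_nonneg_eq_0_iff of_real_eq_0_iff zero_le_one zero_neq_one)
      ultimately have "complex_of_real (1 + norm \<kappa>) \<in> ?T" by simp
      then show "?T \<noteq> {}" by (metis empty_iff)
      show "connected (- {0::complex})"
        by (rule connected_punctured_plane)
      show "(\<lambda>x. same_base_rel t0 t1 t2 t3 t4 x) holomorphic_on - {0}"
        by (rule same_base_rel_holomorphic[OF S]) (use nz in \<open>auto intro!: holomorphic_intros\<close>)
      show "same_base_rel t0 t1 t2 t3 t4 x = 0" if "x \<in> ?T" for x
        by (rule same_base_rel_generic) (use nz gen that in \<open>auto simp: \<kappa>_def\<close>)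
    qed (use nz in auto)
  qed
  \<comment> \<open>With the exponents 1, 2, 4 all squares, products and quotients that occur in the
    conditions depend on \<open>s\<close>, with exponents 2, 4, 8, 3, 5, 6 and -2.\<close>
  define F where "F = (\<lambda>s. same_base_rel (t0 * s) (t1 * s^2) (t2 * s^4) t3 t4 t5)"
  have "F holomorphic_on - {0}" unfolding F_def
    by (rule same_base_rel_holomorphic) (use nz in \<open>auto intro!: holomorphic_intros\<close>)
  then have cF: "isCont F 1" by (rule holomorphic_isCont_1)
  define B where "B = {s. s \<noteq> 0 \<and> theta (t0^2 * s^2) = 0} \<union> {s. s \<noteq> 0 \<and> theta (t1^2 * s^4) = 0}
    \<union> {s. s \<noteq> 0 \<and> theta (t2^2 * s^8) = 0} \<union> {s. s \<noteq> 0 \<and> theta (t0*t1 * s^3) = 0} \<union> {s. s \<noteq> 0 \<and> theta (t0*t2 * s^5) = 0}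
    \<union> {s. s \<noteq> 0 \<and> theta (t1*t2 * s^6) = 0} \<union> {s. s \<noteq> 0 \<and> theta (q*t2/t1 * s^2) = 0}"
  have "countable B" unfolding B_def using nz q_nz by (intro countable_Un countable_theta_zeros) auto
  moreover have "F s = 0" if s: "s \<notin> B" "s \<noteq> 0" for s
  proof -
    have e: "(t0 * s)^2 = t0^2 * s^2" "(t1 * s^2)^2 = t1^2 * s^4" "(t2 * s^4)^2 = t2^2 * s^8"
      "t0 * s * (t1 * s^2) = t0*t1 * s^3" "t0 * s * (t2 * s^4) = t0*t2 * s^5" "t1 * s^2 * (t2 * s^4) = t1*t2 * s^6"
      by (simp_all add: power_mult_distrib eval_nat_numeral)
    \<comment> \<open>The quotient has a negative exponent of \<open>s\<close>; the symmetry of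
      \<open>theta\<close> under replacing \<open>x\<close> by \<open>q/x\<close> makes it positive,
      as \<open>countable_theta_zeros\<close> requires.\<close>
    have e7: "q/(t1 * s^2/(t2 * s^4)) = q*t2/t1 * s^2" using s(2) nz by (simp add: eval_nat_numeral)
    have "t1 * s^2/(t2 * s^4) \<noteq> 0" using nz s by simp
    from theta_q_divide[OF this] have e8: "theta (t1 * s^2/(t2 * s^4)) = theta (q*t2/t1 * s^2)" unfolding e7 by simp
    show ?thesis unfolding F_def
      by (rule step; (unfold e e8)?) (use s nz in \<open>simp_all add: B_def\<close>)
  qed
  ultimately have "F 1 = 0" using eq_at_1_if_eq_off_countable[OF cF continuous_const] by blast
  then show ?thesis by (simp add: F_def)
qed

section \<open>The relation that contains the inverted series, and elimination of the base
  \<open>t2\<close>\<close>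

text \<open>For base \<open>t1^2\<close> and the three distinguished parameters
  \<open>t1*t2, t1*t3, t1*t4\<close> the new base is \<open>(\<rho>*t1)^2\<close>. Parameters from
  the group \<open>t1, ..., t4\<close> are dilated by \<open>\<rho>\<close>, while
  \<open>t1*t0\<close> and \<open>t1*t5\<close> stay unchanged as products.\<close>

lemma wp_transformation_at:
  assumes nz: "t0 \<noteq> 0" "t1 \<noteq> 0" "t2 \<noteq> 0" "t3 \<noteq> 0" "t4 \<noteq> 0" "t5 \<noteq> 0" "\<rho> \<noteq> 0"
    and \<rho>: "\<rho>^2 = q/(t1*t2*t3*t4)"
  shows "qinf ((\<rho> * t1)^2) * wp_at t1 [t0, t2, t3, t4, t5]
    = qinf (t1^2) * wp_at (\<rho> * t1) [t0/\<rho>, \<rho> * t2, \<rho> * t3, \<rho> * t4, t5/\<rho>]"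
proof -
  have l: "(\<rho> * t1)^2 = q * (t1^2)^2/(t1*t2 * (t1*t3) * (t1*t4))"
    unfolding power_mult_distrib \<rho> using nz by (simp add: field_simps power2_eq_square)
  have e: "(\<rho> * t1)^2 * (t1*r)/t1^2 = \<rho> * t1 * (\<rho> * r)" for r
    using nz by (simp add: field_simps power2_eq_square)
  have f: "\<rho> * t1 * (r/\<rho>) = t1 * r" for r using nz by simp
  have "qinf ((\<rho> * t1)^2) * wp_entire (t1^2) [t1*t2, t1*t3, t1*t4, t1*t0, t1*t5]
    = qinf (t1^2) * wp_entire ((\<rho> * t1)^2) [\<rho> * t1 * (\<rho> * t2), \<rho> * t1 * (\<rho> * t3), \<rho> * t1 * (\<rho> * t4), t1*t0, t1*t5]"
    using wp_transformation[OF _ _ _ _ _ _ l, of "t1*t0" "t1*t5"] nz unfolding e by simp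
  moreover have "wp_at t1 [t0, t2, t3, t4, t5] = wp_entire (t1^2) [t1*t2, t1*t3, t1*t4, t1*t0, t1*t5]"
    unfolding wp_at_def by (rule wp_entire_cong_mset) simp
  moreover have "wp_at (\<rho> * t1) [t0/\<rho>, \<rho> * t2, \<rho> * t3, \<rho> * t4, t5/\<rho>]
    = wp_entire ((\<rho> * t1)^2) [\<rho> * t1 * (\<rho> * t2), \<rho> * t1 * (\<rho> * t3), \<rho> * t1 * (\<rho> * t4), t1*t0, t1*t5]"
    unfolding wp_at_def by (rule wp_entire_cong_mset) (use nz in \<open>simp add: f\<close>)
  ultimately show ?thesis by simp
qed

text \<open>This is the series based at \<open>r0\<close> for the numbers
  \<open>r_i = q^(1/2)/t_i\<close>, written without the square root.\<close>

abbreviation wp_inverted where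
  "wp_inverted t0 t1 t2 t3 t4 t5 \<equiv> wp_entire (q/t0^2) [q/(t0*t1), q/(t0*t2), q/(t0*t3), q/(t0*t4), q/(t0*t5)]"

text \<open>Two transformations in succession, with intermediate base
  \<open>v = t1*t3*t5/t0\<close>: the parameters with indices 1, 3, 5 are distinguished in one, and
  \<open>t1*t3\<close>, \<open>q/(t0*t2)\<close>, \<open>q/(t0*t4)\<close> in the other. The factor
  \<open>qinf v\<close> enters both and is cancelled.\<close>

lemma wp_transformation_inverted:
  assumes nz: "t0 \<noteq> 0" "t1 \<noteq> 0" "t2 \<noteq> 0" "t3 \<noteq> 0" "t4 \<noteq> 0" "t5 \<noteq> 0" "\<rho> \<noteq> 0"
    and \<rho>: "\<rho>^2 = q/(t1*t2*t3*t4)"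
    and w: "qinf (t1*t3*t5/t0) \<noteq> 0"
  shows "qinf ((t5/\<rho>)^2) * wp_inverted t0 t1 t2 t3 t4 t5
    = qinf (q/t0^2) * wp_at (t5/\<rho>) [\<rho> * t1, \<rho> * t2, \<rho> * t3, \<rho> * t4, t0/\<rho>]"
proof -
  define v where "v = t1*t3*t5/t0"
  have v: "v \<noteq> 0" using nz by (simp add: v_def)
  have l1: "v = q * (q/t0^2)^2/(q/(t0*t1) * (q/(t0*t3)) * (q/(t0*t5)))"
    unfolding v_def using nz q_nz by (simp add: field_simps power2_eq_square)
  have e1: "v * (q/(t0*t1))/(q/t0^2) = t3*t5" "v * (q/(t0*t3))/(q/t0^2) = t1*t5"
    "v * (q/(t0*t5))/(q/t0^2) = t1*t3"
    unfolding v_def using nz q_nz by (simp_all add: field_simps power2_eq_square)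
  have 1: "qinf v * wp_entire (q/t0^2) [q/(t0*t1), q/(t0*t3), q/(t0*t5), q/(t0*t2), q/(t0*t4)]
    = qinf (q/t0^2) * wp_entire v [t3*t5, t1*t5, t1*t3, q/(t0*t2), q/(t0*t4)]"
    using wp_transformation[OF _ _ _ _ _ _ l1, of "q/(t0*t2)" "q/(t0*t4)"] nz q_nz unfolding e1 by simp
  have l2: "(t5/\<rho>)^2 = q * v^2/(t1*t3 * (q/(t0*t2)) * (q/(t0*t4)))"
    unfolding power_divide \<rho> v_def using nz q_nz by (simp add: field_simps power2_eq_square)
  have e2: "(t5/\<rho>)^2 * (t1*t3)/v = t0*t5/\<rho>^2" "(t5/\<rho>)^2 * (q/(t0*t2))/v = t5*t4"
    "(t5/\<rho>)^2 * (q/(t0*t4))/v = t5*t2"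
    unfolding power_divide \<rho> v_def using nz q_nz by (simp_all add: field_simps power2_eq_square)
  have 2: "qinf ((t5/\<rho>)^2) * wp_entire v [t1*t3, q/(t0*t2), q/(t0*t4), t3*t5, t1*t5]
    = qinf v * wp_entire ((t5/\<rho>)^2) [t0*t5/\<rho>^2, t5*t4, t5*t2, t3*t5, t1*t5]"
    using wp_transformation[OF _ _ _ _ _ _ l2, of "t3*t5" "t1*t5"] v nz q_nz unfolding e2 by simp
  have 3: "wp_entire v [t3*t5, t1*t5, t1*t3, q/(t0*t2), q/(t0*t4)] = wp_entire v [t1*t3, q/(t0*t2), q/(t0*t4), t3*t5, t1*t5]"
    by (rule wp_entire_cong_mset) simp
  have 4: "wp_entire (q/t0^2) [q/(t0*t1), q/(t0*t3), q/(t0*t5), q/(t0*t2), q/(t0*t4)]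
    = wp_inverted t0 t1 t2 t3 t4 t5"
    by (rule wp_entire_cong_mset) simp
  have f: "t5/\<rho> * (\<rho> * r) = t5 * r" for r using nz by simp
  have 5: "wp_entire ((t5/\<rho>)^2) [t0*t5/\<rho>^2, t5*t4, t5*t2, t3*t5, t1*t5]
    = wp_at (t5/\<rho>) [\<rho> * t1, \<rho> * t2, \<rho> * t3, \<rho> * t4, t0/\<rho>]"
    unfolding wp_at_def by (rule wp_entire_cong_mset) (use nz in \<open>simp add: f power2_eq_square mult.commute[of t5]\<close>)
  have "qinf v * (qinf ((t5/\<rho>)^2) * wp_inverted t0 t1 t2 t3 t4 t5)
    = qinf v * (qinf (q/t0^2) * wp_at (t5/\<rho>) [\<rho> * t1, \<rho> * t2, \<rho> * t3, \<rho> * t4, t0/\<rho>])"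
    using 1 2 unfolding 3 4 5 by (metis mult.left_commute)
  then show ?thesis using w by (simp add: v_def)
qed

text \<open>The combination of \<open>same_base_rel\<close> and the relation \<open>inverted_base_rel\<close> below in which the
  series based at \<open>t2\<close> cancels.\<close>

definition mixed_rel :: "complex \<Rightarrow> complex \<Rightarrow> complex \<Rightarrow> complex \<Rightarrow> complex \<Rightarrow> complex \<Rightarrow> complex" where
  "mixed_rel t0 t1 t2 t3 t4 t5 =
     wp_at t0 [t1, t2, t3, t4, t5] * (qinf (t1^2) * qinf (q/t0^2))
    * ((qinf (q/(t0*t3)) * qinf (q/(t0*t4)) * qinf (q/(t0*t5)))
    * (qinf (t1*t2) * theta (t1/t2)/t1)
    * (qinf (t1*t3) * qinf (t1*t4) * qinf (t1*t5) * qinf (q/(t0*t2)) * theta (t2*t3*t4*t5)/t1))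
   - wp_at t1 [t0, t2, t3, t4, t5] * (qinf (t0^2) * qinf (q/t0^2))
    * ((qinf (q/(t1*t3)) * qinf (q/(t1*t4)) * qinf (q/(t1*t5)))
    * (qinf (t0*t2) * theta (t0/t2)/t0)
    * (qinf (t1*t3) * qinf (t1*t4) * qinf (t1*t5) * qinf (q/(t0*t2)) * theta (t2*t3*t4*t5)/t1)
    - (qinf (t2*t3) * qinf (t2*t4) * qinf (t2*t5) * qinf (q/(t0*t1)) * theta (t1*t3*t4*t5)/t2)
    * ((qinf (q/(t2*t3)) * qinf (q/(t2*t4)) * qinf (q/(t2*t5)))
    * (qinf (t0*t1) * theta (t0/t1)/t0)))
   + wp_inverted t0 t1 t2 t3 t4 t5
    * (qinf (t0^2) * qinf (t1^2))
    * ((qinf (q/(t3*t4)) * qinf (q/(t3*t5)) * qinf (q/(t4*t5)) * qinf (q^2/(t0*t1*t2*t3*t4*t5)))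
    * (theta (t1/t2)/t1)
    * ((qinf (q/(t2*t3)) * qinf (q/(t2*t4)) * qinf (q/(t2*t5)))
    * (qinf (t0*t1) * theta (t0/t1)/t0)))"

context
  fixes t0 t1 t2 t3 t4 t5 :: complex
  assumes nz: "t0 \<noteq> 0" "t1 \<noteq> 0" "t2 \<noteq> 0" "t3 \<noteq> 0" "t4 \<noteq> 0" "t5 \<noteq> 0"
    and gen: "qinf (q*t1/(t2*t3*t4)) \<noteq> 0" "qinf (q*t2/(t1*t3*t4)) \<noteq> 0"
      "qinf (t5^2*t1*t2*t3*t4/q) \<noteq> 0" "qinf (t1*t3*t5/t0) \<noteq> 0"
begin

text \<open>The three-term relation for the dilated parameters \<open>\<rho> t1, \<dots>, \<rho> t4, t0/\<rho>, t5/\<rho>\<close>, with every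
  series transformed back; the one based at \<open>t5/\<rho>\<close> becomes the series with inverted parameters.\<close>

lemma inverted_base_rel:
  shows "wp_at t1 [t0, t2, t3, t4, t5] * (qinf (t2^2) * qinf (q/t0^2))
    * (qinf (t2*t3) * qinf (t2*t4) * qinf (t2*t5) * qinf (q/(t0*t1))) * (theta (t1*t3*t4*t5)/t2)
    - wp_at t2 [t0, t1, t3, t4, t5] * (qinf (t1^2) * qinf (q/t0^2))
    * (qinf (t1*t3) * qinf (t1*t4) * qinf (t1*t5) * qinf (q/(t0*t2))) * (theta (t2*t3*t4*t5)/t1)
    + wp_inverted t0 t1 t2 t3 t4 t5
    * (qinf (t1^2) * qinf (t2^2))
    * (qinf (q/(t3*t4)) * qinf (q/(t3*t5)) * qinf (q/(t4*t5)) * qinf (q^2/(t0*t1*t2*t3*t4*t5)))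
    * (theta (t1/t2)/t1) = 0"
proof -
  \<comment> \<open>Either square root would do: the relation obtained depends on
    \<open>\<rho>^2\<close> only, apart from an overall factor \<open>1/\<rho>\<close>.\<close>
  define \<rho> where "\<rho> = csqrt (q/(t1*t2*t3*t4))"
  have \<rho>: "\<rho>^2 = q/(t1*t2*t3*t4)" by (simp add: \<rho>_def)
  have \<rho>nz: "\<rho> \<noteq> 0" using \<rho> nz q_nz by (metis divide_eq_0_iff mult_eq_0_iff power_zero_numeral)
  have \<rho>2: "\<rho>^2 = q/(t2*t1*t3*t4)" using \<rho> by (simp add: mult.commute)
  have A1: "qinf ((\<rho> * t1)^2) * wp_at t1 [t0, t2, t3, t4, t5]
    = qinf (t1^2) * wp_at (\<rho> * t1) [t0/\<rho>, \<rho> * t2, \<rho> * t3, \<rho> * t4, t5/\<rho>]"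
    by (rule wp_transformation_at) (use nz \<rho>nz \<rho> in auto)
  have A2: "qinf ((\<rho> * t2)^2) * wp_at t2 [t0, t1, t3, t4, t5]
    = qinf (t2^2) * wp_at (\<rho> * t2) [t0/\<rho>, \<rho> * t1, \<rho> * t3, \<rho> * t4, t5/\<rho>]"
    by (rule wp_transformation_at) (use nz \<rho>nz \<rho>2 in auto)
  have A5: "qinf ((t5/\<rho>)^2) * wp_inverted t0 t1 t2 t3 t4 t5
    = qinf (q/t0^2) * wp_at (t5/\<rho>) [\<rho> * t1, \<rho> * t2, \<rho> * t3, \<rho> * t4, t0/\<rho>]"
    by (rule wp_transformation_inverted) (use nz \<rho>nz \<rho> gen in auto)
  have P: "same_base_rel (\<rho> * t1) (\<rho> * t2) (t5/\<rho>) (\<rho> * t3) (\<rho> * t4) (t0/\<rho>) = 0"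
    by (rule same_base_rel_eq_0) (use nz \<rho>nz in auto)
  have m: "wp_at (\<rho> * t1) [\<rho> * t2, t5/\<rho>, \<rho> * t3, \<rho> * t4, t0/\<rho>] = wp_at (\<rho> * t1) [t0/\<rho>, \<rho> * t2, \<rho> * t3, \<rho> * t4, t5/\<rho>]"
    "wp_at (\<rho> * t2) [\<rho> * t1, t5/\<rho>, \<rho> * t3, \<rho> * t4, t0/\<rho>] = wp_at (\<rho> * t2) [t0/\<rho>, \<rho> * t1, \<rho> * t3, \<rho> * t4, t5/\<rho>]"
    by (rule wp_at_cong_mset, simp)+
  have \<rho>\<rho>: "\<rho> * x * (\<rho> * y) = q/(t1*t2*t3*t4) * (x*y)" for x y
    unfolding \<rho>[symmetric] by (simp add: power2_eq_square mult_ac)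
  have s: "q/(\<rho> * t1 * (\<rho> * t3)) = t2*t4" "q/(\<rho> * t1 * (\<rho> * t4)) = t2*t3"
     "q/(\<rho> * t2 * (\<rho> * t3)) = t1*t4" "q/(\<rho> * t2 * (\<rho> * t4)) = t1*t3" "\<rho> * t1 * (\<rho> * t2) = q/(t3*t4)"
    unfolding \<rho>\<rho> using nz q_nz by simp_all
  have s2: "q/(\<rho> * t1 * (t0/\<rho>)) = q/(t0*t1)" "q/(\<rho> * t2 * (t0/\<rho>)) = q/(t0*t2)"
    "\<rho> * t2 * (t5/\<rho>) = t2*t5" "\<rho> * t1 * (t5/\<rho>) = t1*t5"
    "q/(t5/\<rho> * (\<rho> * t3)) = q/(t3*t5)" "q/(t5/\<rho> * (\<rho> * t4)) = q/(t4*t5)" "\<rho> * t1/(\<rho>*t2) = t1/t2"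
    using \<rho>nz by (simp_all add: mult.commute)
  have "t5/\<rho> * (t0/\<rho>) = t0*t5/\<rho>^2" by (simp add: power2_eq_square mult.commute)
  then have s3: "q/(t5/\<rho> * (t0/\<rho>)) = q^2/(t0*t1*t2*t3*t4*t5)"
    unfolding \<rho> using nz q_nz by (simp add: power2_eq_square mult_ac)
  have "\<rho> * t2/(t5/\<rho>) = \<rho>^2 * (t2/t5)" "\<rho> * t1/(t5/\<rho>) = \<rho>^2 * (t1/t5)"
    by (simp_all add: power2_eq_square)
  then have "\<rho> * t2/(t5/\<rho>) = q/(t1*t3*t4*t5)" "\<rho> * t1/(t5/\<rho>) = q/(t2*t3*t4*t5)"
    unfolding \<rho> using nz by simp_all
  then have s4: "theta (\<rho> * t2/(t5/\<rho>)) = theta (t1*t3*t4*t5)" "theta (\<rho> * t1/(t5/\<rho>)) = theta (t2*t3*t4*t5)"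
    using theta_q_divide nz by simp_all
  define k1 where "k1 = qinf ((\<rho> * t1)^2)"
  define k2 where "k2 = qinf ((\<rho> * t2)^2)"
  define k5 where "k5 = qinf ((t5/\<rho>)^2)"
  have "(\<rho> * t1)^2 = q*t1/(t2*t3*t4)" "(\<rho> * t2)^2 = q*t2/(t1*t3*t4)" "(t5/\<rho>)^2 = t5^2*t1*t2*t3*t4/q"
    unfolding power_mult_distrib power_divide \<rho> using nz by (simp_all add: power2_eq_square mult_ac)
  then have k: "k1 \<noteq> 0" "k2 \<noteq> 0" "k5 \<noteq> 0" using gen by (simp_all add: k1_def k2_def k5_def)
  define E1 where "E1 = wp_at (\<rho> * t1) [t0/\<rho>, \<rho> * t2, \<rho> * t3, \<rho> * t4, t5/\<rho>]"
  define E2 where "E2 = wp_at (\<rho> * t2) [t0/\<rho>, \<rho> * t1, \<rho> * t3, \<rho> * t4, t5/\<rho>]"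
  define E5 where "E5 = wp_at (t5/\<rho>) [\<rho> * t1, \<rho> * t2, \<rho> * t3, \<rho> * t4, t0/\<rho>]"
  define Y1 where "Y1 = wp_at t1 [t0, t2, t3, t4, t5]"
  define Y2 where "Y2 = wp_at t2 [t0, t1, t3, t4, t5]"
  define M where "M = wp_inverted t0 t1 t2 t3 t4 t5"
  define b1 where "b1 = qinf (t1^2)"
  define b2 where "b2 = qinf (t2^2)"
  define b0 where "b0 = qinf (q/t0^2)"
  define c1 where "c1 = (qinf (t2*t3) * qinf (t2*t4) * qinf (t2*t5) * qinf (q/(t0*t1))) * (theta (t1*t3*t4*t5)/t2)"
  define c2 where "c2 = (qinf (t1*t3) * qinf (t1*t4) * qinf (t1*t5) * qinf (q/(t0*t2))) * (theta (t2*t3*t4*t5)/t1)"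
  define c5 where "c5 = (qinf (q/(t3*t4)) * qinf (q/(t3*t5)) * qinf (q/(t4*t5)) * qinf (q^2/(t0*t1*t2*t3*t4*t5)))
    * (theta (t1/t2)/t1)"
  have e: "k1*Y1 = b1*E1" "k2*Y2 = b2*E2" "k5*M = b0*E5"
    using A1 A2 A5 unfolding k1_def k2_def k5_def E1_def E2_def E5_def Y1_def Y2_def M_def b1_def b2_def b0_def .
  have "(E1 * (k2 * k5) * c1 - E2 * (k1 * k5) * c2 + E5 * (k1 * k2) * c5)/\<rho> = 0"
    using P unfolding same_base_rel_def m s s2 s3 s4 E1_def[symmetric] E2_def[symmetric] E5_def[symmetric]
      k1_def[symmetric] k2_def[symmetric] k5_def[symmetric] c1_def c2_def c5_def
    by (simp add: diff_divide_distrib add_divide_distrib mult_ac)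
  then have "E1 * (k2 * k5) * c1 - E2 * (k1 * k5) * c2 + E5 * (k1 * k2) * c5 = 0" using \<rho>nz by simp
  then have "(k1 * k2 * k5) * (Y1 * (b2*b0) * c1 - Y2 * (b1*b0) * c2 + M * (b1*b2) * c5) = 0"
    using e by algebra
  then have "Y1 * (b2*b0) * c1 - Y2 * (b1*b0) * c2 + M * (b1*b2) * c5 = 0" using k by simp
  then show ?thesis unfolding Y1_def Y2_def M_def b1_def b2_def b0_def c1_def c2_def c5_def mult.assoc .
qed

lemma mixed_rel_generic:
  assumes "qinf (t2^2) \<noteq> 0"
  shows "mixed_rel t0 t1 t2 t3 t4 t5 = 0"
proof -
  note P = same_base_rel_eq_0[OF nz, unfolded same_base_rel_def]
  note I = inverted_base_rel
  have "qinf (t2^2) * mixed_rel t0 t1 t2 t3 t4 t5 = 0"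
  proof -
    \<comment> \<open>\<open>Y2\<close> cancels when the same-base relation, multiplied by
      \<open>b*u\<close>, is added to the other one, multiplied by \<open>b0*G2*r01\<close>. Every
      remaining term carries \<open>b2 = qinf (t2^2)\<close>, which is why this factor has to be
      nonzero.\<close>
    have "b2 * (Y0 * (b1*b) * (G0 * r12 * u) - Y1 * (b0*b) * (G1 * r02 * u - w * (G2*r01)) + M * (b0*b1) * (c * r12' * (G2*r01))) = 0"
      if "Y0*G0 * (b1*b2) * r12 - Y1*G1 * (b0*b2) * r02 + Y2*G2 * (b0*b1) * r01 = 0"
        "Y1 * (b2*b) * w1*w2 - Y2 * (b1*b) * u1*u2 + M * (b1*b2) * c * r12' = 0" "w = w1*w2" "u = u1*u2"
      for Y0 Y1 Y2 M G0 G1 G2 b0 b1 b2 b r12 r12' r02 r01 u u1 u2 w w1 w2 c :: complex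
      using that by algebra
    from this[OF P I] show ?thesis unfolding mixed_rel_def by (simp only: times_divide_eq_right)
  qed
  then show ?thesis using assms by simp
qed

end

lemma mixed_rel_eq_0:
  assumes nz: "t0 \<noteq> 0" "t1 \<noteq> 0" "t2 \<noteq> 0" "t3 \<noteq> 0" "t4 \<noteq> 0" "t5 \<noteq> 0"
  shows "mixed_rel t0 t1 t2 t3 t4 t5 = 0"
proof -
  \<comment> \<open>Under this deformation the five quantities that have to avoid zeros scale with
    the exponents -3, 1, 3, 1 and 4 of \<open>s\<close>.\<close>
  define F where "F = (\<lambda>s. mixed_rel t0 t1 (t2 * s^2) (t3 * s) t4 t5)"
  have w: "(\<lambda>s. wp_at x [g1 s, g2 s, g3 s, g4 s, g5 s]) holomorphic_on - {0}"
    if "x \<noteq> 0" "\<And>g. g \<in> {g1, g2, g3, g4, g5} \<Longrightarrow> g holomorphic_on - {0} \<and> (\<forall>s. s \<noteq> 0 \<longrightarrow> g s \<noteq> 0)" for x g1 g2 g3 g4 g5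
  proof -
    have "(\<lambda>s. wp_at x (map (\<lambda>f. f s) [g1, g2, g3, g4, g5])) holomorphic_on - {0}"
      by (rule wp_at_holomorphic) (use that in auto)
    then show ?thesis by simp
  qed
  have "(\<lambda>s. wp_entire (q/t0^2) (map (\<lambda>f. f s) [\<lambda>_. q/(t0*t1), \<lambda>s. q/(t0 * (t2 * s^2)), \<lambda>s. q/(t0 * (t3 * s)), \<lambda>_. q/(t0*t4), \<lambda>_. q/(t0*t5)])) holomorphic_on - {0}"
    by (rule wp_entire_holomorphic) (use nz q_nz in \<open>auto intro!: holomorphic_intros\<close>)
  then have 3: "(\<lambda>s. wp_entire (q/t0^2) [q/(t0*t1), q/(t0 * (t2 * s^2)), q/(t0 * (t3 * s)), q/(t0*t4), q/(t0*t5)]) holomorphic_on - {0}"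
    by simp
  have 1: "(\<lambda>s. wp_at t0 [t1, t2 * s^2, t3 * s, t4, t5]) holomorphic_on - {0}"
    by (rule w) (use nz in \<open>auto intro!: holomorphic_intros\<close>)
  have 2: "(\<lambda>s. wp_at t1 [t0, t2 * s^2, t3 * s, t4, t5]) holomorphic_on - {0}"
    by (rule w) (use nz in \<open>auto intro!: holomorphic_intros\<close>)
  have "F holomorphic_on - {0}"
    unfolding F_def mixed_rel_def by (intro holomorphic_intros 1 2 3) (use nz in auto)
  then have cF: "isCont F 1" by (rule holomorphic_isCont_1)
  define B where "B = {s. s \<noteq> 0 \<and> qinf (q*t1/(t2*t3*t4)/s^3) = 0} \<union> {s. qinf (q*t2/(t1*t3*t4) * s^1) = 0}
    \<union> {s. qinf (t5^2*t1*t2*t3*t4/q * s^3) = 0} \<union> {s. qinf (t1*t3*t5/t0 * s^1) = 0}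
    \<union> {s. qinf (t2^2 * s^4) = 0}"
  have "countable B" unfolding B_def using nz q_nz by (intro countable_Un countable_qpoch_inf_zeros) auto
  moreover have "F s = 0" if s: "s \<notin> B" "s \<noteq> 0" for s
  proof -
    have e: "q*t1/(t2 * s^2 * (t3 * s) * t4) = q*t1/(t2*t3*t4)/s^3"
      "q * (t2 * s^2)/(t1 * (t3 * s) * t4) = q*t2/(t1*t3*t4) * s^1"
      "t5^2*t1 * (t2 * s^2) * (t3 * s) * t4/q = t5^2*t1*t2*t3*t4/q * s^3"
      "t1 * (t3 * s) * t5/t0 = t1*t3*t5/t0 * s^1" "(t2 * s^2)^2 = t2^2 * s^4"
      using s(2) nz by (simp_all add: power_mult_distrib eval_nat_numeral field_simps)
    show ?thesis unfolding F_def
      by (rule mixed_rel_generic; (unfold e)?) (use s nz in \<open>simp_all add: B_def\<close>)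
  qed
  ultimately have "F 1 = 0" using eq_at_1_if_eq_off_countable[OF cF continuous_const] by blast
  then show ?thesis by (simp add: F_def)
qed

text \<open>The substitution \<open>t0 = t\<close>, \<open>t1 = b/t\<close>, ...,
  \<open>t5 = f/t\<close> with \<open>t^2 = a\<close> returns to the original parameters:
  \<open>t0*t1\<close> is \<open>b\<close>, \<open>t1^2\<close> is \<open>b^2/a\<close> and
  \<open>t1*t2\<close> is \<open>b*c/a\<close>.\<close>

lemma mixed_rel_params:
  assumes nz: "a \<noteq> 0" "b \<noteq> 0" "c \<noteq> 0" "d \<noteq> 0" "e \<noteq> 0" "f \<noteq> 0"
  shows "wp_entire a [b, c, d, e, f] * (qinf (b^2/a) * qinf (q/a))
    * ((qinf (q/d) * qinf (q/e) * qinf (q/f))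
    * (qinf (b*c/a) * theta (b/c))
    * (qinf (b*d/a) * qinf (b*e/a) * qinf (b * f/a) * qinf (q/c) * theta (c*d*e * f/a^2)))
   - wp_entire (b^2/a) [b, b*c/a, b*d/a, b*e/a, b * f/a] * (qinf a * qinf (q/a))
    * (b/a * ((qinf (a*q/(b*d)) * qinf (a*q/(b*e)) * qinf (a*q/(b*f)))
    * (qinf c * theta (a/c))
    * (qinf (b*d/a) * qinf (b*e/a) * qinf (b * f/a) * qinf (q/c) * theta (c*d*e * f/a^2)))
    - b^2/(a*c) * ((qinf (c*d/a) * qinf (c*e/a) * qinf (c * f/a) * qinf (q/b) * theta (b*d*e * f/a^2))
    * ((qinf (a*q/(c*d)) * qinf (a*q/(c*e)) * qinf (a*q/(c*f)))
    * (qinf b * theta (a/b)))))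
   + wp_entire (q/a) [q/b, q/c, q/d, q/e, q/f]
    * (qinf a * qinf (b^2/a))
    * (b/a * ((qinf (a*q/(d*e)) * qinf (a*q/(d*f)) * qinf (a*q/(e*f)) * qinf (a^2*q^2/(b*c*d*e*f)))
    * theta (b/c)
    * ((qinf (a*q/(c*d)) * qinf (a*q/(c*e)) * qinf (a*q/(c*f)))
    * (qinf b * theta (a/b))))) = 0"
proof -
  define t where "t = csqrt a"
  have t2: "t^2 = a" by (simp add: t_def)
  have t: "t \<noteq> 0" using t2 nz by auto
  have tt: "t*t = a" using t2 by (simp add: power2_eq_square)
  have R: "mixed_rel t (b/t) (c/t) (d/t) (e/t) (f/t) = 0"
    by (rule mixed_rel_eq_0) (use nz t in auto)
  have p: "x/t * (y/t) = x*y/a" "t * (x/t) = x" "x/t*t = x" "(x/t)^2 = x^2/a" "x/t/(y/t) = x/y" "t/(x/t) = a/x" for x y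
    using t by (simp_all add: tt[symmetric] power2_eq_square)
  have p4: "w*x/a * (y/t) * (z/t) = w*x*y*z/a^2" for w x y z
    using t by (simp add: tt[symmetric] power2_eq_square)
  have pz: "q^2/(b * (c/t) * (d/t) * (e/t) * (f/t)) = a^2*q^2/(b*c*d*e*f)"
    using t by (simp add: t2[symmetric] power2_eq_square mult_ac)
  have w0: "wp_at t [b/t, c/t, d/t, e/t, f/t] = wp_entire a [b, c, d, e, f]"
    unfolding wp_at_def t2 using t by simp
  have w1: "wp_at (b/t) [t, c/t, d/t, e/t, f/t] = wp_entire (b^2/a) [b, b*c/a, b*d/a, b*e/a, b * f/a]"
    unfolding wp_at_def p list.map ..
  have dq: "q/(x*y/a) = a*q/(x*y)" for x y by (simp add: mult.commute)
  define T where "T = b/t"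
  \<comment> \<open>The relation still contains products of two reciprocals of
    \<open>t0, t1, t2\<close>. Multiplication by \<open>t1^2\<close> makes them rational in
    \<open>a\<close>, \<open>b\<close>, \<open>c\<close>, as listed in \<open>sc\<close>.\<close>
  have R1: "(T*T) * mixed_rel t (b/t) (c/t) (d/t) (e/t) (f/t) = 0" using R by simp
  have sc: "1/T * (1/T) * (T*T) = 1" "1/t * (1/T) * (T*T) = b/a" "1/(c/t) * (1/t) * (T*T) = b^2/(a*c)" "1/T * (1/t) * (T*T) = b/a"
    using nz t unfolding T_def by (simp_all add: tt[symmetric] power2_eq_square mult.commute)
  have eq: "k * (Y0*B0 * (G0 * (p12 * r12/T) * (U/T)) - Y1*B1 * (G1 * (p02 * r02/t) * (U/T) - W/(c/t) * (G2 * (p01 * r01/t)))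
    + M*B2 * (C * (r12/T) * (G2 * (p01 * r01/t))))
    = Y0*B0 * (G0 * (p12*r12) * U) - Y1*B1 * (b/a * (G1 * (p02*r02) * U) - b^2/(a*c) * (W * (G2 * (p01*r01))))
    + M*B2 * (b/a * (C * r12 * (G2 * (p01*r01))))" (is "?L = _")
    if "1/T * (1/T) * k = 1" "1/t * (1/T) * k = b/a" "1/(c/t) * (1/t) * k = b^2/(a*c)" "1/T * (1/t) * k = b/a"
    for k Y0 Y1 M B0 B1 B2 G0 G1 G2 p12 r12 p02 r02 p01 r01 U W C
  proof -
    have "?L
    = Y0*B0 * (G0 * (p12*r12) * U * (1/T * (1/T) * k)) - Y1*B1 * (1/t * (1/T) * k * (G1 * (p02*r02) * U)
    - 1/(c/t) * (1/t) * k * (W * (G2 * (p01*r01)))) + M*B2 * (1/T * (1/t) * k * (C * r12 * (G2 * (p01*r01))))"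
      by (simp only: divide_inverse) algebra
    then show ?thesis unfolding that by (simp only: mult_1_right)
  qed
  show ?thesis
    using R1[unfolded mixed_rel_def, folded T_def, unfolded eq[OF sc], unfolded T_def w0 w1 p p4 pz t2 dq] .
qed

section \<open>Matching the coefficients with those of the theorem\<close>

lemma theta_swap: "x \<noteq> 0 \<Longrightarrow> y \<noteq> 0 \<Longrightarrow> theta (x/y) = - (x/y) * (qinf (y/x) * qinf (x*q/y))"
  using theta_inverse[of "y/x"] by (simp add: theta_def mult.commute)

text \<open>In the bracket of the theorem the pairs with \<open>c*f\<close> and \<open>b*f\<close>
  are shifted by \<open>q\<close> against those with \<open>d\<close> and \<open>e\<close>. Each
  shift costs a monomial factor, and the two together account for a quotient
  \<open>b/c\<close>.\<close>

lemma theta_shifted: "x \<noteq> 0 \<Longrightarrow> y \<noteq> 0 \<Longrightarrow> z \<noteq> 0 \<Longrightarrow>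
   qinf (x*y*q/z) * qinf (z/(x*y)) = - (z/(x*y)) * (qinf (x*y/z) * qinf (z*q/(x*y)))"
  using theta_q_mult[of "x*y/z"] q_nz by (simp add: theta_def mult_ac)

end

theorem mainTheorem10:
  fixes q a b c d e f :: complex
  assumes q: "0 < norm q" "norm q < 1"
    and nonzero: "a \<noteq> 0" "b \<noteq> 0" "c \<noteq> 0" "d \<noteq> 0" "e \<noteq> 0" "f \<noteq> 0"
    and nonsingular_W:
      "(a, [b, c, d, e, f]) \<in> W87_domain q"
      "(q/a, [q/b, q/c, q/d, q/e, q/f]) \<in> W87_domain q"
      "(b^2/a, [b, b*c/a, b*d/a, b*e/a, b*f/a]) \<in> W87_domain q"
    and nonzero_denominators:
      "qpochs_inf q [q^2/a, q/c, q/d, q/e, q/f, a*q/c, a*q/d, a*q/e, a*q/f,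
                     b*c/a, b*d/a, b*e/a, b*f/a, c*d*e*f/a^2, a^2*q/(c*d*e*f)] \<noteq> 0"
      "qpochs_inf q [b^2*q/a, q/d, q/e, q/f, c/b, a*q/b, a*q/d, a*q/e, a*q/f, b*c/a] \<noteq> 0"
      "qpochs_inf q [c, q/c, a/c, c*q/a, b*d/a, a*q/(b*d), b*e/a, a*q/(b*e),
                     b*f*q/a, a/(b*f), c*d*e*f/a^2, a^2*q/(c*d*e*f)] \<noteq> 0"
  shows "W87 q a [b, c, d, e, f] =
      qpochs_inf q [a*q, b, b/a, b*q/a, c*q/a, d*q/a, e*q/a, f*q/a,
                    a*q/(c*d), a*q/(c*e), a*q/(c*f), a*q/(d*e), a*q/(d*f), a*q/(e*f),
                    b*c*d*e*f/(a^2*q)]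
      / qpochs_inf q [q^2/a, q/c, q/d, q/e, q/f, a*q/c, a*q/d, a*q/e, a*q/f,
                      b*c/a, b*d/a, b*e/a, b*f/a, c*d*e*f/a^2, a^2*q/(c*d*e*f)]
      * W87 q (q/a) [q/b, q/c, q/d, q/e, q/f]
    + qpochs_inf q [a*q, c, c/a, b*q/a, b*q/d, b*q/e, b*q/f, a*q/(b*d), a*q/(b*e), a*q/(b*f)]
      / qpochs_inf q [b^2*q/a, q/d, q/e, q/f, c/b, a*q/b, a*q/d, a*q/e, a*q/f, b*c/a]
      * (1 - qpochs_inf q [b, q/b, a/b, b*q/a, c*d/a, a*q/(c*d), c*e/a, a*q/(c*e),
                           c*f*q/a, a/(c*f), b*d*e*f/a^2, a^2*q/(b*d*e*f)]
             / qpochs_inf q [c, q/c, a/c, c*q/a, b*d/a, a*q/(b*d), b*e/a, a*q/(b*e),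
                             b*f*q/a, a/(b*f), c*d*e*f/a^2, a^2*q/(c*d*e*f)])
      * W87 q (b^2/a) [b, b*c/a, b*d/a, b*e/a, b*f/a]"
proof -
  interpret q_base q by unfold_locales (use q in auto)
  let ?P = "qpoch_inf q"
  let ?G1 = "?P (a*q/(b*d)) * ?P (a*q/(b*e)) * ?P (a*q/(b*f))"
  let ?G2 = "?P (a*q/(c*d)) * ?P (a*q/(c*e)) * ?P (a*q/(c*f))"
  let ?G3 = "?P (a*q/(d*e)) * ?P (a*q/(d*f)) * ?P (a*q/(e*f))"
  let ?X = "?P (c*d*e*f/a^2) * ?P (a^2*q/(c*d*e*f))"
  let ?Y = "?P (b*d*e*f/a^2) * ?P (a^2*q/(b*d*e*f))"
  let ?U = "?P (b*d/a) * ?P (b*e/a) * ?P (b*f/a) * ?P (q/c)"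
  let ?V = "?P (b*q/a) * ?P (c*q/a) * ?P (d*q/a) * ?P (e*q/a) * ?P (f*q/a)"
  let ?W = "?P (b*q/a) * ?P (b*q/c) * ?P (b*q/d) * ?P (b*q/e) * ?P (b*q/f)"
  let ?N = "?P (a*q/b) * ?P (a*q/c) * ?P (a*q/d) * ?P (a*q/e) * ?P (a*q/f)"
  note nz = nonzero
  note dom1 = W87_domainD[OF nonsingular_W(1)] and dom2 = W87_domainD[OF nonsingular_W(2)] and dom3 = W87_domainD[OF nonsingular_W(3)]
  define W0 where "W0 = W87 q a [b, c, d, e, f]"
  define W1 where "W1 = W87 q (b^2/a) [b, b*c/a, b*d/a, b*e/a, b*f/a]"
  define W2 where "W2 = W87 q (q/a) [q/b, q/c, q/d, q/e, q/f]"
  define z where "z = a^2*q^2/(b*c*d*e*f)"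
  \<comment> \<open>The domain conditions make the divisor in \<open>wp_fun\<close> nonzero, so the
    cleared series can be expressed by the value of \<open>W87\<close>.\<close>
  have Y0: "wp_entire a [b, c, d, e, f] = W0 * ((1 - a) * ?P q * ?N * ?P z)"
    unfolding W0_def W87_eq[OF nonsingular_W(1)] wp_fun_def W87_arg_1 z_def
    using dom1(3) dom1(5)[of b] dom1(5)[of c] dom1(5)[of d] dom1(5)[of e] dom1(5)[of f] dom1(6)[unfolded W87_arg_1] qpoch_inf_q_nz
    by simp
  have s1: "b^2/a*q/b = b*q/a" "b^2/a*q/(b*x/a) = b*q/x" for x
    using nz q_nz by (simp_all add: power2_eq_square)
  have s2: "q/a*q/(q/x) = x*q/a" for x using q_nz by simp
  have p1: "?P (b*q/a) \<noteq> 0" "?P (b*q/c) \<noteq> 0" "?P (b*q/d) \<noteq> 0" "?P (b*q/e) \<noteq> 0" "?P (b*q/f) \<noteq> 0"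
    using dom3(5)[of b] dom3(5)[of "b*c/a"] dom3(5)[of "b*d/a"] dom3(5)[of "b*e/a"] dom3(5)[of "b*f/a"] by (simp_all only: s1 list.set insert_iff simp_thms)
  have p2: "?P (b*q/a) \<noteq> 0" "?P (c*q/a) \<noteq> 0" "?P (d*q/a) \<noteq> 0" "?P (e*q/a) \<noteq> 0" "?P (f*q/a) \<noteq> 0"
    using dom2(5)[of "q/b"] dom2(5)[of "q/c"] dom2(5)[of "q/d"] dom2(5)[of "q/e"] dom2(5)[of "q/f"] by (simp_all only: s2 list.set insert_iff simp_thms)
  have Y1: "wp_entire (b^2/a) [b, b*c/a, b*d/a, b*e/a, b*f/a]
    = W1 * ((1 - b^2/a) * ?P q * ?W * ?P z)"
    unfolding W1_def W87_eq[OF nonsingular_W(3)] wp_fun_def W87_arg_3[OF nz] z_def list.map prod_list.Cons prod_list.Nil s1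
    using nz dom3(3) p1 dom3(6)[unfolded W87_arg_3[OF nz]] qpoch_inf_q_nz by simp
  have Y2: "wp_entire (q/a) [q/b, q/c, q/d, q/e, q/f]
    = W2 * ((1 - q/a) * ?P q * ?V * ?P (b*c*d*e*f/(a^2*q)))"
    unfolding W2_def W87_eq[OF nonsingular_W(2)] wp_fun_def W87_arg_2[OF q_nz nz] list.map prod_list.Cons prod_list.Nil s2
    using nz dom2(3) p2 dom2(6)[unfolded W87_arg_2[OF q_nz nz]] qpoch_inf_q_nz by simp
  have dn1: "?P (q^2/a) \<noteq> 0" "?P (q/c) \<noteq> 0" "?P (q/d) \<noteq> 0" "?P (q/e) \<noteq> 0" "?P (q/f) \<noteq> 0" "?P (a*q/c) \<noteq> 0" "?P (a*q/d) \<noteq> 0"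
    "?P (a*q/e) \<noteq> 0" "?P (a*q/f) \<noteq> 0" "?P (b*c/a) \<noteq> 0" "?P (b*d/a) \<noteq> 0" "?P (b*e/a) \<noteq> 0" "?P (b*f/a) \<noteq> 0"
    "?P (c*d*e*f/a^2) \<noteq> 0" "?P (a^2*q/(c*d*e*f)) \<noteq> 0"
    and dn2: "?P (b^2*q/a) \<noteq> 0" "?P (c/b) \<noteq> 0" "?P (a*q/b) \<noteq> 0"
    and dn3: "?P c \<noteq> 0" "?P (a/c) \<noteq> 0" "?P (c*q/a) \<noteq> 0" "?P (a*q/(b*d)) \<noteq> 0" "?P (a*q/(b*e)) \<noteq> 0" "?P (b*f*q/a) \<noteq> 0" "?P (a/(b*f)) \<noteq> 0"
    using nonzero_denominators unfolding qpochs_inf_def list.map prod_list.Cons by auto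
  have th: "theta (c*d*e*f/a^2) = ?P (c*d*e*f/a^2) * ?P (a^2*q/(c*d*e*f))" "theta (b*d*e*f/a^2) = ?P (b*d*e*f/a^2) * ?P (a^2*q/(b*d*e*f))"
    "theta (a/c) = ?P (a/c) * ?P (c*q/a)" "theta (a/b) = ?P (a/b) * ?P (b*q/a)"
    by (simp_all add: theta_def mult.commute)
  have sw: "theta (b/c) = - (b/c) * (?P (c/b) * ?P (b*q/c))" "?P (a/c) * ?P (c*q/a) = - (a/c) * (?P (c/a) * ?P (a*q/c))"
    "?P (a/b) * ?P (b*q/a) = - (a/b) * (?P (b/a) * ?P (a*q/b))"
    using theta_swap nz th(3,4) by metis+
  have sh: "?P (c*f*q/a) * ?P (a/(c*f)) = - (a/(c*f)) * (?P (c*f/a) * ?P (a*q/(c*f)))"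
    "?P (b*f*q/a) * ?P (a/(b*f)) = - (a/(b*f)) * (?P (b*f/a) * ?P (a*q/(b*f)))"
    using theta_shifted nz by auto
  have st: "?P a = (1 - a) * ?P (a*q)" "?P (b^2/a) = (1 - b^2/a) * ?P (b^2*q/a)" "?P (q/a) = (1 - q/a) * ?P (q^2/a)"
    using qpoch_inf_step[of a] qpoch_inf_step[of "b^2/a"] qpoch_inf_step[of "q/a"] by (simp_all add: power2_eq_square)
  \<comment> \<open>After cancellation of \<open>D\<close>, the coefficient of \<open>W0\<close> is
    \<open>- (b/c) * K\<close>. Both quotients of the theorem are brought to the denominator
    \<open>K\<close>.\<close>
  define K where "K = ?P (a*q/b) * ?P (a*q/c) * ?P (a*q/d) * ?P (a*q/e) * ?P (a*q/f) * (?P (q/d) * ?P (q/e) * ?P (q/f)) * ?P (b^2*q/a) * ?P (b*c/a)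
    * (?P (c/b) * ?P (b*q/c)) * ?U * ?X * ?P (q^2/a)"
  have K: "K \<noteq> 0" unfolding K_def using dn1 dn2 p1 by simp
  \<comment> \<open>The factors common to all three terms. In the term with the inverted series
    \<open>?P z\<close> comes from the coefficient, in the other two from the normalisation of the
    series.\<close>
  define D where "D = (1 - a) * ?P q * ?P z * (1 - b^2/a) * (1 - q/a)"
  have D: "D \<noteq> 0" unfolding D_def using dom1(3,6) dom2(3) dom3(3) qpoch_inf_q_nz unfolding W87_arg_1 z_def by simp
  \<comment> \<open>The coefficient of the third series is a difference of two products.
    \<open>T1\<close> becomes the prefactor of the bracket and \<open>T2\<close> divided by
    \<open>T1\<close> the fraction inside it.\<close>
  define T1 where "T1 = b/a * (?G1 * (?P c * (?P (a/c) * ?P (c*q/a)))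
    * (?P (b*d/a) * ?P (b*e/a) * ?P (b*f/a) * ?P (q/c) * ?X))"
  define T2 where "T2 = b^2/(a*c) * ((?P (c*d/a) * ?P (c*e/a) * ?P (c*f/a) * ?P (q/b) * ?Y)
    * (?G2 * (?P b * (?P (a/b) * ?P (b*q/a)))))"
  define pre where "pre = ?P (b*q/a) * ?P (b*q/c) * ?P (b*q/d) * ?P (b*q/e) * ?P (b*q/f) * ?P (q^2/a) * ?P (a*q)"
  define S2 where "S2 = ?P (a*q) * ?P (b^2*q/a) * (b/a * (?G3 * (?P (c/b) * ?P (b*q/c))
    * (?G2 * (?P b * (?P (a/b) * ?P (b*q/a))))))
    * ?V * ?P (b*c*d*e*f/(a^2*q))"
  have "D * (- (b/c) * (K*W0) - pre * (T1 - T2) * W1 - (b/c) * S2*W2) = 0"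
    using mixed_rel_params[OF nz] unfolding Y0 Y1 Y2 st th sw(1) z_def[symmetric]
    unfolding D_def K_def pre_def T1_def T2_def S2_def by (simp only: mult_minus_left mult_minus_right) algebra
  then have "- (b/c) * (K*W0) - pre * (T1 - T2) * W1 - (b/c) * S2*W2 = 0" using D by (metis mult_eq_0_iff)
  then have main: "- (b/c) * (K*W0) = pre * (T1 - T2) * W1 + (b/c) * S2*W2" by (simp add: algebra_simps)
  define An where "An = qpochs_inf q [a*q, b, b/a, b*q/a, c*q/a, d*q/a, e*q/a, f*q/a,
                    a*q/(c*d), a*q/(c*e), a*q/(c*f), a*q/(d*e), a*q/(d*f), a*q/(e*f),
                    b*c*d*e*f/(a^2*q)]"
  define Ad where "Ad = qpochs_inf q [q^2/a, q/c, q/d, q/e, q/f, a*q/c, a*q/d, a*q/e, a*q/f,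
                      b*c/a, b*d/a, b*e/a, b*f/a, c*d*e*f/a^2, a^2*q/(c*d*e*f)]"
  define Bn where "Bn = qpochs_inf q [a*q, c, c/a, b*q/a, b*q/d, b*q/e, b*q/f, a*q/(b*d), a*q/(b*e), a*q/(b*f)]"
  define Bd where "Bd = qpochs_inf q [b^2*q/a, q/d, q/e, q/f, c/b, a*q/b, a*q/d, a*q/e, a*q/f, b*c/a]"
  define rn where "rn = qpochs_inf q [b, q/b, a/b, b*q/a, c*d/a, a*q/(c*d), c*e/a, a*q/(c*e),
                           c*f*q/a, a/(c*f), b*d*e*f/a^2, a^2*q/(b*d*e*f)]"
  define rd where "rd = qpochs_inf q [c, q/c, a/c, c*q/a, b*d/a, a*q/(b*d), b*e/a, a*q/(b*e),
                             b*f*q/a, a/(b*f), c*d*e*f/a^2, a^2*q/(c*d*e*f)]"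
  have den: "Ad \<noteq> 0" "Bd \<noteq> 0" "rd \<noteq> 0" using nonzero_denominators unfolding Ad_def Bd_def rd_def .
  have h2: "- S2 * Ad = K * An"
  proof -
    have "S2 = - (?P (a*q) * ?P (b^2*q/a) * (?G3 * (?P (c/b) * ?P (b*q/c))
    * (?G2 * (?P b * (?P (b/a) * ?P (a*q/b)))))
    * ?V * ?P (b*c*d*e*f/(a^2*q)))"
      unfolding S2_def sw(3) using nz by simp
    then show ?thesis unfolding Ad_def K_def An_def qpochs_inf_def list.map prod_list.Cons prod_list.Nil
      by (simp only: minus_minus mult_minus_left mult_ac mult_1_right)
  qed
  have h1: "T2 * rd = T1 * rn"
  proof -
    have rd: "rd = - (a/(b*f)) * (?P c * ?P (q/c) * (?P (a/c) * ?P (c*q/a)) * ?P (b*d/a) * ?P (a*q/(b*d)) * ?P (b*e/a) * ?P (a*q/(b*e))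
    * (?P (b*f/a) * ?P (a*q/(b*f))) * ?P (c*d*e*f/a^2) * ?P (a^2*q/(c*d*e*f)))"
      unfolding rd_def qpochs_inf_def list.map prod_list.Cons prod_list.Nil using sh(2) by algebra
    have rn: "rn = - (a/(c*f)) * (?P b * ?P (q/b) * (?P (a/b) * ?P (b*q/a)) * ?P (c*d/a) * ?P (a*q/(c*d)) * ?P (c*e/a) * ?P (a*q/(c*e))
    * (?P (c*f/a) * ?P (a*q/(c*f))) * ?P (b*d*e*f/a^2) * ?P (a^2*q/(b*d*e*f)))"
      unfolding rn_def qpochs_inf_def list.map prod_list.Cons prod_list.Nil using sh(1) by algebra
    \<comment> \<open>The monomials of \<open>T1\<close> and \<open>T2\<close> differ by
      \<open>b/c\<close>, which is exactly what the two shifted pairs in \<open>rd\<close> and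
      \<open>rn\<close> contribute.\<close>
    have sc: "b^2/(a*c) * (a/(b*f)) = b/a * (a/(c*f))" using nz by (simp add: field_simps power2_eq_square)
    show ?thesis unfolding rd rn T1_def T2_def using sc by algebra
  qed
  have h3: "- (c/b) * pre * T1 * Bd = K * Bn"
  proof -
    have sc: "c/b * (b/a) * (a/c) = 1" using nz by simp
    show ?thesis unfolding pre_def T1_def sw(2) Bd_def K_def Bn_def qpochs_inf_def list.map prod_list.Cons prod_list.Nil
      using sc by algebra
  qed
  have A: "An/Ad = - S2/K"
    by (rule iffD2[OF frac_eq_eq[OF den(1) K]]) (simp only: h2 mult.commute[of An])
  have B: "Bn/Bd = - (c/b) * pre * T1/K"
    by (rule iffD2[OF frac_eq_eq[OF den(2) K]]) (simp only: h3 mult.commute[of Bn])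
  have r: "T1 * (1 - rn/rd) = T1 - T2" using h1 den by (simp add: field_simps)
  have "W0 = - (c/b) * (pre * (T1 - T2))/K*W1 + - S2/K*W2"
  proof -
    have "- (c/b) * (- (b/c) * (K*W0)) = - (c/b) * (pre * (T1 - T2) * W1 + (b/c) * S2*W2)" unfolding main ..
    then have "K*W0 = - (c/b) * (pre * (T1 - T2)) * W1 - S2*W2" using nz by (simp add: distrib_left)
    moreover have "K*W0 = u*W1 - S2 * W2 \<Longrightarrow> W0 = u/K*W1 + - S2/K*W2" for u
      using K by (simp add: field_simps)
    ultimately show ?thesis by blast
  qed
  also have "- (c/b) * (pre * (T1 - T2))/K = Bn/Bd * (1 - rn/rd)"
    unfolding B r[symmetric] by simp
  also have "- S2/K = An/Ad" using A by simp
  finally have "W0 = An/Ad * W2 + Bn/Bd * (1 - rn/rd) * W1" by simp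
  then show ?thesis unfolding W0_def W1_def W2_def An_def Ad_def Bn_def Bd_def rn_def rd_def .
qed

end
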